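(* Let $A$ be a finite-dimensional unital algebra over an algebraically closed field $K$ with $\Lambda_0\neq\emptyset$, and let $B=\operatorname{End}_A\bigl(\bigoplus_{\lambda\in\Lambda_0}P^\lambda\bigr)$. If the map $'$ is an involution on $\Lambda_0$, then for any appropriate basis $\Upsilon$ of $B$ the bilinear form $(-,-)_{\mathrm{tr}}$ induced by the canonical form $\mathrm{tr}$ attached to $\Upsilon$ is non-degenerate. In other words, $B$ is a Frobenius algebra over $K$. In particular, if the $K$-algebra $A$ is equipped with a $K$-linear anti-involution $\ast$ satisfying $(L^\lambda)^\ast\cong L^\lambda$ for every $\lambda\in\Lambda$, then $B$ is a Frobenius algebra over $K$.
   Context: $A\text{-mod}$ is the category of finite-dimensional $A$-modules; $\{L^\lambda\mid\lambda\in\Lambda\}$ is a complete set of pairwise non-isomorphic simple $A$-modules ($\Lambda$ finite); $P^\lambda$ and $I^\lambda$ are the projective cover and injective envelope of $L^\lambda$. $\Lambda_0:=\{\lambda\in\Lambda\mid P^\lambda\text{ is injective}\}$. For $\lambda\in\Lambda_0$ let $\lambda'\in\Lambda$ be the unique element with $P^\lambda\cong I^{\lambda'}$, equivalently $\operatorname{soc}(P^\lambda)\cong L^{\lambda'}$. "The map $'$ is an involution on $\Lambda_0$" means $\lambda'\in\Lambda_0$ and $(\lambda')'=\lambda$ for all $\lambda\in\Lambda_0$. We regard $B=\bigoplus_{\lambda,\mu\in\Lambda_0}\operatorname{Hom}_A(P^\lambda,P^\mu)$. When $'$ is an involution on $\Lambda_0$, for each $\lambda\in\Lambda_0$ there is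 a unique up to scalar nonzero $\theta_\lambda\in\operatorname{Hom}_A(P^\lambda,P^{\lambda'})$ with $\operatorname{Im}(\theta_\lambda)=\operatorname{soc}(P^{\lambda'})$; fix one for each $\lambda$. A $K$-basis $\Upsilon$ of $B$ is appropriate if $\{\theta_\lambda\mid\lambda\in\Lambda_0\}\subseteq\Upsilon\subseteq\bigsqcup_{\lambda,\mu\in\Lambda_0}\operatorname{Hom}_A(P^\lambda,P^\mu)$. The canonical form attached to $\Upsilon$ is the $K$-linear map $\mathrm{tr}:B\to K$ with $\mathrm{tr}(\theta_\lambda)=1$ for all $\lambda\in\Lambda_0$ and $\mathrm{tr}(f)=0$ for all other $f\in\Upsilon$. For a linear map $\tau:B\to K$, $(f,g)_\tau:=\tau(fg)$, where $fg$ is the composite. For an anti-involution $\ast$ of $A$, the dual of $M\in A\text{-mod}$ is $M^\ast:=\operatorname{Hom}_K(M,K)$ with $(af)(m):=f(a^\ast m)$. *)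

theory Defs
  imports "HOL-Library.Function_Algebras" "HOL-Computational_Algebra.Polynomial"
begin

section \<open>Finite-dimensional algebras\<close>

text \<open>Vector spaces of functions carry the pointwise addition of
  \<^theory>\<open>HOL-Library.Function_Algebras\<close> and the following pointwise scalar multiplication.\<close>

definition fscale :: "('k \<Rightarrow> 'b \<Rightarrow> 'b) \<Rightarrow> 'k \<Rightarrow> ('x \<Rightarrow> 'b) \<Rightarrow> 'x \<Rightarrow> 'b" where
  "fscale s c f = (\<lambda>x. s c (f x))"

text \<open>The set \<open>W\<close> is a finite-dimensional subspace of the ambient vector space.\<close>

definition fin_dim :: "('k::field \<Rightarrow> 'b::ab_group_add \<Rightarrow> 'b) \<Rightarrow> 'b set \<Rightarrow> bool" where
  "fin_dim s W \<longleftrightarrow> (\<exists>S. finite S \<and> module.span s S = W)"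

text \<open>A finite-dimensional unital associative algebra whose underlying vector space is a subspace
  \<open>B\<close> of the ambient space.\<close>

definition fd_algebra ::
  "('k::field \<Rightarrow> 'b::ab_group_add \<Rightarrow> 'b) \<Rightarrow> 'b set \<Rightarrow> ('b \<Rightarrow> 'b \<Rightarrow> 'b) \<Rightarrow> 'b \<Rightarrow> bool" where
  "fd_algebra s B m e \<longleftrightarrow>
     vector_space s \<and> fin_dim s B \<and> e \<in> B \<and>
     (\<forall>x\<in>B. \<forall>y\<in>B. m x y \<in> B) \<and>
     (\<forall>x\<in>B. m e x = x \<and> m x e = x) \<and>
     (\<forall>x\<in>B. \<forall>y\<in>B. \<forall>z\<in>B. m (m x y) z = m x (m y z)) \<and>
     (\<forall>x\<in>B. \<forall>y\<in>B. \<forall>z\<in>B. m (x + y) z = m x z + m y z \<and> m x (y + z) = m x y + m x z) \<and>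
     (\<forall>c. \<forall>x\<in>B. \<forall>y\<in>B. m (s c x) y = s c (m x y) \<and> m x (s c y) = s c (m x y))"

definition linear_form ::
  "('k::field \<Rightarrow> 'b::ab_group_add \<Rightarrow> 'b) \<Rightarrow> 'b set \<Rightarrow> ('b \<Rightarrow> 'k) \<Rightarrow> bool" where
  "linear_form s B \<tau> \<longleftrightarrow>
     (\<forall>x\<in>B. \<forall>y\<in>B. \<tau> (x + y) = \<tau> x + \<tau> y) \<and> (\<forall>c. \<forall>x\<in>B. \<tau> (s c x) = c * \<tau> x)"

definition induced_form :: "('b \<Rightarrow> 'b \<Rightarrow> 'b) \<Rightarrow> ('b \<Rightarrow> 'k) \<Rightarrow> 'b \<Rightarrow> 'b \<Rightarrow> 'k" where
  "induced_form m \<tau> f g = \<tau> (m f g)"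

definition nondegenerate :: "'b::zero set \<Rightarrow> ('b \<Rightarrow> 'b \<Rightarrow> 'k::zero) \<Rightarrow> bool" where
  "nondegenerate B \<beta> \<longleftrightarrow>
     (\<forall>f\<in>B. (\<forall>g\<in>B. \<beta> f g = 0) \<longrightarrow> f = 0) \<and>
     (\<forall>g\<in>B. (\<forall>f\<in>B. \<beta> f g = 0) \<longrightarrow> g = 0)"

definition frobenius_algebra ::
  "('k::field \<Rightarrow> 'b::ab_group_add \<Rightarrow> 'b) \<Rightarrow> 'b set \<Rightarrow> ('b \<Rightarrow> 'b \<Rightarrow> 'b) \<Rightarrow> 'b \<Rightarrow> bool" where
  "frobenius_algebra s B m e \<longleftrightarrow>
     fd_algebra s B m e \<and>
     (\<exists>\<tau>. linear_form s B \<tau> \<and> nondegenerate B (induced_form m \<tau>))"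

definition anti_involution ::
  "('k::field \<Rightarrow> 'a::ring_1 \<Rightarrow> 'a) \<Rightarrow> ('a \<Rightarrow> 'a) \<Rightarrow> bool" where
  "anti_involution sA star \<longleftrightarrow>
     Vector_Spaces.linear sA sA star \<and>
     (\<forall>a b. star (a * b) = star b * star a) \<and> (\<forall>a. star (star a) = a)"


section \<open>Finite-dimensional modules\<close>

text \<open>The algebra is a type \<open>'a\<close> with scalar multiplication \<open>sA\<close>. A module is a subspace of an
  ambient vector space with its own action of \<open>'a\<close>; \<open>act M a v\<close> is only meaningful for
  \<open>v \<in> carrier M\<close>.\<close>

record ('a, 'v) amod =
  carrier :: "'v set"
  act :: "'a \<Rightarrow> 'v \<Rightarrow> 'v"

definition fd_module ::
  "('k::field \<Rightarrow> 'a::ring_1 \<Rightarrow> 'a) \<Rightarrow> ('k \<Rightarrow> 'v::ab_group_add \<Rightarrow> 'v) \<Rightarrow> ('a, 'v) amod \<Rightarrow> bool" where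
  "fd_module sA sV M \<longleftrightarrow>
     fin_dim sV (carrier M) \<and>
     (\<forall>a. \<forall>v\<in>carrier M. act M a v \<in> carrier M) \<and>
     (\<forall>a. \<forall>v\<in>carrier M. \<forall>w\<in>carrier M. act M a (v + w) = act M a v + act M a w) \<and>
     (\<forall>a b. \<forall>v\<in>carrier M. act M (a + b) v = act M a v + act M b v) \<and>
     (\<forall>a b. \<forall>v\<in>carrier M. act M (a * b) v = act M a (act M b v)) \<and>
     (\<forall>v\<in>carrier M. act M 1 v = v) \<and>
     (\<forall>c. \<forall>v\<in>carrier M. act M (sA c 1) v = sV c v)"

text \<open>Homomorphisms are extended by zero outside the carrier, so that equality of
  homomorphisms is equality of functions and composition is \<open>(\<circ>)\<close>.\<close>

definition Hom :: "('a, 'v::ab_group_add) amod \<Rightarrow> ('a, 'w::ab_group_add) amod \<Rightarrow> ('v \<Rightarrow> 'w) set" where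
  "Hom M N = {f. (\<forall>v. v \<notin> carrier M \<longrightarrow> f v = 0) \<and>
     (\<forall>v\<in>carrier M. f v \<in> carrier N) \<and>
     (\<forall>v\<in>carrier M. \<forall>w\<in>carrier M. f (v + w) = f v + f w) \<and>
     (\<forall>a. \<forall>v\<in>carrier M. f (act M a v) = act N a (f v))}"

definition iso :: "('a, 'v::ab_group_add) amod \<Rightarrow> ('a, 'w::ab_group_add) amod \<Rightarrow> bool" where
  "iso M N \<longleftrightarrow> (\<exists>f\<in>Hom M N. bij_betw f (carrier M) (carrier N))"

definition submodule :: "'v::ab_group_add set \<Rightarrow> ('a, 'v) amod \<Rightarrow> bool" where
  "submodule W M \<longleftrightarrow> W \<subseteq> carrier M \<and> 0 \<in> W \<and> (\<forall>v\<in>W. \<forall>w\<in>W. v + w \<in> W) \<and>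
     (\<forall>a. \<forall>v\<in>W. act M a v \<in> W)"

definition simple :: "('a, 'v::ab_group_add) amod \<Rightarrow> bool" where
  "simple M \<longleftrightarrow> carrier M \<noteq> {0} \<and> (\<forall>W. submodule W M \<longrightarrow> W = {0} \<or> W = carrier M)"

text \<open>The sum of the simple submodules.\<close>

definition socle ::
  "('k::field \<Rightarrow> 'v::ab_group_add \<Rightarrow> 'v) \<Rightarrow> ('a, 'v) amod \<Rightarrow> 'v set" where
  "socle sV M = module.span sV (\<Union>{W. submodule W M \<and> simple (M\<lparr>carrier := W\<rparr>)})"

text \<open>HOL cannot quantify over all types in a formula. Every finite-dimensional module is isomorphic
  to one whose carrier is a subspace of the space of sequences over the ground field, so
  quantification over the objects of the category of finite-dimensional modules is quantification
  over the following modules.\<close>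

definition A_mod :: "('k::field \<Rightarrow> 'a::ring_1 \<Rightarrow> 'a) \<Rightarrow> ('a, nat \<Rightarrow> 'k) amod set" where
  "A_mod sA = {M. fd_module sA (fscale (*)) M}"

definition projective ::
  "('k::field \<Rightarrow> 'a::ring_1 \<Rightarrow> 'a) \<Rightarrow> ('a, 'v::ab_group_add) amod \<Rightarrow> bool" where
  "projective sA P \<longleftrightarrow> (\<forall>X\<in>A_mod sA. \<forall>Y\<in>A_mod sA. \<forall>g\<in>Hom X Y. \<forall>f\<in>Hom P Y.
     g ` carrier X = carrier Y \<longrightarrow> (\<exists>h\<in>Hom P X. g \<circ> h = f))"

definition injective ::
  "('k::field \<Rightarrow> 'a::ring_1 \<Rightarrow> 'a) \<Rightarrow> ('a, 'v::ab_group_add) amod \<Rightarrow> bool" where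
  "injective sA I \<longleftrightarrow> (\<forall>X\<in>A_mod sA. \<forall>Y\<in>A_mod sA. \<forall>g\<in>Hom X Y. \<forall>f\<in>Hom X I.
     inj_on g (carrier X) \<longrightarrow> (\<exists>h\<in>Hom Y I. h \<circ> g = f))"

definition superfluous :: "'v::ab_group_add set \<Rightarrow> ('a, 'v) amod \<Rightarrow> bool" where
  "superfluous N M \<longleftrightarrow>
     (\<forall>U. submodule U M \<longrightarrow> {u + n |u n. u \<in> U \<and> n \<in> N} = carrier M \<longrightarrow> U = carrier M)"

definition essential :: "'v::ab_group_add set \<Rightarrow> ('a, 'v) amod \<Rightarrow> bool" where
  "essential N M \<longleftrightarrow> (\<forall>U. submodule U M \<longrightarrow> U \<inter> N = {0} \<longrightarrow> U = {0})"

definition projective_cover ::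
  "('k::field \<Rightarrow> 'a::ring_1 \<Rightarrow> 'a) \<Rightarrow> ('k \<Rightarrow> 'v::ab_group_add \<Rightarrow> 'v)
    \<Rightarrow> ('a, 'v) amod \<Rightarrow> ('a, 'v) amod \<Rightarrow> bool" where
  "projective_cover sA sV P L \<longleftrightarrow> fd_module sA sV P \<and> projective sA P \<and>
     (\<exists>p\<in>Hom P L. p ` carrier P = carrier L \<and> superfluous {v \<in> carrier P. p v = 0} P)"

definition injective_envelope ::
  "('k::field \<Rightarrow> 'a::ring_1 \<Rightarrow> 'a) \<Rightarrow> ('k \<Rightarrow> 'v::ab_group_add \<Rightarrow> 'v)
    \<Rightarrow> ('a, 'v) amod \<Rightarrow> ('a, 'v) amod \<Rightarrow> bool" where
  "injective_envelope sA sV I L \<longleftrightarrow> fd_module sA sV I \<and> injective sA I \<and>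
     (\<exists>i\<in>Hom L I. inj_on i (carrier L) \<and> essential (i ` carrier L) I)"

definition complete_simples ::
  "('k::field \<Rightarrow> 'a::ring_1 \<Rightarrow> 'a) \<Rightarrow> ('k \<Rightarrow> 'v::ab_group_add \<Rightarrow> 'v)
    \<Rightarrow> 'l set \<Rightarrow> ('l \<Rightarrow> ('a, 'v) amod) \<Rightarrow> bool" where
  "complete_simples sA sV \<Lambda> L \<longleftrightarrow>
     (\<forall>i\<in>\<Lambda>. fd_module sA sV (L i) \<and> simple (L i)) \<and>
     (\<forall>i\<in>\<Lambda>. \<forall>j\<in>\<Lambda>. iso (L i) (L j) \<longrightarrow> i = j) \<and>
     (\<forall>M\<in>A_mod sA. simple M \<longrightarrow> (\<exists>i\<in>\<Lambda>. iso M (L i)))"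

text \<open>The linear dual, with linear forms on \<open>carrier M\<close> extended by zero. Its ambient vector space
  is \<open>'v \<Rightarrow> 'k\<close> with scalar multiplication \<open>fscale (*)\<close>.\<close>

definition dual ::
  "('a \<Rightarrow> 'a) \<Rightarrow> ('k::field \<Rightarrow> 'v::ab_group_add \<Rightarrow> 'v) \<Rightarrow> ('a, 'v) amod \<Rightarrow> ('a, 'v \<Rightarrow> 'k) amod" where
  "dual star sV M =
     \<lparr>carrier = {\<phi>. (\<forall>v. v \<notin> carrier M \<longrightarrow> \<phi> v = 0) \<and> linear_form sV (carrier M) \<phi>},
      act = (\<lambda>a \<phi> v. if v \<in> carrier M then \<phi> (act M (star a) v) else 0)\<rparr>"


section \<open>The projective-injective modules and the algebra B\<close>

definition Lambda0 ::
  "('k::field \<Rightarrow> 'a::ring_1 \<Rightarrow> 'a) \<Rightarrow> 'l set \<Rightarrow> ('l \<Rightarrow> ('a, 'v::ab_group_add) amod) \<Rightarrow> 'l set" where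
  "Lambda0 sA \<Lambda> P = {i \<in> \<Lambda>. injective sA (P i)}"

definition prime_map ::
  "'l set \<Rightarrow> ('l \<Rightarrow> ('a, 'v::ab_group_add) amod) \<Rightarrow> ('l \<Rightarrow> ('a, 'v) amod) \<Rightarrow> 'l \<Rightarrow> 'l" where
  "prime_map \<Lambda> P I i = (THE j. j \<in> \<Lambda> \<and> iso (P i) (I j))"

definition involution_on :: "'l set \<Rightarrow> ('l \<Rightarrow> 'l) \<Rightarrow> bool" where
  "involution_on S p \<longleftrightarrow> (\<forall>i\<in>S. p i \<in> S \<and> p (p i) = i)"

definition direct_sum :: "'l set \<Rightarrow> ('l \<Rightarrow> ('a, 'v::ab_group_add) amod) \<Rightarrow> ('a, 'l \<Rightarrow> 'v) amod" where
  "direct_sum S P =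
     \<lparr>carrier = {x. (\<forall>i\<in>S. x i \<in> carrier (P i)) \<and> (\<forall>i. i \<notin> S \<longrightarrow> x i = 0)},
      act = (\<lambda>a x i. if i \<in> S then act (P i) a (x i) else 0)\<rparr>"

text \<open>With \<open>S = \<Lambda>\<^sub>0\<close> this is the carrier of the algebra \<open>B\<close>. Its multiplication is \<open>(\<circ>)\<close>, its unit
  \<open>End_one S P\<close>, and its scalar multiplication \<open>fscale (fscale sV)\<close>.\<close>

definition End_sum ::
  "'l set \<Rightarrow> ('l \<Rightarrow> ('a, 'v::ab_group_add) amod) \<Rightarrow> (('l \<Rightarrow> 'v) \<Rightarrow> ('l \<Rightarrow> 'v)) set" where
  "End_sum S P = Hom (direct_sum S P) (direct_sum S P)"

definition End_one ::
  "'l set \<Rightarrow> ('l \<Rightarrow> ('a, 'v::ab_group_add) amod) \<Rightarrow> ('l \<Rightarrow> 'v) \<Rightarrow> ('l \<Rightarrow> 'v)" where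
  "End_one S P = (\<lambda>x. if x \<in> carrier (direct_sum S P) then x else 0)"

text \<open>The element of \<open>End_sum S P\<close> given by \<open>f \<in> Hom (P i) (P j)\<close>: project to the
  \<open>i\<close>-summand, apply \<open>f\<close>, include into the \<open>j\<close>-summand.\<close>

definition block ::
  "'l set \<Rightarrow> ('l \<Rightarrow> ('a, 'v::ab_group_add) amod) \<Rightarrow> 'l \<Rightarrow> 'l \<Rightarrow> ('v \<Rightarrow> 'v) \<Rightarrow> ('l \<Rightarrow> 'v) \<Rightarrow> ('l \<Rightarrow> 'v)" where
  "block S P i j f =
     (\<lambda>x. if x \<in> carrier (direct_sum S P) then (\<lambda>k. if k = j then f (x i) else 0) else 0)"

text \<open>In the following definitions, \<open>S\<close> stands for \<open>\<Lambda>\<^sub>0\<close> and \<open>p\<close> for the involution.\<close>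

definition socle_maps ::
  "('k::field \<Rightarrow> 'v::ab_group_add \<Rightarrow> 'v) \<Rightarrow> 'l set \<Rightarrow> ('l \<Rightarrow> ('a, 'v) amod) \<Rightarrow> ('l \<Rightarrow> 'l)
    \<Rightarrow> ('l \<Rightarrow> 'v \<Rightarrow> 'v) \<Rightarrow> bool" where
  "socle_maps sV S P p \<theta> \<longleftrightarrow> (\<forall>i\<in>S. \<theta> i \<in> Hom (P i) (P (p i)) \<and> \<theta> i \<noteq> 0 \<and>
     \<theta> i ` carrier (P i) = socle sV (P (p i)))"

definition theta_blocks ::
  "'l set \<Rightarrow> ('l \<Rightarrow> ('a, 'v::ab_group_add) amod) \<Rightarrow> ('l \<Rightarrow> 'l) \<Rightarrow> ('l \<Rightarrow> 'v \<Rightarrow> 'v)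
    \<Rightarrow> (('l \<Rightarrow> 'v) \<Rightarrow> ('l \<Rightarrow> 'v)) set" where
  "theta_blocks S P p \<theta> = {block S P i (p i) (\<theta> i) |i. i \<in> S}"

definition appropriate_basis ::
  "('k::field \<Rightarrow> 'v::ab_group_add \<Rightarrow> 'v) \<Rightarrow> 'l set \<Rightarrow> ('l \<Rightarrow> ('a, 'v) amod) \<Rightarrow> ('l \<Rightarrow> 'l)
    \<Rightarrow> ('l \<Rightarrow> 'v \<Rightarrow> 'v) \<Rightarrow> (('l \<Rightarrow> 'v) \<Rightarrow> ('l \<Rightarrow> 'v)) set \<Rightarrow> bool" where
  "appropriate_basis sV S P p \<theta> \<Upsilon> \<longleftrightarrow>
     \<not> module.dependent (fscale (fscale sV)) \<Upsilon> \<and>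
     module.span (fscale (fscale sV)) \<Upsilon> = End_sum S P \<and>
     theta_blocks S P p \<theta> \<subseteq> \<Upsilon> \<and>
     \<Upsilon> \<subseteq> (\<Union>i\<in>S. \<Union>j\<in>S. block S P i j ` Hom (P i) (P j))"

definition canonical_form ::
  "('k::field \<Rightarrow> 'v::ab_group_add \<Rightarrow> 'v) \<Rightarrow> 'l set \<Rightarrow> ('l \<Rightarrow> ('a, 'v) amod) \<Rightarrow> ('l \<Rightarrow> 'l)
    \<Rightarrow> ('l \<Rightarrow> 'v \<Rightarrow> 'v) \<Rightarrow> (('l \<Rightarrow> 'v) \<Rightarrow> ('l \<Rightarrow> 'v)) set
    \<Rightarrow> ((('l \<Rightarrow> 'v) \<Rightarrow> ('l \<Rightarrow> 'v)) \<Rightarrow> 'k) \<Rightarrow> bool" where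
  "canonical_form sV S P p \<theta> \<Upsilon> tr \<longleftrightarrow>
     linear_form (fscale (fscale sV)) (End_sum S P) tr \<and>
     (\<forall>f\<in>theta_blocks S P p \<theta>. tr f = 1) \<and>
     (\<forall>f\<in>\<Upsilon> - theta_blocks S P p \<theta>. tr f = 0)"

end

theory Submission
  imports Defs
begin

text \<open>For \<open>i \<in> \<Lambda>\<^sub>0\<close> the module \<open>P\<^sup>i\<close> has a largest proper submodule and, being an injective
  envelope, a smallest nonzero submodule. If \<open>f : P\<^sup>i \<rightarrow> P\<^sup>j\<close> is nonzero, its image contains the socle
  of \<open>P\<^sup>j\<close>, so \<open>\<theta>\<close> into \<open>P\<^sup>j\<close> lifts along \<open>f\<close> by projectivity; dually its kernel is contained in the
  kernel of \<open>\<theta>\<^sub>i\<close>, so \<open>\<theta>\<^sub>i\<close> extends along \<open>f\<close> by injectivity. The trace only sees the blocks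
  \<open>P\<^sup>i \<rightarrow> P\<^bsup>i'\<^esup>\<close>, hence takes the value 1 on the resulting products \<open>fg\<close> and \<open>gf\<close>. A duality fixing the
  simple modules turns \<open>P\<^sup>i\<close> into \<open>I\<^sup>i\<close>, which makes \<open>'\<close> an involution.\<close>

section \<open>Linear algebra\<close>

text \<open>One nonzero entry of the matrix of components is enough to test a nonzero
  \<open>f\<close>. If the test map \<open>g\<close> is a single block, all entries of
  \<open>f \<circ> g\<close> have the same source and all entries of \<open>g \<circ> f\<close> the
  same target. As \<open>'\<close> is an involution, exactly one position with that source, or with
  that target, has the form \<open>i \<rightarrow> i'\<close>; the trace vanishes on every other
  position, so nothing can cancel the entry for which \<open>g\<close> was chosen. The two sides of
  non-degeneracy are proved independently, one from projectivity and one from injectivity. The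
  Frobenius statement mentions no basis, so its form is written down directly instead of completing
  the \<theta> to a homogeneous basis. A technical obstacle shapes the middle part: projectivity and
  injectivity are tested only against modules of sequences over the field, whereas summands,
  submodules and duals live in other types. Each use therefore passes through an isomorphic sequence
  module. On the duality side the double dual is avoided: an isomorphism from M to the dual of N is
  transposed into one from N to the dual of M.\<close>

lemma vector_space_mult: "vector_space ((*) :: 'k::field \<Rightarrow> 'k \<Rightarrow> 'k)"
  by unfold_locales (auto simp: algebra_simps)

lemma vector_space_fscale:
  assumes "vector_space s"
  shows "vector_space (fscale s)"
proof -
  interpret vector_space s by fact
  show ?thesis
    by unfold_locales
      (auto simp: fscale_def fun_eq_iff scale_right_distrib scale_left_distrib)
qed

lemma sum_fun_apply: "(\<Sum>i\<in>A. f i) x = (\<Sum>i\<in>A. f i x)"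
  for f :: "'i \<Rightarrow> 'x \<Rightarrow> 'b::comm_monoid_add"
  by (induction A rule: infinite_finite_induct) auto

text \<open>Linearity is asked for on a subset only: homomorphisms and forms are extended by zero
  outside their carrier, which in general destroys additivity on the ambient space.\<close>

definition linear_on ::
  "('k::field \<Rightarrow> 'b::ab_group_add \<Rightarrow> 'b) \<Rightarrow> 'b set \<Rightarrow> ('k \<Rightarrow> 'c::ab_group_add \<Rightarrow> 'c)
    \<Rightarrow> ('b \<Rightarrow> 'c) \<Rightarrow> bool" where
  "linear_on s W t f \<longleftrightarrow>
     (\<forall>x\<in>W. \<forall>y\<in>W. f (x + y) = f x + f y) \<and> (\<forall>c. \<forall>x\<in>W. f (s c x) = t c (f x))"

lemma linear_form_iff: "linear_form s W \<phi> \<longleftrightarrow> linear_on s W (*) \<phi>"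
  by (simp add: linear_form_def linear_on_def)

lemma linear_on_0: "linear_on s W t f \<Longrightarrow> 0 \<in> W \<Longrightarrow> f 0 = 0"
  unfolding linear_on_def by (metis add.right_neutral add_left_cancel)

lemma linear_on_sum:
  assumes "vector_space s" "vector_space t" "module.subspace s W" "linear_on s W t f"
    and "\<And>i. i \<in> A \<Longrightarrow> x i \<in> W"
  shows "f (\<Sum>i\<in>A. s (c i) (x i)) = (\<Sum>i\<in>A. t (c i) (f (x i)))"
proof -
  interpret S: vector_space s by fact
  interpret T: vector_space t by fact
  have 0: "f 0 = 0" using assms(3,4) by (metis S.subspace_0 linear_on_0)
  show ?thesis using assms(5)
  proof (induction A rule: infinite_finite_induct)
    case (insert a A)
    have "(\<Sum>i\<in>A. s (c i) (x i)) \<in> W" "s (c a) (x a) \<in> W" "x a \<in> W"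
      using insert.prems assms(3) by (auto intro!: S.subspace_sum S.subspace_scale)
    then show ?case
      using insert assms(4) by (simp add: linear_on_def)
  qed (simp_all add: 0)
qed

lemma linear_on_image_span:
  assumes "vector_space s" "vector_space t" "linear_on s (module.span s B) t f"
  shows "f ` module.span s B = module.span t (f ` B)"
proof -
  interpret S: vector_space s by fact
  interpret T: vector_space t by fact
  have 0: "f 0 = 0" using assms(3) S.span_zero by (rule linear_on_0)
  show ?thesis
  proof
    have "x \<in> S.span B \<and> f x \<in> T.span (f ` B)" if "x \<in> S.span B" for x
      using that
    proof (induction rule: S.span_induct_alt)
      case base then show ?case by (simp add: 0 T.span_zero S.span_zero)
    next
      case (step c x y)
      then have "f (s c x + y) = t c (f x) + f y"
        using assms(3) by (simp add: linear_on_def S.span_base S.span_scale)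
      with step show ?case
        by (simp add: S.span_base S.span_scale S.span_add T.span_base T.span_scale T.span_add)
    qed
    then show "f ` S.span B \<subseteq> T.span (f ` B)" by blast
    show "T.span (f ` B) \<subseteq> f ` S.span B"
    proof
      fix y assume "y \<in> T.span (f ` B)"
      then show "y \<in> f ` S.span B"
      proof (induction rule: T.span_induct_alt)
        case base then show ?case using 0 S.span_zero by force
      next
        case (step c u v)
        then obtain b w where "b \<in> B" "u = f b" "w \<in> S.span B" "v = f w" by blast
        moreover from this have "f (s c b + w) = t c u + v"
          using assms(3) by (simp add: linear_on_def S.span_base S.span_scale)
        ultimately show ?case
          by (metis S.span_add S.span_base S.span_scale rev_image_eqI)
      qed
    qed
  qed
qed

section \<open>Bases of subspaces and comparison of dimensions\<close>

lemma fin_dim_basis: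
  assumes "vector_space s" "fin_dim s W"
  obtains B where "finite B" "\<not> module.dependent s B" "module.span s B = W" "B \<subseteq> W"
proof -
  interpret vector_space s by fact
  obtain S where S: "finite S" "span S = W" using assms(2) by (auto simp: fin_dim_def)
  obtain B where B: "B \<subseteq> W" "independent B" "W \<subseteq> span B"
    using maximal_independent_subset by blast
  have "finite B" using independent_span_bound[OF S(1) B(2)] B(1) S(2) by auto
  moreover have "span B = W" using B S by (metis span_minimal subspace_span subset_antisym)
  ultimately show ?thesis using that B by blast
qed

lemma subspace_finite_basis:
  assumes "vector_space s" "module.subspace s W" "finite S" "W \<subseteq> module.span s S"
  obtains B where "finite B" "\<not> module.dependent s B" "module.span s B = W" "B \<subseteq> W" "card B \<le> card S"
proof -
  interpret vector_space s by fact
  obtain B where B: "B \<subseteq> W" "independent B" "W \<subseteq> span B"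
    using maximal_independent_subset by blast
  have "finite B \<and> card B \<le> card S" using independent_span_bound[OF assms(3) B(2)] B(1) assms(4) by auto
  moreover have "span B = W" using B assms(2) by (metis span_minimal subset_antisym)
  ultimately show ?thesis using that B by blast
qed

lemma fin_dim_subspace:
  assumes "vector_space s" "module.subspace s W" "finite S" "W \<subseteq> module.span s S"
  shows "fin_dim s W"
  using subspace_finite_basis[OF assms] unfolding fin_dim_def by metis

lemma fin_dim_imp_subspace:
  assumes "vector_space s" "fin_dim s W"
  shows "module.subspace s W"
proof -
  interpret vector_space s by fact
  obtain S where "span S = W" using assms(2) unfolding fin_dim_def by blast
  then show ?thesis using subspace_span[of S] by simp
qed

text \<open>A vector of the larger span outside the smaller one can be adjoined to \<open>S\<close>
  without losing independence, so the exchange bound for \<open>T\<close> applies to a set with one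
  more element than \<open>S\<close>.\<close>

lemma card_basis_less:
  assumes "vector_space s" "finite T" "\<not> module.dependent s S"
    and "module.span s S \<subset> module.span s T"
  shows "card S < card T"
proof -
  interpret vector_space s by fact
  obtain x where x: "x \<in> span T" "x \<notin> span S" using assms(4) by auto
  have "independent (insert x S)" using x assms(3) by (simp add: independent_insertI)
  moreover have "insert x S \<subseteq> span T" using x assms(4) span_superset[of S] by auto
  ultimately have "finite (insert x S) \<and> card (insert x S) \<le> card T"
    by (rule independent_span_bound[OF assms(2)])
  moreover have "x \<notin> S" using x span_base[of x S] by auto
  ultimately show ?thesis by auto
qed

text \<open>For a basis \<open>B\<close> this is the map of rank at most one that multiplies
  \<open>c\<close> by the coordinate at \<open>b\<close>, the analogue of a matrix unit. The cut-off
  outside the span agrees with the convention for \<open>Hom\<close>.\<close>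

definition elementary ::
  "('k::field \<Rightarrow> 'b::ab_group_add \<Rightarrow> 'b) \<Rightarrow> ('k \<Rightarrow> 'c::ab_group_add \<Rightarrow> 'c) \<Rightarrow> 'b set
    \<Rightarrow> 'b \<Rightarrow> 'c \<Rightarrow> 'b \<Rightarrow> 'c" where
  "elementary s t B b c = (\<lambda>v. if v \<in> module.span s B then t (module.representation s B v b) c else 0)"

text \<open>A linear map is determined by its values on \<open>B\<close>, and expanding these values
  in \<open>C\<close> expresses it through elementary maps. The spanning set is explicit, so besides
  finite dimensionality of endomorphism spaces it yields, with \<open>C = {1}\<close>, a bound for
  the dimension of a dual.\<close>

lemma linear_maps_subset_span_elementary:
  assumes "vector_space s" "vector_space t"
    and "finite B" "\<not> module.dependent s B" "finite C"
    and "linear_on s (module.span s B) t f" "f ` module.span s B \<subseteq> module.span t C"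
    and "\<And>v. v \<notin> module.span s B \<Longrightarrow> f v = 0"
  shows "f \<in> module.span (fscale t) ((\<lambda>(b, c). elementary s t B b c) ` (B \<times> C))"
proof -
  interpret S: vector_space s by fact
  interpret T: vector_space t by fact
  interpret F: vector_space "fscale t" using vector_space_fscale assms(2) .
  have "\<exists>u. f b = (\<Sum>c\<in>C. t (u c) c)" if "b \<in> B" for b
  proof -
    have "f b \<in> T.span C" using that assms(7) S.span_base by blast
    then show ?thesis using T.span_finite[OF assms(5)] by auto
  qed
  then obtain u where u: "f b = (\<Sum>c\<in>C. t (u b c) c)" if "b \<in> B" for b by metis
  have "f = (\<Sum>(b,c)\<in>B \<times> C. fscale t (u b c) (elementary s t B b c))"
  proof
    fix v
    show "f v = (\<Sum>(b,c)\<in>B \<times> C. fscale t (u b c) (elementary s t B b c)) v"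
    proof (cases "v \<in> S.span B")
      case False
      then show ?thesis using assms(8)
        by (simp add: sum_fun_apply case_prod_unfold fscale_def elementary_def)
    next
      case True
      have "f v = f (\<Sum>b\<in>B. s (S.representation B v b) b)"
        using S.sum_representation_eq[OF assms(4) True assms(3)] by simp
      also have "\<dots> = (\<Sum>b\<in>B. t (S.representation B v b) (f b))"
        by (rule linear_on_sum[OF assms(1,2) S.subspace_span[of B] assms(6)]) (simp add: S.span_base)
      also have "\<dots> = (\<Sum>b\<in>B. \<Sum>c\<in>C. t (u b c) (t (S.representation B v b) c))"
        by (intro sum.cong refl) (simp add: u T.scale_sum_right mult.commute)
      also have "\<dots> = (\<Sum>(b,c)\<in>B \<times> C. fscale t (u b c) (elementary s t B b c)) v"
        using True by (simp add: sum.cartesian_product sum_fun_apply fscale_def elementary_def case_prod_unfold)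
      finally show ?thesis .
    qed
  qed
  also have "\<dots> \<in> F.span ((\<lambda>(b, c). elementary s t B b c) ` (B \<times> C))"
    by (rule F.span_sum) (force intro: F.span_scale F.span_base)
  finally show ?thesis .
qed

section \<open>Linear forms: extension, separation, common zeros\<close>

lemma linear_form_extend:
  assumes "vector_space s" "module.subspace s W" "linear_form s W \<phi>"
  obtains \<psi> where "linear_form s UNIV \<psi>" "\<And>w. w \<in> W \<Longrightarrow> \<psi> w = \<phi> w"
proof -
  interpret vector_space s by fact
  interpret vector_space_pair s "(*)"
    by (simp add: vector_space_pair_def assms(1) vector_space_mult)
  obtain B where B: "B \<subseteq> W" "independent B" "W \<subseteq> span B"
    using maximal_independent_subset by blast
  obtain \<psi> where \<psi>: "Vector_Spaces.linear s (*) \<psi>" "\<forall>b\<in>B. \<psi> b = \<phi> b"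
    using linear_independent_extend[OF B(2)] by blast
  interpret P: Vector_Spaces.linear s "(*)" \<psi> by fact
  have 0: "\<phi> 0 = 0"
    using assms(2,3) by (metis linear_form_iff subspace_0 linear_on_0)
  \<comment> \<open>Membership in \<open>W\<close> is carried through the induction because
    \<open>\<phi>\<close> is known to be linear only there.\<close>
  have "w \<in> W \<and> \<psi> w = \<phi> w" if "w \<in> span B" for w
    using that
  proof (induction rule: span_induct_alt)
    case base show ?case using 0 assms(2) by (simp add: P.zero subspace_0)
  next
    case (step c x y)
    then have "x \<in> W" "y \<in> W" using B by auto
    then show ?case using step \<psi>(2) assms(2,3)
      by (simp add: linear_form_def P.add P.scale subspace_add subspace_scale)
  qed
  then show ?thesis
    using that[of \<psi>] B(3) by (auto simp: linear_form_def P.add P.scale)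
qed

lemma linear_form_separate:
  assumes "vector_space s" "module.subspace s W" "x \<notin> W"
  obtains \<psi> where "linear_form s UNIV \<psi>" "\<psi> x = 1" "\<And>w. w \<in> W \<Longrightarrow> \<psi> w = 0"
proof -
  interpret vector_space s by fact
  interpret vector_space_pair s "(*)"
    by (simp add: vector_space_pair_def assms(1) vector_space_mult)
  obtain B where B: "B \<subseteq> W" "independent B" "W \<subseteq> span B"
    using maximal_independent_subset by blast
  have sB: "span B = W" using B assms(2) by (metis span_minimal subset_antisym)
  \<comment> \<open>Since \<open>x\<close> lies outside the span of \<open>B\<close>, the value 1 at
    \<open>x\<close> and the value 0 on \<open>B\<close> can be prescribed simultaneously.\<close>
  then have "independent (insert x B)" using B assms(3) by (simp add: independent_insertI)
  from linear_independent_extend[OF this, of "\<lambda>b. if b = x then 1 else 0"]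
  obtain \<psi> where \<psi>: "Vector_Spaces.linear s (*) \<psi>" "\<forall>b\<in>insert x B. \<psi> b = (if b = x then 1 else 0)"
    by blast
  interpret P: Vector_Spaces.linear s "(*)" \<psi> by fact
  have "\<psi> w = 0" if "w \<in> span B" for w
    using that
  proof (induction rule: span_induct_alt)
    case base show ?case by (simp add: P.zero)
  next
    case (step c b y)
    then show ?case using \<psi>(2) B(1) assms(3) by (auto simp: P.add P.scale)
  qed
  then show ?thesis
    using that[of \<psi>] \<psi>(2) sB by (auto simp: linear_form_def P.add P.scale)
qed

text \<open>This is the finite double annihilator theorem: a form vanishing on the common zeros of
  \<open>\<Phi>\<close> lies in the span of \<open>\<Phi>\<close>. The induction removes one form by
  restricting to its kernel, which is why \<open>W\<close> must vary.\<close>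

lemma linear_form_combination:
  assumes "vector_space s" "finite \<Phi>" "module.subspace s W"
    and "\<And>\<psi>. \<psi> \<in> \<Phi> \<Longrightarrow> linear_form s W \<psi>" "linear_form s W \<phi>"
    and "\<And>w. w \<in> W \<Longrightarrow> (\<And>\<psi>. \<psi> \<in> \<Phi> \<Longrightarrow> \<psi> w = 0) \<Longrightarrow> \<phi> w = 0"
  shows "\<exists>c. \<forall>w\<in>W. \<phi> w = (\<Sum>\<psi>\<in>\<Phi>. c \<psi> * \<psi> w)"
  using assms(2-)
proof (induction \<Phi> arbitrary: W rule: finite_induct)
  case empty then show ?case by simp
next
  case (insert \<psi> \<Phi>)
  interpret vector_space s by fact
  let ?W = "{w \<in> W. \<psi> w = 0}"
  have lin: "linear_form s W \<psi>" using insert.prems(2) by blast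
  have W0: "0 \<in> W" using insert.prems(1) by (rule subspace_0)
  have \<psi>0: "\<psi> 0 = 0" using lin W0 by (metis linear_form_iff linear_on_0)
  have sub: "subspace ?W"
    using insert.prems(1) lin \<psi>0 unfolding subspace_def linear_form_def by auto
  have "\<exists>c. \<forall>w\<in>?W. \<phi> w = (\<Sum>\<psi>\<in>\<Phi>. c \<psi> * \<psi> w)"
  proof (rule insert.IH[OF sub])
    show "linear_form s ?W \<psi>'" if "\<psi>' \<in> \<Phi>" for \<psi>'
      using insert.prems(2)[of \<psi>'] that by (auto simp: linear_form_def)
    show "linear_form s ?W \<phi>" using insert.prems(3) by (auto simp: linear_form_def)
    show "\<phi> w = 0" if "w \<in> ?W" "\<And>\<psi>'. \<psi>' \<in> \<Phi> \<Longrightarrow> \<psi>' w = 0" for w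
      using insert.prems(4)[of w] that by auto
  qed
  then obtain c where c: "\<phi> w = (\<Sum>\<psi>\<in>\<Phi>. c \<psi> * \<psi> w)" if "w \<in> ?W" for w by blast
  define r where "r w = \<phi> w - (\<Sum>\<psi>\<in>\<Phi>. c \<psi> * \<psi> w)" for w
  have r_add: "r (x + y) = r x + r y" if "x \<in> W" "y \<in> W" for x y
  proof -
    have "(\<Sum>\<psi>\<in>\<Phi>. c \<psi> * \<psi> (x + y)) = (\<Sum>\<psi>\<in>\<Phi>. c \<psi> * \<psi> x) + (\<Sum>\<psi>\<in>\<Phi>. c \<psi> * \<psi> y)"
      unfolding sum.distrib[symmetric]
    proof (rule sum.cong)
      fix \<psi>' assume "\<psi>' \<in> \<Phi>"
      then have "\<psi>' (x + y) = \<psi>' x + \<psi>' y"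
        using that insert.prems(2)[of \<psi>'] by (simp add: linear_form_def)
      then show "c \<psi>' * \<psi>' (x + y) = c \<psi>' * \<psi>' x + c \<psi>' * \<psi>' y"
        by (simp add: distrib_left)
    qed simp
    then show ?thesis using insert.prems(3) that by (simp add: r_def linear_form_def)
  qed
  have r_scale: "r (s a x) = a * r x" if "x \<in> W" for a x
  proof -
    have "(\<Sum>\<psi>\<in>\<Phi>. c \<psi> * \<psi> (s a x)) = a * (\<Sum>\<psi>\<in>\<Phi>. c \<psi> * \<psi> x)"
      unfolding sum_distrib_left
    proof (rule sum.cong)
      fix \<psi>' assume "\<psi>' \<in> \<Phi>"
      then have "\<psi>' (s a x) = a * \<psi>' x"
        using that insert.prems(2)[of \<psi>'] by (simp add: linear_form_def)
      then show "c \<psi>' * \<psi>' (s a x) = a * (c \<psi>' * \<psi>' x)"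
        by (simp add: mult.left_commute)
    qed simp
    then show ?thesis using insert.prems(3) that by (simp add: r_def linear_form_def algebra_simps)
  qed
  \<comment> \<open>The residue \<open>r\<close> vanishes on the kernel of \<open>\<psi>\<close>, so
    it factors through a quotient of dimension at most one and must be a multiple of
    \<open>\<psi>\<close>.\<close>
  have "\<exists>k. \<forall>w\<in>W. r w = k * \<psi> w"
  proof (cases "\<forall>w\<in>W. \<psi> w = 0")
    case True then show ?thesis using c by (auto simp: r_def)
  next
    case False
    then obtain u where u: "u \<in> W" "\<psi> u \<noteq> 0" by blast
    have "r w = r u / \<psi> u * \<psi> w" if "w \<in> W" for w
    proof -
      \<comment> \<open>Chosen so that \<open>w + s a u\<close> falls into the kernel of
        \<open>\<psi>\<close>.\<close>
      define a where "a = - \<psi> w / \<psi> u"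
      have mem: "s a u \<in> W" by (rule subspace_scale[OF insert.prems(1) u(1)])
      then have "\<psi> (w + s a u) = \<psi> w + a * \<psi> u"
        using lin u that by (simp add: linear_form_def)
      then have "\<psi> (w + s a u) = 0" using u(2) by (simp add: a_def)
      then have "r (w + s a u) = 0"
        using c[of "w + s a u"] that mem insert.prems(1) by (simp add: r_def subspace_add)
      then have "r w = - (a * r u)" using that mem u by (simp add: r_add r_scale eq_neg_iff_add_eq_0)
      then show ?thesis by (simp add: a_def)
    qed
    then show ?thesis by blast
  qed
  then obtain k where k: "r w = k * \<psi> w" if "w \<in> W" for w by blast
  have "\<phi> w = (\<Sum>\<psi>'\<in>insert \<psi> \<Phi>. (c(\<psi> := k)) \<psi>' * \<psi>' w)" if "w \<in> W" for w
  proof -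
    have "(\<Sum>\<psi>'\<in>\<Phi>. (c(\<psi> := k)) \<psi>' * \<psi>' w) = (\<Sum>\<psi>'\<in>\<Phi>. c \<psi>' * \<psi>' w)"
      using insert.hyps by (intro sum.cong) auto
    then show ?thesis using k[OF that] insert.hyps by (simp add: r_def algebra_simps)
  qed
  then show ?case by blast
qed

section \<open>Homomorphisms and submodules\<close>

locale fd_mod = vector_space sV
  for sV :: "'k::field \<Rightarrow> 'v::ab_group_add \<Rightarrow> 'v" +
  fixes sA :: "'k \<Rightarrow> 'a::ring_1 \<Rightarrow> 'a" and M :: "('a, 'v) amod"
  assumes fd_module: "fd_module sA sV M"
begin

lemma fin_dim: "fin_dim sV (carrier M)"
  and act_closed: "v \<in> carrier M \<Longrightarrow> act M a v \<in> carrier M"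
  and act_add: "v \<in> carrier M \<Longrightarrow> w \<in> carrier M \<Longrightarrow> act M a (v + w) = act M a v + act M a w"
  and add_act: "v \<in> carrier M \<Longrightarrow> act M (a + b) v = act M a v + act M b v"
  and mult_act: "v \<in> carrier M \<Longrightarrow> act M (a * b) v = act M a (act M b v)"
  and one_act: "v \<in> carrier M \<Longrightarrow> act M 1 v = v"
  and scalar_act: "v \<in> carrier M \<Longrightarrow> act M (sA c 1) v = sV c v"
  using fd_module unfolding fd_module_def by auto

lemma subspace_carrier: "subspace (carrier M)"
  using fin_dim_imp_subspace[OF _ fin_dim] vector_space_axioms by blast

lemma zero_closed: "0 \<in> carrier M"
  using subspace_carrier by (rule subspace_0)

text \<open>Scalars act through the algebra, as \<open>sA c 1\<close>, so stability under the action
  already yields a subspace. The same principle makes homomorphisms linear over the field in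
  \<open>Hom_scale\<close>.\<close>

lemma submodule_scale: "submodule W M \<Longrightarrow> v \<in> W \<Longrightarrow> sV c v \<in> W"
  unfolding submodule_def by (metis scalar_act subsetD)

lemma submodule_subspace: "submodule W M \<Longrightarrow> subspace W"
  by (rule subspaceI) (auto simp: submodule_scale, auto simp: submodule_def)

lemma diff_closed: "v \<in> carrier M \<Longrightarrow> w \<in> carrier M \<Longrightarrow> v - w \<in> carrier M"
  using subspace_carrier by (rule subspace_diff)

lemma submodule_carrier: "submodule (carrier M) M"
  unfolding submodule_def using zero_closed act_closed subspace_add[OF subspace_carrier] by auto

lemma act_0: "act M a 0 = 0"
  using act_add[OF zero_closed zero_closed, of a] by simp

lemma fd_mod_submodule:
  assumes "submodule W M"
  shows "fd_mod sV sA (M\<lparr>carrier := W\<rparr>)"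
proof -
  have W: "W \<subseteq> carrier M" "\<And>a v. v \<in> W \<Longrightarrow> act M a v \<in> W"
    using assms unfolding submodule_def by auto
  obtain B where "finite B" "span B = carrier M" using fin_dim unfolding fin_dim_def by blast
  then have "fin_dim sV W"
    using fin_dim_subspace[OF vector_space_axioms submodule_subspace[OF assms]] W by blast
  then have "fd_module sA sV (M\<lparr>carrier := W\<rparr>)"
    using W unfolding fd_module_def
    by (simp add: subset_iff act_add add_act mult_act one_act scalar_act)
  then show ?thesis by unfold_locales
qed

lemma basis:
  obtains B where "finite B" "independent B" "span B = carrier M" "B \<subseteq> carrier M"
  using fin_dim_basis[OF vector_space_axioms fin_dim] .

end

lemma submodule_trans:
  "submodule W M \<Longrightarrow> submodule U (M\<lparr>carrier := W\<rparr>) \<Longrightarrow> submodule U M"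
  by (auto simp: submodule_def)

lemma submodule_restrict: "submodule U M \<Longrightarrow> U \<subseteq> W \<Longrightarrow> submodule U (M\<lparr>carrier := W\<rparr>)"
  by (auto simp: submodule_def)

lemma HomI:
  assumes "\<And>v. v \<notin> carrier M \<Longrightarrow> f v = 0" "\<And>v. v \<in> carrier M \<Longrightarrow> f v \<in> carrier N"
    and "\<And>v w. v \<in> carrier M \<Longrightarrow> w \<in> carrier M \<Longrightarrow> f (v + w) = f v + f w"
    and "\<And>a v. v \<in> carrier M \<Longrightarrow> f (act M a v) = act N a (f v)"
  shows "f \<in> Hom M N"
  using assms unfolding Hom_def by blast

lemma Hom_outside: "f \<in> Hom M N \<Longrightarrow> v \<notin> carrier M \<Longrightarrow> f v = 0"
  and Hom_closed: "f \<in> Hom M N \<Longrightarrow> v \<in> carrier M \<Longrightarrow> f v \<in> carrier N"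
  and Hom_add: "f \<in> Hom M N \<Longrightarrow> v \<in> carrier M \<Longrightarrow> w \<in> carrier M \<Longrightarrow> f (v + w) = f v + f w"
  and Hom_act: "f \<in> Hom M N \<Longrightarrow> v \<in> carrier M \<Longrightarrow> f (act M a v) = act N a (f v)"
  unfolding Hom_def by blast+

lemma Hom_0: "f \<in> Hom M N \<Longrightarrow> f 0 = 0"
  by (cases "0 \<in> carrier M") (metis Hom_add add.right_neutral add_left_cancel, metis Hom_outside)

lemma Hom_eqI:
  assumes "f \<in> Hom M N" "g \<in> Hom M N" "\<And>v. v \<in> carrier M \<Longrightarrow> f v = g v"
  shows "f = g"
  using assms by (metis Hom_outside ext)

lemma Hom_comp:
  assumes "f \<in> Hom M N" "g \<in> Hom N Q"
  shows "g \<circ> f \<in> Hom M Q"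
  using assms by (intro HomI) (auto simp: Hom_outside Hom_0 Hom_closed Hom_add Hom_act)

lemma Hom_codomain:
  assumes "f \<in> Hom M (N\<lparr>carrier := W\<rparr>)" "W \<subseteq> carrier N"
  shows "f \<in> Hom M N"
  using assms unfolding Hom_def by auto

lemma Hom_restrict_codomain:
  assumes "f \<in> Hom M N" "f ` carrier M \<subseteq> W"
  shows "f \<in> Hom M (N\<lparr>carrier := W\<rparr>)"
  using assms unfolding Hom_def by auto

lemma Hom_scale:
  assumes "fd_mod sV sA M" "fd_mod sW sA N" "f \<in> Hom M N" "v \<in> carrier M"
  shows "f (sV c v) = sW c (f v)"
  using Hom_act[OF assms(3,4), of "sA c 1"] fd_mod.scalar_act[OF assms(1,4)]
    fd_mod.scalar_act[OF assms(2) Hom_closed[OF assms(3,4)]] by simp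

lemma Hom_linear_on:
  assumes "fd_mod sV sA M" "fd_mod sW sA N" "f \<in> Hom M N"
  shows "linear_on sV (carrier M) sW f"
  using assms by (simp add: linear_on_def Hom_add Hom_scale[of sV sA M sW N])

lemma Hom_diff:
  assumes "fd_mod sV sA M" "f \<in> Hom M N" "v \<in> carrier M" "w \<in> carrier M"
  shows "f (v - w) = f v - f w"
proof -
  have "f (v - w + w) = f (v - w) + f w"
    using assms by (intro Hom_add) (auto intro: fd_mod.diff_closed)
  then show ?thesis by simp
qed

lemma Hom_image_submodule:
  assumes "f \<in> Hom M N" "submodule U M"
  shows "submodule (f ` U) N"
  unfolding submodule_def
proof (intro conjI ballI allI)
  have U: "U \<subseteq> carrier M" "0 \<in> U" "\<And>v w. v \<in> U \<Longrightarrow> w \<in> U \<Longrightarrow> v + w \<in> U"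
    "\<And>a v. v \<in> U \<Longrightarrow> act M a v \<in> U"
    using assms(2) unfolding submodule_def by auto
  show "f ` U \<subseteq> carrier N" using U assms(1) Hom_closed by blast
  show "0 \<in> f ` U" using U Hom_0[OF assms(1)] by force
  show "v + w \<in> f ` U" if vw: "v \<in> f ` U" "w \<in> f ` U" for v w
  proof -
    obtain v' w' where "v' \<in> U" "v = f v'" "w' \<in> U" "w = f w'" using vw by blast
    then have "v + w = f (v' + w')" using U(1) by (simp add: Hom_add[OF assms(1)] subsetD)
    then show ?thesis using U(3) \<open>v' \<in> U\<close> \<open>w' \<in> U\<close> by blast
  qed
  show "act N a v \<in> f ` U" if v: "v \<in> f ` U" for a v
  proof -
    obtain v' where "v' \<in> U" "v = f v'" using v by blast
    then have "act N a v = f (act M a v')" using U(1) by (simp add: Hom_act[OF assms(1)] subsetD)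
    then show ?thesis using U(4) \<open>v' \<in> U\<close> by blast
  qed
qed

abbreviation ker_on :: "('a, 'v::ab_group_add) amod \<Rightarrow> ('v \<Rightarrow> 'w::ab_group_add) \<Rightarrow> 'v set" where
  "ker_on M f \<equiv> {v \<in> carrier M. f v = 0}"

lemma Hom_kernel_submodule:
  assumes "fd_mod sV sA M" "fd_mod sW sA N" "f \<in> Hom M N"
  shows "submodule (ker_on M f) M"
proof -
  interpret M: fd_mod sV sA M by fact
  interpret N: fd_mod sW sA N by fact
  show ?thesis unfolding submodule_def
    using M.zero_closed Hom_0[OF assms(3)] Hom_add[OF assms(3)] Hom_act[OF assms(3)]
      M.act_closed M.subspace_add[OF M.subspace_carrier] N.act_0 by auto
qed

lemma Hom_inj_on_iff:
  assumes "fd_mod sV sA M" "f \<in> Hom M N"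
  shows "inj_on f (carrier M) \<longleftrightarrow> ker_on M f = {0}"
proof -
  interpret M: fd_mod sV sA M by fact
  show ?thesis
  proof
    assume "inj_on f (carrier M)"
    then show "ker_on M f = {0}"
      using M.zero_closed Hom_0[OF assms(2)] by (auto simp: inj_on_def)
  next
    assume k: "ker_on M f = {0}"
    show "inj_on f (carrier M)"
    proof (rule inj_onI)
      fix v w assume "v \<in> carrier M" "w \<in> carrier M" "f v = f w"
      then have "v - w \<in> ker_on M f"
        using M.diff_closed Hom_diff[OF assms] by simp
      then show "v = w" using k by simp
    qed
  qed
qed

text \<open>The inclusion of \<open>W\<close>, cut off by zero so that it belongs to
  \<open>Hom\<close>. When \<open>W\<close> is the whole carrier it is the identity of the module,
  and hence the unit of the endomorphism algebra.\<close>

definition hom_incl :: "'v set \<Rightarrow> 'v \<Rightarrow> 'v::ab_group_add" where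
  "hom_incl W = (\<lambda>v. if v \<in> W then v else 0)"

lemma hom_incl_Hom:
  assumes "submodule W M"
  shows "hom_incl W \<in> Hom (M\<lparr>carrier := W\<rparr>) M"
  using assms unfolding submodule_def hom_incl_def by (intro HomI) auto

lemma Hom_comp_incl:
  assumes "f \<in> Hom M N"
  shows "f \<circ> hom_incl (carrier M) = f"
  using assms by (auto simp: hom_incl_def fun_eq_iff Hom_0 Hom_outside)

lemma incl_comp_Hom:
  assumes "f \<in> Hom M N"
  shows "hom_incl (carrier N) \<circ> f = f"
  using Hom_closed[OF assms] Hom_outside[OF assms] by (auto simp: hom_incl_def fun_eq_iff)

lemma Hom_inverse:
  assumes "fd_mod sV sA M" "f \<in> Hom M N" "bij_betw f (carrier M) (carrier N)"
  obtains g where "g \<in> Hom N M" "bij_betw g (carrier N) (carrier M)"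
    "\<forall>v\<in>carrier M. g (f v) = v" "\<forall>w\<in>carrier N. f (g w) = w"
proof -
  interpret M: fd_mod sV sA M by fact
  define g where "g w = (if w \<in> carrier N then inv_into (carrier M) f w else 0)" for w
  have 1: "g w \<in> carrier M" "f (g w) = w" if "w \<in> carrier N" for w
    using that assms(3) unfolding g_def bij_betw_def by (auto simp: inv_into_into f_inv_into_f)
  have 2: "g (f v) = v" if "v \<in> carrier M" for v
    using that assms(2,3) unfolding g_def bij_betw_def by (simp add: Hom_closed)
  have "g \<in> Hom N M"
  proof (rule HomI)
    show "g w = 0" if "w \<notin> carrier N" for w using that by (simp add: g_def)
    show "g w \<in> carrier M" if "w \<in> carrier N" for w using that 1 by simp
    show "g (v + w) = g v + g w" if "v \<in> carrier N" "w \<in> carrier N" for v w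
    proof -
      have "f (g v + g w) = v + w" using that 1 assms(2) by (simp add: Hom_add)
      moreover have "g v + g w \<in> carrier M" using that 1 M.subspace_add[OF M.subspace_carrier] by simp
      ultimately show ?thesis using 2 by metis
    qed
    show "g (act N a w) = act M a (g w)" if "w \<in> carrier N" for a w
    proof -
      have "f (act M a (g w)) = act N a w" using that 1 assms(2) by (simp add: Hom_act)
      moreover have "act M a (g w) \<in> carrier M" using that 1 M.act_closed by simp
      ultimately show ?thesis using 2 by metis
    qed
  qed
  moreover have "bij_betw g (carrier N) (carrier M)"
    using 1 2 assms(2) by (intro bij_betw_byWitness[where f' = f]) (auto simp: Hom_closed)
  ultimately show ?thesis using that 1 2 by blast
qed

lemma iso_sym: "fd_mod sV sA M \<Longrightarrow> iso M N \<Longrightarrow> iso N M"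
  unfolding iso_def using Hom_inverse by metis

lemma iso_trans: "iso M N \<Longrightarrow> iso N Q \<Longrightarrow> iso M Q"
  unfolding iso_def using Hom_comp bij_betw_trans by blast

text \<open>Coordinates with respect to a basis embed the carrier into the sequences, and the action
  is carried along. This is the bridge between a module of arbitrary type and notions that quantify
  over \<open>A_mod\<close>.\<close>

lemma (in fd_mod) iso_sequence_module:
  obtains N where "N \<in> A_mod sA" "iso M N"
proof -
  obtain B where B: "finite B" "independent B" "span B = carrier M" "B \<subseteq> carrier M"
    by (rule basis)
  obtain b where b: "bij_betw b {..<card B} B"
    using ex_bij_betw_nat_finite[OF B(1)] by (auto simp: atLeast0LessThan)
  \<comment> \<open>The value is zero beyond the dimension, to obtain a sequence, and zero outside
    the carrier, as \<open>Hom\<close> demands.\<close>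
  define f :: "'v \<Rightarrow> nat \<Rightarrow> 'k" where
    "f v = (\<lambda>n. if v \<in> carrier M \<and> n < card B then representation B v (b n) else 0)" for v
  have lin: "linear_on sV (carrier M) (fscale (*)) f"
    using B(2,3) subspace_add[OF subspace_carrier] subspace_scale[OF subspace_carrier]
    by (simp add: linear_on_def f_def fscale_def fun_eq_iff representation_add representation_scale)
  have inj: "inj_on f (carrier M)"
  proof (rule inj_onI)
    fix v w assume vw: "v \<in> carrier M" "w \<in> carrier M" "f v = f w"
    have "representation B v u = representation B w u" if "u \<in> B" for u
    proof -
      obtain n where "n < card B" "b n = u" using b \<open>u \<in> B\<close> unfolding bij_betw_def by force
      then show ?thesis using fun_cong[OF vw(3), of n] vw by (simp add: f_def)
    qed
    then have "(\<Sum>u\<in>B. sV (representation B v u) u) = (\<Sum>u\<in>B. sV (representation B w u) u)" by simp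
    then show "v = w" using vw B by (simp add: sum_representation_eq)
  qed
  define g where "g = inv_into (carrier M) f"
  have gf: "g (f v) = v" if "v \<in> carrier M" for v using that inj by (simp add: g_def)
  define N where "N = \<lparr>carrier = f ` carrier M, act = (\<lambda>a x. f (act M a (g x)))\<rparr>"
  have vs: "vector_space (fscale (*) :: 'k \<Rightarrow> (nat \<Rightarrow> 'k) \<Rightarrow> _)"
    using vector_space_mult by (rule vector_space_fscale)
  have f_add: "f v + f w = f (v + w)" if "v \<in> carrier M" "w \<in> carrier M" for v w
    using lin that by (simp add: linear_on_def)
  have f_scale: "fscale (*) c (f v) = f (sV c v)" if "v \<in> carrier M" for c v
    using lin that by (simp add: linear_on_def)
  have "f ` carrier M = module.span (fscale (*)) (f ` B)"
    using linear_on_image_span[OF vector_space_axioms vs, of B f] lin B(3) by simp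
  then have "fin_dim (fscale (*)) (carrier N)"
    using B(1) unfolding fin_dim_def N_def by auto
  then have "fd_module sA (fscale (*)) N"
    unfolding fd_module_def N_def
    by (auto simp: gf f_add f_scale act_closed act_add add_act mult_act one_act scalar_act
        subspace_add[OF subspace_carrier])
  moreover have "f \<in> Hom M N"
  proof (rule HomI)
    show "f v = 0" if "v \<notin> carrier M" for v using that by (simp add: f_def fun_eq_iff)
  qed (simp_all add: N_def gf f_add)
  ultimately show ?thesis
    using that[of N] inj unfolding A_mod_def iso_def bij_betw_def by (auto simp: N_def)
qed

lemma A_mod_fd_mod: "N \<in> A_mod sA \<Longrightarrow> fd_mod (fscale (*)) sA N"
  unfolding A_mod_def fd_mod_def fd_mod_axioms_def
  using vector_space_fscale[OF vector_space_mult] by blast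

lemma simple_iso:
  assumes "fd_mod sV sA M" "iso M N" "simple M"
  shows "simple N"
proof -
  obtain f where f: "f \<in> Hom M N" "bij_betw f (carrier M) (carrier N)"
    using assms(2) unfolding iso_def by blast
  obtain g where g: "g \<in> Hom N M" "bij_betw g (carrier N) (carrier M)"
    "\<forall>v\<in>carrier M. g (f v) = v" "\<forall>w\<in>carrier N. f (g w) = w"
    by (rule Hom_inverse[OF assms(1) f])
  have N: "f ` carrier M = carrier N" "g ` carrier N = carrier M"
    using f(2) g(2) unfolding bij_betw_def by auto
  have "carrier N \<noteq> {0}"
    using N(2) Hom_0[OF g(1)] assms(3) unfolding simple_def by auto
  moreover have "W = {0} \<or> W = carrier N" if W: "submodule W N" for W
  proof -
    have "W \<subseteq> carrier N" using W by (simp add: submodule_def)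
    then have "f ` g ` W = W" using g(4) by (force simp: image_iff subset_iff)
    moreover have "g ` W = {0} \<or> g ` W = carrier M"
      using Hom_image_submodule[OF g(1) W] assms(3) unfolding simple_def by blast
    ultimately show ?thesis using N(1) Hom_0[OF f(1)] by force
  qed
  ultimately show ?thesis unfolding simple_def by blast
qed

text \<open>A nonzero submodule of least dimension has no room for a proper nonzero one.\<close>

lemma (in fd_mod) exists_simple_submodule:
  assumes "carrier M \<noteq> {0}"
  obtains W where "submodule W M" "simple (M\<lparr>carrier := W\<rparr>)"
proof -
  define Q where "Q n \<longleftrightarrow> (\<exists>W B. submodule W M \<and> W \<noteq> {0} \<and> finite B \<and> independent B
    \<and> span B = W \<and> card B = n)" for n
  obtain B where "finite B" "independent B" "span B = carrier M" by (rule basis)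
  then have "Q (card B)" unfolding Q_def using submodule_carrier assms by blast
  then have "Q (LEAST n. Q n)" by (rule LeastI)
  then obtain W B where W: "submodule W M" "W \<noteq> {0}" "finite B" "independent B" "span B = W"
    "card B = (LEAST n. Q n)" unfolding Q_def by blast
  have "U = {0} \<or> U = W" if U: "submodule U (M\<lparr>carrier := W\<rparr>)" for U
  proof (rule ccontr)
    assume neg: "\<not> (U = {0} \<or> U = W)"
    have UM: "submodule U M" using submodule_trans[OF W(1) U] .
    have UW: "U \<subset> W" using U neg by (auto simp: submodule_def)
    have "U \<subseteq> span B" using UW W(5) by simp
    then obtain C where C: "finite C" "independent C" "span C = U" "C \<subseteq> U" "card C \<le> card B"
      by (rule subspace_finite_basis[OF vector_space_axioms submodule_subspace[OF UM] W(3)])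
    have "card C < card B" using card_basis_less[OF vector_space_axioms W(3) C(2)] C(3) W(5) UW by simp
    moreover have "Q (card C)" unfolding Q_def using UM neg C by blast
    ultimately show False using not_less_Least W(6) by metis
  qed
  then have "simple (M\<lparr>carrier := W\<rparr>)" using W(2) unfolding simple_def by simp
  with W(1) show ?thesis by (rule that)
qed

section \<open>Projective and injective modules\<close>

text \<open>Frees the test modules from \<open>A_mod\<close>: the problem is conjugated by
  isomorphisms of \<open>X\<close> and \<open>Y\<close> with sequence modules, solved there, and
  moved back. The injective module itself is left in place.\<close>

lemma injective_extend:
  assumes "injective sA E" "fd_mod sX sA X" "fd_mod sY sA Y"
    and "g \<in> Hom X Y" "inj_on g (carrier X)" "f \<in> Hom X E"
  obtains h where "h \<in> Hom Y E" "\<And>x. x \<in> carrier X \<Longrightarrow> h (g x) = f x"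
proof -
  obtain X' where X': "X' \<in> A_mod sA" "iso X X'" by (rule fd_mod.iso_sequence_module[OF assms(2)])
  obtain Y' where Y': "Y' \<in> A_mod sA" "iso Y Y'" by (rule fd_mod.iso_sequence_module[OF assms(3)])
  obtain a where a: "a \<in> Hom X X'" "bij_betw a (carrier X) (carrier X')"
    using X'(2) unfolding iso_def by blast
  obtain a' where a': "a' \<in> Hom X' X" "bij_betw a' (carrier X') (carrier X)"
    "\<forall>v\<in>carrier X. a' (a v) = v" "\<forall>w\<in>carrier X'. a (a' w) = w"
    by (rule Hom_inverse[OF assms(2) a])
  obtain b where b: "b \<in> Hom Y Y'" "bij_betw b (carrier Y) (carrier Y')"
    using Y'(2) unfolding iso_def by blast
  have "inj_on (b \<circ> g \<circ> a') (carrier X')"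
  proof -
    have "inj_on b (g ` carrier X)"
      using b(2) assms(4) by (auto simp: bij_betw_def intro: inj_on_subset Hom_closed)
    then have "inj_on (b \<circ> g) (carrier X)" using assms(5) by (rule comp_inj_on[rotated])
    then show ?thesis using a'(2) unfolding bij_betw_def by (auto intro: comp_inj_on)
  qed
  moreover have "b \<circ> g \<circ> a' \<in> Hom X' Y'" "f \<circ> a' \<in> Hom X' E"
    by (rule Hom_comp[OF a'(1) Hom_comp[OF assms(4) b(1)]], rule Hom_comp[OF a'(1) assms(6)])
  ultimately obtain h where h: "h \<in> Hom Y' E" "h \<circ> (b \<circ> g \<circ> a') = f \<circ> a'"
    using assms(1) X'(1) Y'(1) unfolding injective_def by blast
  have "(h \<circ> b) (g x) = f x" if "x \<in> carrier X" for x
    using fun_cong[OF h(2), of "a x"] that a'(3) by simp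
  moreover have "h \<circ> b \<in> Hom Y E" using Hom_comp[OF b(1) h(1)] .
  ultimately show ?thesis using that by blast
qed

text \<open>The same conjugation for lifting problems; again only the two test modules are replaced
  by copies.\<close>

lemma projective_lift:
  assumes "projective sA P" "fd_mod sX sA X" "fd_mod sY sA Y"
    and "g \<in> Hom X Y" "g ` carrier X = carrier Y" "f \<in> Hom P Y"
  obtains h where "h \<in> Hom P X" "g \<circ> h = f"
proof -
  obtain X' where X': "X' \<in> A_mod sA" "iso X X'" by (rule fd_mod.iso_sequence_module[OF assms(2)])
  obtain Y' where Y': "Y' \<in> A_mod sA" "iso Y Y'" by (rule fd_mod.iso_sequence_module[OF assms(3)])
  obtain a where a: "a \<in> Hom X X'" "bij_betw a (carrier X) (carrier X')"
    using X'(2) unfolding iso_def by blast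
  obtain a' where a': "a' \<in> Hom X' X" "bij_betw a' (carrier X') (carrier X)"
    "\<forall>v\<in>carrier X. a' (a v) = v" "\<forall>w\<in>carrier X'. a (a' w) = w"
    by (rule Hom_inverse[OF assms(2) a])
  obtain b where b: "b \<in> Hom Y Y'" "bij_betw b (carrier Y) (carrier Y')"
    using Y'(2) unfolding iso_def by blast
  obtain b' where b': "b' \<in> Hom Y' Y" "bij_betw b' (carrier Y') (carrier Y)"
    "\<forall>v\<in>carrier Y. b' (b v) = v" "\<forall>w\<in>carrier Y'. b (b' w) = w"
    by (rule Hom_inverse[OF assms(3) b])
  have "(b \<circ> g \<circ> a') ` carrier X' = carrier Y'"
    using a'(2) b(2) assms(5) unfolding bij_betw_def by (simp only: image_comp[symmetric])
  moreover have "b \<circ> g \<circ> a' \<in> Hom X' Y'" "b \<circ> f \<in> Hom P Y'"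
    by (rule Hom_comp[OF a'(1) Hom_comp[OF assms(4) b(1)]], rule Hom_comp[OF assms(6) b(1)])
  ultimately obtain h where h: "h \<in> Hom P X'" "b \<circ> g \<circ> a' \<circ> h = b \<circ> f"
    using assms(1) X'(1) Y'(1) unfolding projective_def by blast
  have ah: "a' \<circ> h \<in> Hom P X" using Hom_comp[OF h(1) a'(1)] .
  have "g \<circ> (a' \<circ> h) = f"
  proof (rule Hom_eqI[OF Hom_comp[OF ah assms(4)] assms(6)])
    fix v assume v: "v \<in> carrier P"
    \<comment> \<open>The isomorphism \<open>b\<close> is injective only on the carrier of
      \<open>Y\<close>, so it can be cancelled only after both arguments are known to lie
      there.\<close>
    have "b (g (a' (h v))) = b (f v)" using fun_cong[OF h(2), of v] by simp
    moreover have "g (a' (h v)) \<in> carrier Y" "f v \<in> carrier Y"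
      using Hom_closed[OF Hom_comp[OF ah assms(4)] v] Hom_closed[OF assms(6) v] by simp_all
    ultimately show "(g \<circ> (a' \<circ> h)) v = f v" using b'(3) by (metis comp_apply)
  qed
  with ah show ?thesis by (rule that)
qed

lemma injective_iso:
  assumes "fd_mod sV sA E" "injective sA E" "iso E E'"
  shows "injective sA E'"
proof -
  obtain f where f: "f \<in> Hom E E'" "bij_betw f (carrier E) (carrier E')"
    using assms(3) unfolding iso_def by blast
  obtain g where g: "g \<in> Hom E' E" "bij_betw g (carrier E') (carrier E)"
    "\<forall>v\<in>carrier E. g (f v) = v" "\<forall>w\<in>carrier E'. f (g w) = w"
    by (rule Hom_inverse[OF assms(1) f])
  show ?thesis unfolding injective_def
  proof (intro ballI impI)
    fix X Y u k
    assume XY: "X \<in> A_mod sA" "Y \<in> A_mod sA" "u \<in> Hom X Y" "k \<in> Hom X E'" "inj_on u (carrier X)"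
    then obtain h where h: "h \<in> Hom Y E" "h \<circ> u = g \<circ> k"
      using assms(2) Hom_comp[OF XY(4) g(1)] unfolding injective_def by blast
    have "f \<circ> h \<circ> u = k"
    proof (rule Hom_eqI[OF Hom_comp[OF XY(3) Hom_comp[OF h(1) f(1)]] XY(4)])
      fix x assume "x \<in> carrier X"
      then show "(f \<circ> h \<circ> u) x = k x"
        using fun_cong[OF h(2), of x] g(4) Hom_closed[OF XY(4)] by simp
    qed
    then show "\<exists>h\<in>Hom Y E'. h \<circ> u = k" using Hom_comp[OF h(1) f(1)] by blast
  qed
qed

section \<open>Minimal and maximal submodules\<close>

text \<open>A least nonzero submodule, contained in all others, and not merely a minimal one. It is
  therefore unique when it exists, and is the simple socle.\<close>

definition minimal_submodule :: "'v::ab_group_add set \<Rightarrow> ('a, 'v) amod \<Rightarrow> bool" where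
  "minimal_submodule T M \<longleftrightarrow>
     submodule T M \<and> T \<noteq> {0} \<and> (\<forall>U. submodule U M \<longrightarrow> U \<noteq> {0} \<longrightarrow> T \<subseteq> U)"

text \<open>A greatest proper submodule, again stronger than maximality: its existence says that the
  module is local.\<close>

definition maximal_submodule :: "'v::ab_group_add set \<Rightarrow> ('a, 'v) amod \<Rightarrow> bool" where
  "maximal_submodule N M \<longleftrightarrow>
     submodule N M \<and> N \<noteq> carrier M \<and> (\<forall>U. submodule U M \<longrightarrow> U \<noteq> carrier M \<longrightarrow> U \<subseteq> N)"

lemma minimal_submodule_unique:
  "minimal_submodule T M \<Longrightarrow> minimal_submodule T' M \<Longrightarrow> T = T'"
  unfolding minimal_submodule_def by blast

lemma minimal_submodule_simple:
  assumes "minimal_submodule T M"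
  shows "simple (M\<lparr>carrier := T\<rparr>)"
proof -
  have "U = {0} \<or> U = T" if U: "submodule U (M\<lparr>carrier := T\<rparr>)" for U
  proof -
    have "submodule U M" using submodule_trans U assms unfolding minimal_submodule_def by blast
    moreover have "U \<subseteq> T" using U by (simp add: submodule_def)
    ultimately show ?thesis using assms unfolding minimal_submodule_def by blast
  qed
  then show ?thesis using assms unfolding simple_def minimal_submodule_def by simp
qed

text \<open>Any simple submodule contains \<open>T\<close> and hence equals it, so the sum defining
  the socle has a single summand.\<close>

lemma (in fd_mod) socle_minimal_submodule:
  assumes "minimal_submodule T M"
  shows "socle sV M = T"
proof -
  have T: "submodule T M" "T \<noteq> {0}" using assms unfolding minimal_submodule_def by auto
  have "W = T" if W: "submodule W M" "simple (M\<lparr>carrier := W\<rparr>)" for W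
  proof -
    have "W \<noteq> {0}" using W(2) unfolding simple_def by simp
    then have "T \<subseteq> W" using assms W(1) unfolding minimal_submodule_def by blast
    then have "submodule T (M\<lparr>carrier := W\<rparr>)" using T(1) submodule_restrict by blast
    then show "W = T" using W(2) T(2) unfolding simple_def by auto
  qed
  then have "{W. submodule W M \<and> simple (M\<lparr>carrier := W\<rparr>)} = {T}"
    using T(1) minimal_submodule_simple[OF assms] by blast
  then show ?thesis
    unfolding socle_def using submodule_subspace[OF T(1)] span_eq_iff by simp
qed

lemma Hom_bij_image_vimage:
  assumes "fd_mod sV sA M" "f \<in> Hom M N" "bij_betw f (carrier M) (carrier N)" "submodule U N"
  obtains U' where "submodule U' M" "f ` U' = U"
proof -
  obtain g where g: "g \<in> Hom N M" "bij_betw g (carrier N) (carrier M)"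
    "\<forall>v\<in>carrier M. g (f v) = v" "\<forall>w\<in>carrier N. f (g w) = w"
    by (rule Hom_inverse[OF assms(1-3)])
  have "U \<subseteq> carrier N" using assms(4) by (simp add: submodule_def)
  then have "f ` g ` U = U" using g(4) by (force simp: image_iff subset_iff)
  then show ?thesis using that Hom_image_submodule[OF g(1) assms(4)] by blast
qed

lemma minimal_submodule_iso:
  assumes "fd_mod sV sA M" "f \<in> Hom M N" "bij_betw f (carrier M) (carrier N)"
    and "minimal_submodule T M"
  shows "minimal_submodule (f ` T) N"
proof -
  have T: "submodule T M" "T \<noteq> {0}" using assms(4) unfolding minimal_submodule_def by auto
  have f0: "f 0 = 0" using Hom_0[OF assms(2)] .
  have inj: "inj_on f (carrier M)" using assms(3) by (simp add: bij_betw_def)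
  have "f ` T \<noteq> {0}"
  proof -
    obtain t where "t \<in> T" "t \<noteq> 0" using T unfolding submodule_def by blast
    moreover have "0 \<in> carrier M" "t \<in> carrier M" using T(1) \<open>t \<in> T\<close> unfolding submodule_def by auto
    ultimately have "f t \<noteq> 0" using inj f0 by (metis inj_onD)
    then show ?thesis using \<open>t \<in> T\<close> by blast
  qed
  moreover have "f ` T \<subseteq> U" if U: "submodule U N" "U \<noteq> {0}" for U
  proof -
    obtain U' where "submodule U' M" "f ` U' = U"
      by (rule Hom_bij_image_vimage[OF assms(1-3) U(1)])
    moreover from this have "U' \<noteq> {0}" using U(2) f0 by auto
    ultimately show ?thesis using assms(4) unfolding minimal_submodule_def by blast
  qed
  ultimately show ?thesis
    using Hom_image_submodule[OF assms(2) T(1)] unfolding minimal_submodule_def by blast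
qed

text \<open>If \<open>U\<close> is nonzero, essentiality makes its preimage in \<open>L\<close>
  nonzero, and simplicity then makes that preimage all of \<open>L\<close>. So the copy of
  \<open>L\<close> lies in every nonzero submodule.\<close>

lemma injective_envelope_minimal_submodule:
  assumes "fd_mod sV sA L" "simple L" "vector_space sV" "injective_envelope sA sV E L"
  obtains i where "i \<in> Hom L E" "inj_on i (carrier L)" "minimal_submodule (i ` carrier L) E"
proof -
  obtain i where i: "i \<in> Hom L E" "inj_on i (carrier L)" "essential (i ` carrier L) E"
    using assms(4) unfolding injective_envelope_def by blast
  interpret L: fd_mod sV sA L by fact
  have "carrier L \<noteq> {0}" using assms(2) unfolding simple_def by blast
  then obtain x where x: "x \<in> carrier L" "x \<noteq> 0" using L.zero_closed by blast
  then have "i x \<noteq> 0" using i(2) Hom_0[OF i(1)] L.zero_closed by (metis inj_onD)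
  then have ne: "i ` carrier L \<noteq> {0}" using x by blast
  have "i ` carrier L \<subseteq> U" if U: "submodule U E" "U \<noteq> {0}" for U
  proof -
    have "0 \<in> U \<inter> i ` carrier L"
      using U(1) L.zero_closed Hom_0[OF i(1)] unfolding submodule_def by force
    moreover have "U \<inter> i ` carrier L \<noteq> {0}" using i(3) U unfolding essential_def by blast
    ultimately obtain y where y: "y \<in> carrier L" "i y \<in> U" "i y \<noteq> 0" by blast
    have "submodule {x \<in> carrier L. i x \<in> U} L"
      using U(1) L.submodule_carrier unfolding submodule_def
      by (simp add: Hom_0[OF i(1)] Hom_add[OF i(1)] Hom_act[OF i(1)])
    then have "{x \<in> carrier L. i x \<in> U} = {0} \<or> {x \<in> carrier L. i x \<in> U} = carrier L"
      using assms(2) unfolding simple_def by blast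
    moreover have "y \<noteq> 0" using y Hom_0[OF i(1)] by auto
    ultimately show ?thesis using y by blast
  qed
  then have "minimal_submodule (i ` carrier L) E"
    using Hom_image_submodule[OF i(1) L.submodule_carrier] ne unfolding minimal_submodule_def by blast
  then show ?thesis using that i by blast
qed

lemma projective_cover_maximal_submodule:
  assumes "fd_mod sV sA L" "simple L" "vector_space sV" "projective_cover sA sV P L"
  obtains q where "q \<in> Hom P L" "q ` carrier P = carrier L" "maximal_submodule (ker_on P q) P"
proof -
  obtain q where q: "q \<in> Hom P L" "q ` carrier P = carrier L" "superfluous (ker_on P q) P"
    using assms(4) unfolding projective_cover_def by blast
  interpret L: fd_mod sV sA L by fact
  interpret P: fd_mod sV sA P
    using assms(3,4) unfolding projective_cover_def fd_mod_def fd_mod_axioms_def by blast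
  have ker: "submodule (ker_on P q) P"
    using Hom_kernel_submodule[OF P.fd_mod_axioms L.fd_mod_axioms q(1)] .
  have "carrier L \<noteq> {0}" using assms(2) unfolding simple_def by blast
  then obtain x where x: "x \<in> carrier L" "x \<noteq> 0" using L.zero_closed by blast
  then have ne: "ker_on P q \<noteq> carrier P" using q(2) by force
  have "U \<subseteq> ker_on P q" if U: "submodule U P" "U \<noteq> carrier P" for U
  proof -
    have UP: "U \<subseteq> carrier P" using U(1) by (simp add: submodule_def)
    have "q ` U = {0} \<or> q ` U = carrier L"
      using Hom_image_submodule[OF q(1) U(1)] assms(2) unfolding simple_def by blast
    moreover have "q ` U \<noteq> carrier L"
    proof
      assume eq: "q ` U = carrier L"
      have "v \<in> {u + n |u n. u \<in> U \<and> n \<in> ker_on P q}" if v: "v \<in> carrier P" for v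
      proof -
        have "q v \<in> q ` U" using eq Hom_closed[OF q(1) v] by simp
        then obtain u where u: "u \<in> U" "q u = q v" by auto
        then have "v - u \<in> ker_on P q"
          using v UP P.diff_closed Hom_diff[OF P.fd_mod_axioms q(1) v] by auto
        moreover have "v = u + (v - u)" by simp
        ultimately show ?thesis using u(1) by blast
      qed
      moreover have "{u + n |u n. u \<in> U \<and> n \<in> ker_on P q} \<subseteq> carrier P"
        using UP L.subspace_add[OF P.subspace_carrier] by blast
      ultimately have "{u + n |u n. u \<in> U \<and> n \<in> ker_on P q} = carrier P" by blast
      then show False using q(3) U unfolding superfluous_def by blast
    qed
    ultimately show ?thesis using UP by blast
  qed
  then show ?thesis using that[of q] q ker ne unfolding maximal_submodule_def by blast
qed

lemma Hom_ne_0: "f \<in> Hom M N \<Longrightarrow> f \<noteq> 0 \<longleftrightarrow> (\<exists>v\<in>carrier M. f v \<noteq> 0)"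
  by (metis Hom_outside ext zero_fun_apply)

section \<open>Lifting and extending socle maps\<close>

lemma factor_through_projective:
  assumes "fd_mod sV sA M" "fd_mod sW sA N" "projective sA Q"
    and "f \<in> Hom M N" "f \<noteq> 0" "minimal_submodule T N" "\<theta> \<in> Hom Q N" "\<theta> ` carrier Q \<subseteq> T"
  obtains g where "g \<in> Hom Q M" "f \<circ> g = \<theta>"
proof -
  interpret M: fd_mod sV sA M by fact
  interpret N: fd_mod sW sA N by fact
  let ?W = "f ` carrier M"
  have W: "submodule ?W N" using Hom_image_submodule[OF assms(4) M.submodule_carrier] .
  have "?W \<noteq> {0}" using assms(5) Hom_ne_0[OF assms(4)] by blast
  then have "T \<subseteq> ?W" using assms(6) W unfolding minimal_submodule_def by blast
  \<comment> \<open>Lifting requires a surjection, so \<open>f\<close> and \<open>\<theta>\<close>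
    are both regarded as maps into the image of \<open>f\<close>; for \<open>\<theta>\<close> this
    is possible because that image contains \<open>T\<close>.\<close>
  then have \<theta>: "\<theta> \<in> Hom Q (N\<lparr>carrier := ?W\<rparr>)"
    using assms(7,8) by (blast intro: Hom_restrict_codomain)
  have f: "f \<in> Hom M (N\<lparr>carrier := ?W\<rparr>)" using assms(4) by (blast intro: Hom_restrict_codomain)
  have "f ` carrier M = carrier (N\<lparr>carrier := ?W\<rparr>)" by simp
  from projective_lift[OF assms(3) assms(1) N.fd_mod_submodule[OF W] f this \<theta>] show ?thesis
    using that by blast
qed

text \<open>The homomorphism theorem without forming a quotient: the image of \<open>f\<close> takes
  its place, preimages are chosen, and the inclusion of kernels makes the result independent of the
  choice.\<close>

lemma Hom_factor_image:
  assumes "fd_mod sV sA M" "f \<in> Hom M N" "\<theta> \<in> Hom M E"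
    and "ker_on M f \<subseteq> ker_on M \<theta>"
  obtains k where "k \<in> Hom (N\<lparr>carrier := f ` carrier M\<rparr>) E" "\<forall>v\<in>carrier M. k (f v) = \<theta> v"
proof -
  interpret M: fd_mod sV sA M by fact
  define k where "k w = (if w \<in> f ` carrier M then \<theta> (inv_into (carrier M) f w) else 0)" for w
  have k: "k (f v) = \<theta> v" if v: "v \<in> carrier M" for v
  proof -
    define u where "u = inv_into (carrier M) f (f v)"
    have u: "u \<in> carrier M" "f u = f v" unfolding u_def using v by (auto intro: inv_into_into f_inv_into_f)
    then have "u - v \<in> ker_on M f" using v M.diff_closed Hom_diff[OF assms(1,2)] by simp
    then have "\<theta> u = \<theta> v" using assms(4) Hom_diff[OF assms(1,3) u(1) v] by auto
    then show ?thesis using v by (simp add: k_def u_def)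
  qed
  have "k \<in> Hom (N\<lparr>carrier := f ` carrier M\<rparr>) E"
  proof (rule HomI)
    show "k w = 0" if "w \<notin> carrier (N\<lparr>carrier := f ` carrier M\<rparr>)" for w
      using that by (simp add: k_def)
    show "k w \<in> carrier E" if "w \<in> carrier (N\<lparr>carrier := f ` carrier M\<rparr>)" for w
      using that k Hom_closed[OF assms(3)] by auto
    show "k (v + w) = k v + k w"
      if vw: "v \<in> carrier (N\<lparr>carrier := f ` carrier M\<rparr>)" "w \<in> carrier (N\<lparr>carrier := f ` carrier M\<rparr>)" for v w
    proof -
      obtain v' w' where v': "v' \<in> carrier M" "v = f v'" "w' \<in> carrier M" "w = f w'" using vw by auto
      then have "v + w = f (v' + w')" "v' + w' \<in> carrier M"
        using Hom_add[OF assms(2)] M.subspace_add[OF M.subspace_carrier] by auto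
      then show ?thesis using v' k Hom_add[OF assms(3)] by simp
    qed
    show "k (act (N\<lparr>carrier := f ` carrier M\<rparr>) a w) = act E a (k w)"
      if w: "w \<in> carrier (N\<lparr>carrier := f ` carrier M\<rparr>)" for a w
    proof -
      obtain w' where w': "w' \<in> carrier M" "w = f w'" using w by auto
      then have "act N a w = f (act M a w')" "act M a w' \<in> carrier M"
        using Hom_act[OF assms(2)] M.act_closed by auto
      then show ?thesis using w' k Hom_act[OF assms(3)] by simp
    qed
  qed
  then show ?thesis using that k by blast
qed

text \<open>The kernel of \<open>f\<close> is proper and so lies in \<open>R\<close>; it remains to
  see that \<open>\<theta>\<close> kills \<open>R\<close>. Otherwise the image of \<open>R\<close>
  would contain \<open>T\<close>, the whole image of \<open>\<theta>\<close>, and as the kernel of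
  \<open>\<theta>\<close> also lies in \<open>R\<close>, the submodule \<open>R\<close> would be
  everything. Thus \<open>\<theta>\<close> descends to the image of \<open>f\<close>, and
  injectivity of \<open>E\<close> extends it to \<open>N\<close>.\<close>

lemma factor_through_injective:
  assumes "fd_mod sV sA M" "fd_mod sW sA N" "fd_mod sE sA E" "injective sA E"
    and "f \<in> Hom M N" "f \<noteq> 0" "maximal_submodule R M"
    and "minimal_submodule T E" "\<theta> \<in> Hom M E" "\<theta> ` carrier M = T"
  obtains g where "g \<in> Hom N E" "g \<circ> f = \<theta>"
proof -
  interpret M: fd_mod sV sA M by fact
  interpret N: fd_mod sW sA N by fact
  have R: "submodule R M" "R \<noteq> carrier M" "\<And>U. submodule U M \<Longrightarrow> U \<noteq> carrier M \<Longrightarrow> U \<subseteq> R"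
    using assms(7) unfolding maximal_submodule_def by auto
  have T: "T \<noteq> {0}" "\<And>U. submodule U E \<Longrightarrow> U \<noteq> {0} \<Longrightarrow> T \<subseteq> U"
    using assms(8) unfolding minimal_submodule_def by auto
  have "ker_on M f \<noteq> carrier M" using assms(6) Hom_ne_0[OF assms(5)] by blast
  then have "ker_on M f \<subseteq> R" using Hom_kernel_submodule[OF assms(1,2,5)] R(3) by blast
  have "ker_on M \<theta> \<noteq> carrier M"
  proof
    assume "ker_on M \<theta> = carrier M"
    then have "\<theta> ` carrier M \<subseteq> {0}" by blast
    then have "T \<subseteq> {0}" using assms(10) by simp
    moreover have "0 \<in> T" using assms(8) unfolding minimal_submodule_def submodule_def by simp
    ultimately show False using T(1) by (simp add: subset_singleton_iff)
  qed
  then have kR: "ker_on M \<theta> \<subseteq> R" using Hom_kernel_submodule[OF assms(1,3,9)] R(3) by blast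
  have "\<theta> ` R = {0}"
  proof (rule ccontr)
    assume "\<theta> ` R \<noteq> {0}"
    then have sub: "T \<subseteq> \<theta> ` R" using Hom_image_submodule[OF assms(9) R(1)] T(2) by blast
    have "v \<in> R" if v: "v \<in> carrier M" for v
    proof -
      obtain r where r: "r \<in> R" "\<theta> r = \<theta> v" using sub v assms(10) by force
      then have "r \<in> carrier M" using R(1) unfolding submodule_def by blast
      then have "v - r \<in> ker_on M \<theta>"
        using r v M.diff_closed Hom_diff[OF assms(1,9)] by simp
      then have "v - r + r \<in> R" using kR r R(1) unfolding submodule_def by blast
      then show ?thesis by simp
    qed
    then show False using R unfolding submodule_def by blast
  qed
  then have "ker_on M f \<subseteq> ker_on M \<theta>" using \<open>ker_on M f \<subseteq> R\<close> by blast
  then obtain k where k: "k \<in> Hom (N\<lparr>carrier := f ` carrier M\<rparr>) E" "\<forall>v\<in>carrier M. k (f v) = \<theta> v"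
    by (rule Hom_factor_image[OF assms(1,5,9)])
  have W: "submodule (f ` carrier M) N" using Hom_image_submodule[OF assms(5) M.submodule_carrier] .
  have inj: "inj_on (hom_incl (f ` carrier M)) (carrier (N\<lparr>carrier := f ` carrier M\<rparr>))"
    by (auto simp: hom_incl_def inj_on_def)
  obtain g where g: "g \<in> Hom N E"
    "\<And>x. x \<in> carrier (N\<lparr>carrier := f ` carrier M\<rparr>) \<Longrightarrow> g (hom_incl (f ` carrier M) x) = k x"
    using injective_extend[OF assms(4) N.fd_mod_submodule[OF W] assms(2) hom_incl_Hom[OF W] inj k(1)]
    by blast
  have "g \<circ> f = \<theta>"
  proof (rule Hom_eqI[OF Hom_comp[OF assms(5) g(1)] assms(9)])
    fix v assume "v \<in> carrier M"
    then show "(g \<circ> f) v = \<theta> v" using g(2)[of "f v"] k(2) by (simp add: hom_incl_def)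
  qed
  with g(1) show ?thesis by (rule that)
qed

section \<open>Injective envelopes\<close>

text \<open>A map whose kernel meets an essential submodule trivially is injective. This applies
  first to an extension \<open>h\<close> of \<open>j\<close> along \<open>i\<close>, and then to a
  retraction \<open>r\<close> of \<open>h\<close>; the latter is surjective as a retraction, so
  bijectivity comes without a dimension count.\<close>

lemma injective_essential_extension_unique:
  assumes "fd_mod sV sA L" "fd_mod sE sA E" "fd_mod sF sA F"
    and inj: "injective sA E" "injective sA F"
    and i: "i \<in> Hom L E" "inj_on i (carrier L)" "essential (i ` carrier L) E"
    and j: "j \<in> Hom L F" "inj_on j (carrier L)" "essential (j ` carrier L) F"
  shows "iso E F"
proof -
  interpret L: fd_mod sV sA L by fact
  interpret E: fd_mod sE sA E by fact
  interpret F: fd_mod sF sA F by fact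
  obtain h where h: "h \<in> Hom E F" "\<And>x. x \<in> carrier L \<Longrightarrow> h (i x) = j x"
    using injective_extend[OF inj(2) L.fd_mod_axioms E.fd_mod_axioms i(1,2) j(1)] by blast
  have "ker_on E h \<inter> i ` carrier L = {0}"
  proof -
    have "i x = 0" if "x \<in> carrier L" "h (i x) = 0" for x
    proof -
      have "j x = j 0" using that h(2) Hom_0[OF j(1)] by simp
      then have "x = 0" using j(2) that L.zero_closed by (metis inj_onD)
      then show ?thesis using Hom_0[OF i(1)] by simp
    qed
    moreover have "0 \<in> i ` carrier L" using L.zero_closed Hom_0[OF i(1)] by (metis imageI)
    ultimately show ?thesis using Hom_0[OF h(1)] E.zero_closed by auto
  qed
  then have "ker_on E h = {0}"
    using i(3) Hom_kernel_submodule[OF E.fd_mod_axioms F.fd_mod_axioms h(1)]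
    unfolding essential_def by blast
  then have hinj: "inj_on h (carrier E)" using Hom_inj_on_iff[OF E.fd_mod_axioms h(1)] by simp
  have id: "hom_incl (carrier E) \<in> Hom E E"
    using hom_incl_Hom[OF E.submodule_carrier] by simp
  \<comment> \<open>Injectivity of \<open>E\<close> extends its identity along the embedding
    \<open>h\<close>.\<close>
  obtain r where r: "r \<in> Hom F E" "\<And>x. x \<in> carrier E \<Longrightarrow> r (h x) = hom_incl (carrier E) x"
    using injective_extend[OF inj(1) E.fd_mod_axioms F.fd_mod_axioms h(1) hinj id] by blast
  then have rh: "r (h x) = x" if "x \<in> carrier E" for x using that by (simp add: hom_incl_def)
  have "ker_on F r \<inter> j ` carrier L = {0}"
  proof -
    have "j x = 0" if "x \<in> carrier L" "r (j x) = 0" for x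
    proof -
      have "i x = i 0" using that h(2)[of x] rh[of "i x"] Hom_closed[OF i(1)] Hom_0[OF i(1)] by simp
      then have "x = 0" using i(2) that L.zero_closed by (metis inj_onD)
      then show ?thesis using Hom_0[OF j(1)] by simp
    qed
    moreover have "0 \<in> j ` carrier L" using L.zero_closed Hom_0[OF j(1)] by (metis imageI)
    ultimately show ?thesis using Hom_0[OF r(1)] F.zero_closed by auto
  qed
  then have "ker_on F r = {0}"
    using j(3) Hom_kernel_submodule[OF F.fd_mod_axioms E.fd_mod_axioms r(1)]
    unfolding essential_def by blast
  then have "inj_on r (carrier F)" using Hom_inj_on_iff[OF F.fd_mod_axioms r(1)] by simp
  moreover have "r ` carrier F = carrier E"
  proof
    show "r ` carrier F \<subseteq> carrier E" using Hom_closed[OF r(1)] by blast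
    show "carrier E \<subseteq> r ` carrier F" using rh Hom_closed[OF h(1)] by (metis imageI subsetI)
  qed
  ultimately have "iso F E" using r(1) unfolding iso_def bij_betw_def by blast
  then show ?thesis using iso_sym F.fd_mod_axioms by blast
qed

lemma iso_image:
  assumes "f \<in> Hom M N" "inj_on f (carrier M)"
  shows "iso M (N\<lparr>carrier := f ` carrier M\<rparr>)"
proof -
  have "f \<in> Hom M (N\<lparr>carrier := f ` carrier M\<rparr>)"
    using Hom_restrict_codomain[OF assms(1)] by blast
  then show ?thesis using assms(2) unfolding iso_def bij_betw_def by auto
qed

text \<open>Completeness of the simple modules is stated over \<open>A_mod\<close>, so a simple
  module of another type is first replaced by a sequence copy.\<close>

lemma complete_simples_iso:
  assumes "complete_simples sA sV \<Lambda> L" "fd_mod sW sA M" "simple M"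
  obtains k where "k \<in> \<Lambda>" "iso M (L k)"
proof -
  obtain N where N: "N \<in> A_mod sA" "iso M N" by (rule fd_mod.iso_sequence_module[OF assms(2)])
  then have "simple N" using simple_iso[OF assms(2)] assms(3) by blast
  then obtain k where "k \<in> \<Lambda>" "iso N (L k)"
    using assms(1) N(1) unfolding complete_simples_def by blast
  then show ?thesis using that iso_trans[OF N(2)] by blast
qed

text \<open>The envelope of a simple submodule splits off, and a complement would lie in the maximal
  submodule.\<close>

lemma injective_local_iso_envelope:
  assumes "fd_mod sV sA M" "injective sA M" "maximal_submodule R M"
    and "complete_simples sA sV \<Lambda> L" "\<forall>i\<in>\<Lambda>. injective_envelope sA sV (I i) (L i)"
  obtains k where "k \<in> \<Lambda>" "iso M (I k)"
proof -
  interpret M: fd_mod sV sA M by fact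
  have R: "submodule R M" "R \<noteq> carrier M" "\<And>U. submodule U M \<Longrightarrow> U \<noteq> carrier M \<Longrightarrow> U \<subseteq> R"
    using assms(3) unfolding maximal_submodule_def by auto
  have "R \<subseteq> carrier M" "0 \<in> R" using R(1) unfolding submodule_def by simp_all
  then have "carrier M \<noteq> {0}" using R(2) by (auto simp: subset_singleton_iff)
  then obtain W where W: "submodule W M" "simple (M\<lparr>carrier := W\<rparr>)"
    by (rule M.exists_simple_submodule)
  have fdW: "fd_mod sV sA (M\<lparr>carrier := W\<rparr>)" using M.fd_mod_submodule[OF W(1)] .
  obtain k where k: "k \<in> \<Lambda>" "iso (M\<lparr>carrier := W\<rparr>) (L k)"
    by (rule complete_simples_iso[OF assms(4) fdW W(2)])
  interpret I: fd_mod sV sA "I k"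
    using assms(5) k(1) M.vector_space_axioms
    unfolding injective_envelope_def fd_mod_def fd_mod_axioms_def by blast
  interpret L: fd_mod sV sA "L k"
    using assms(4) k(1) M.vector_space_axioms
    unfolding complete_simples_def fd_mod_def fd_mod_axioms_def by blast
  have simL: "simple (L k)" using assms(4) k(1) unfolding complete_simples_def by blast
  have "iso (L k) (M\<lparr>carrier := W\<rparr>)" using iso_sym[OF fdW k(2)] .
  then obtain e where e: "e \<in> Hom (L k) (M\<lparr>carrier := W\<rparr>)" "inj_on e (carrier (L k))"
    unfolding iso_def bij_betw_def by blast
  have eM: "e \<in> Hom (L k) M" using Hom_codomain[OF e(1)] W(1) unfolding submodule_def by blast
  obtain i where i: "i \<in> Hom (L k) (I k)" "inj_on i (carrier (L k))" "essential (i ` carrier (L k)) (I k)"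
    using assms(5) k(1) unfolding injective_envelope_def by blast
  obtain h where h: "h \<in> Hom (I k) M" "\<And>x. x \<in> carrier (L k) \<Longrightarrow> h (i x) = e x"
    using injective_extend[OF assms(2) L.fd_mod_axioms I.fd_mod_axioms i(1,2) eM] by blast
  have "ker_on (I k) h \<inter> i ` carrier (L k) = {0}"
  proof -
    have "i x = 0" if "x \<in> carrier (L k)" "h (i x) = 0" for x
    proof -
      have "e x = e 0" using that h(2) Hom_0[OF eM] by simp
      then have "x = 0" using e(2) that L.zero_closed by (metis inj_onD)
      then show ?thesis using Hom_0[OF i(1)] by simp
    qed
    moreover have "0 \<in> i ` carrier (L k)" using L.zero_closed Hom_0[OF i(1)] by (metis imageI)
    ultimately show ?thesis using Hom_0[OF h(1)] I.zero_closed by auto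
  qed
  then have "ker_on (I k) h = {0}"
    using i(3) Hom_kernel_submodule[OF I.fd_mod_axioms M.fd_mod_axioms h(1)]
    unfolding essential_def by blast
  then have hinj: "inj_on h (carrier (I k))" using Hom_inj_on_iff[OF I.fd_mod_axioms h(1)] by simp
  have id: "hom_incl (carrier (I k)) \<in> Hom (I k) (I k)"
    using hom_incl_Hom[OF I.submodule_carrier] by simp
  have "injective sA (I k)" using assms(5) k(1) unfolding injective_envelope_def by blast
  then obtain r where r: "r \<in> Hom M (I k)"
    "\<And>x. x \<in> carrier (I k) \<Longrightarrow> r (h x) = hom_incl (carrier (I k)) x"
    using injective_extend[OF _ I.fd_mod_axioms M.fd_mod_axioms h(1) hinj id] by blast
  then have rh: "r (h x) = x" if "x \<in> carrier (I k)" for x using that by (simp add: hom_incl_def)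
  have "h ` carrier (I k) = carrier M"
  proof (rule ccontr)
    assume "h ` carrier (I k) \<noteq> carrier M"
    then have imR: "h ` carrier (I k) \<subseteq> R"
      using R(3) Hom_image_submodule[OF h(1) I.submodule_carrier] by blast
    have "ker_on M r \<noteq> carrier M"
    proof
      assume eq: "ker_on M r = carrier M"
      have I0: "x = 0" if "x \<in> carrier (I k)" for x
      proof -
        have "h x \<in> ker_on M r" unfolding eq using Hom_closed[OF h(1) that] .
        then show ?thesis using rh[OF that] by simp
      qed
      have "x = 0" if "x \<in> carrier (L k)" for x
      proof -
        have "i x = i 0" using I0[OF Hom_closed[OF i(1) that]] Hom_0[OF i(1)] by simp
        then show ?thesis using i(2) that L.zero_closed by (metis inj_onD)
      qed
      then have "carrier (L k) = {0}" using L.zero_closed by blast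
      then show False using simL unfolding simple_def by blast
    qed
    then have kR: "ker_on M r \<subseteq> R"
      using R(3) Hom_kernel_submodule[OF M.fd_mod_axioms I.fd_mod_axioms r(1)] by blast
    \<comment> \<open>Every \<open>v\<close> is the sum of \<open>h (r v)\<close> and an element of
      the kernel of \<open>r\<close>. If \<open>h\<close> were not onto, both its image and this
      kernel would be proper submodules, hence inside \<open>R\<close>.\<close>
    have "v \<in> R" if v: "v \<in> carrier M" for v
    proof -
      have rv: "r v \<in> carrier (I k)" using Hom_closed[OF r(1) v] .
      then have hrv: "h (r v) \<in> carrier M" using Hom_closed[OF h(1)] by blast
      then have "v - h (r v) \<in> ker_on M r"
        using v M.diff_closed Hom_diff[OF M.fd_mod_axioms r(1) v hrv] rh[OF rv] by simp
      then have "v - h (r v) + h (r v) \<in> R"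
        using kR imR rv R(1) unfolding submodule_def by blast
      then show ?thesis by simp
    qed
    then show False using R(1,2) unfolding submodule_def by blast
  qed
  then have "iso (I k) M" using h(1) hinj unfolding iso_def bij_betw_def by blast
  then show ?thesis using that[OF k(1)] iso_sym[OF I.fd_mod_axioms] by blast
qed

text \<open>Isomorphisms preserve least nonzero submodules, and that of \<open>I k\<close> is a copy
  of \<open>L k\<close>. The index can thus be read off from the module, which justifies the
  definite description in \<open>prime_map\<close>.\<close>

lemma iso_envelope_unique:
  assumes "fd_mod sV sA M" "complete_simples sA sV \<Lambda> L"
    and "\<forall>i\<in>\<Lambda>. injective_envelope sA sV (I i) (L i)"
    and "k \<in> \<Lambda>" "l \<in> \<Lambda>" "iso M (I k)" "iso M (I l)"
  shows "k = l"
proof -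
  interpret M: fd_mod sV sA M by fact
  have I: "fd_mod sV sA (I i)" if "i \<in> \<Lambda>" for i
    using assms(3) that M.vector_space_axioms
    unfolding injective_envelope_def fd_mod_def fd_mod_axioms_def by blast
  have L: "fd_mod sV sA (L i)" "simple (L i)" if "i \<in> \<Lambda>" for i
    using assms(2) that M.vector_space_axioms
    unfolding complete_simples_def fd_mod_def fd_mod_axioms_def by blast+
  have "iso (I k) (I l)" using iso_trans[OF iso_sym[OF assms(1,6)] assms(7)] .
  then obtain f where f: "f \<in> Hom (I k) (I l)" "bij_betw f (carrier (I k)) (carrier (I l))"
    unfolding iso_def by blast
  obtain i where i: "i \<in> Hom (L k) (I k)" "inj_on i (carrier (L k))"
    "minimal_submodule (i ` carrier (L k)) (I k)"
    using injective_envelope_minimal_submodule[OF L[OF assms(4)] M.vector_space_axioms] assms(3,4) by blast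
  obtain j where j: "j \<in> Hom (L l) (I l)" "inj_on j (carrier (L l))"
    "minimal_submodule (j ` carrier (L l)) (I l)"
    using injective_envelope_minimal_submodule[OF L[OF assms(5)] M.vector_space_axioms] assms(3,5) by blast
  have eq: "(f \<circ> i) ` carrier (L k) = j ` carrier (L l)"
    using minimal_submodule_unique[OF minimal_submodule_iso[OF I[OF assms(4)] f i(3)] j(3)]
    by (simp only: image_comp)
  have "inj_on f (i ` carrier (L k))"
    using f(2) Hom_closed[OF i(1)] unfolding bij_betw_def by (auto intro: inj_on_subset)
  then have "inj_on (f \<circ> i) (carrier (L k))" using comp_inj_on i(2) by blast
  then have "iso (L k) (I l\<lparr>carrier := j ` carrier (L l)\<rparr>)"
    using iso_image[OF Hom_comp[OF i(1) f(1)]] eq by simp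
  moreover have "iso (I l\<lparr>carrier := j ` carrier (L l)\<rparr>) (L l)"
    using iso_sym[OF L(1)[OF assms(5)] iso_image[OF j(1,2)]] .
  ultimately have "iso (L k) (L l)" by (rule iso_trans)
  then show ?thesis using assms(2,4,5) unfolding complete_simples_def by blast
qed

section \<open>Duality\<close>

lemma anti_involution_add: "anti_involution sA star \<Longrightarrow> star (a + b) = star a + star b"
  unfolding anti_involution_def by (auto simp: module_hom_iff_linear[symmetric] dest: module_hom.add)

lemma anti_involution_mult: "anti_involution sA star \<Longrightarrow> star (a * b) = star b * star a"
  and anti_involution_star: "anti_involution sA star \<Longrightarrow> star (star a) = a"
  unfolding anti_involution_def by auto

lemma anti_involution_one: "anti_involution sA star \<Longrightarrow> star 1 = 1"
  by (metis anti_involution_mult anti_involution_star mult.right_neutral)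

lemma anti_involution_scalar: "anti_involution sA star \<Longrightarrow> star (sA c 1) = sA c 1"
  using anti_involution_one[of sA star] unfolding anti_involution_def
  by (metis module_hom.scale module_hom_iff_linear)

lemma dual_carrier_iff:
  "\<phi> \<in> carrier (dual star sV M) \<longleftrightarrow>
     (\<forall>v. v \<notin> carrier M \<longrightarrow> \<phi> v = 0) \<and> linear_form sV (carrier M) \<phi>"
  by (simp add: dual_def)

lemma dual_act: "act (dual star sV M) a \<phi> v = (if v \<in> carrier M then \<phi> (act M (star a) v) else 0)"
  by (simp add: dual_def)

lemma dual_outside: "\<phi> \<in> carrier (dual star sV M) \<Longrightarrow> v \<notin> carrier M \<Longrightarrow> \<phi> v = 0"
  and dual_add: "\<phi> \<in> carrier (dual star sV M) \<Longrightarrow> v \<in> carrier M \<Longrightarrow> w \<in> carrier M \<Longrightarrow>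
    \<phi> (v + w) = \<phi> v + \<phi> w"
  and dual_scale: "\<phi> \<in> carrier (dual star sV M) \<Longrightarrow> v \<in> carrier M \<Longrightarrow> \<phi> (sV c v) = c * \<phi> v"
  unfolding dual_def linear_form_def by auto

text \<open>The coordinate forms of a basis span the dual. Only an inequality of dimensions is
  recorded, because the later comparison closes a cycle of such inequalities.\<close>

lemma (in fd_mod) dual_span:
  assumes "finite B" "independent B" "span B = carrier M"
  obtains C where "finite C" "card C \<le> card B"
    "carrier (dual star sV M) \<subseteq> module.span (fscale (*)) C"
proof -
  interpret K: vector_space "(*) :: 'k \<Rightarrow> 'k \<Rightarrow> 'k" by (rule vector_space_mult)
  let ?C = "(\<lambda>(b, c). elementary sV (*) B b c) ` (B \<times> {1 :: 'k})"
  have "x \<in> K.span {1}" for x :: 'k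
    using K.span_scale[OF K.span_base[of 1 "{1}"], of x] by simp
  then have "\<phi> \<in> module.span (fscale (*)) ?C" if "\<phi> \<in> carrier (dual star sV M)" for \<phi>
    using that assms
    by (intro linear_maps_subset_span_elementary[OF vector_space_axioms vector_space_mult])
      (auto simp: dual_carrier_iff linear_form_iff)
  moreover have "finite ?C" using assms(1) by simp
  moreover have "card ?C \<le> card B"
    using card_image_le[of "B \<times> {1 :: 'k}" "\<lambda>(b, c). elementary sV (*) B b c"] assms(1) by simp
  ultimately show ?thesis using that[of ?C] by blast
qed

text \<open>Scalars are central in the algebra, so each element acts linearly over the
  field.\<close>

lemma (in fd_mod) act_scale:
  assumes "fd_algebra sA UNIV (*) 1" "v \<in> carrier M"
  shows "act M a (sV c v) = sV c (act M a v)"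
proof -
  have "a * sA c 1 = sA c 1 * a" using assms(1) unfolding fd_algebra_def by simp
  then have "act M a (act M (sA c 1) v) = act M (sA c 1) (act M a v)"
    using mult_act[OF assms(2)] by metis
  then show ?thesis using assms(2) act_closed by (simp add: scalar_act)
qed

text \<open>Linear forms naturally carry a right action; \<open>star\<close> reverses products and
  so turns it into a left action.\<close>

lemma (in fd_mod) dual_fd_mod:
  assumes "fd_algebra sA UNIV (*) 1" "anti_involution sA star"
  shows "fd_mod (fscale (*)) sA (dual star sV M)"
proof -
  let ?D = "dual star sV M"
  interpret D: vector_space "fscale (*) :: 'k \<Rightarrow> ('v \<Rightarrow> 'k) \<Rightarrow> _"
    by (rule vector_space_fscale[OF vector_space_mult])
  have sub: "D.subspace (carrier ?D)"
    by (rule D.subspaceI) (auto simp: dual_carrier_iff linear_form_def fscale_def algebra_simps)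
  obtain B where B: "finite B" "independent B" "span B = carrier M" "B \<subseteq> carrier M" by (rule basis)
  obtain C where "finite C" "card C \<le> card B" "carrier ?D \<subseteq> D.span C"
    by (rule dual_span[OF B(1-3)])
  then have "Defs.fin_dim (fscale (*)) (carrier ?D)"
    using fin_dim_subspace[OF D.vector_space_axioms sub] by blast
  moreover have "act ?D a \<phi> \<in> carrier ?D" if "\<phi> \<in> carrier ?D" for a \<phi>
    using that subspace_add[OF subspace_carrier] subspace_scale[OF subspace_carrier]
    by (simp add: dual_carrier_iff linear_form_def dual_act act_closed act_add act_scale[OF assms(1)])
  moreover have "act ?D a (\<phi> + \<psi>) = act ?D a \<phi> + act ?D a \<psi>" for a \<phi> \<psi>
    by (simp add: fun_eq_iff dual_act)
  moreover have "act ?D (a + b) \<phi> = act ?D a \<phi> + act ?D b \<phi>" if "\<phi> \<in> carrier ?D" for a b \<phi>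
    using that
    by (auto simp: fun_eq_iff dual_act anti_involution_add[OF assms(2)] add_act act_closed
        dual_add[OF that])
  moreover have "act ?D (a * b) \<phi> = act ?D a (act ?D b \<phi>)" for a b \<phi>
    by (simp add: fun_eq_iff dual_act anti_involution_mult[OF assms(2)] mult_act act_closed)
  moreover have "act ?D 1 \<phi> = \<phi>" if "\<phi> \<in> carrier ?D" for \<phi>
    using dual_outside[OF that]
    by (auto simp: fun_eq_iff dual_act anti_involution_one[OF assms(2)] one_act)
  moreover have "act ?D (sA c 1) \<phi> = fscale (*) c \<phi>" if "\<phi> \<in> carrier ?D" for c \<phi>
    using dual_outside[OF that] dual_scale[OF that]
    by (auto simp: fun_eq_iff dual_act anti_involution_scalar[OF assms(2)] scalar_act fscale_def)
  ultimately have "fd_module sA (fscale (*)) ?D" unfolding fd_module_def by blast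
  then show ?thesis
    using D.vector_space_axioms by (simp add: fd_mod_def fd_mod_axioms_def)
qed

text \<open>A map from \<open>X\<close> to the dual of \<open>P\<close> is a pairing between the two
  modules; this swaps its arguments.\<close>

definition hom_transpose ::
  "('a, 'v::ab_group_add) amod \<Rightarrow> ('x \<Rightarrow> 'v \<Rightarrow> 'k::field) \<Rightarrow> 'v \<Rightarrow> 'x \<Rightarrow> 'k" where
  "hom_transpose P f = (\<lambda>v. if v \<in> carrier P then (\<lambda>x. f x v) else 0)"

text \<open>Compatibility with the action says that \<open>a\<close> on one side of the pairing
  moves to \<open>star a\<close> on the other. Since \<open>star\<close> is its own inverse, this
  condition is symmetric in the two arguments.\<close>

lemma hom_transpose_Hom:
  assumes "fd_algebra sA UNIV (*) 1" "anti_involution sA star"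
    and "fd_mod sX sA X" "fd_mod sV sA P" "f \<in> Hom X (dual star sV P)"
  shows "hom_transpose P f \<in> Hom P (dual star sX X)"
proof (rule HomI)
  interpret P: fd_mod sV sA P by fact
  interpret X: fd_mod sX sA X by fact
  have D: "fd_mod (fscale (*)) sA (dual star sV P)" using P.dual_fd_mod[OF assms(1,2)] .
  have f: "f x \<in> carrier (dual star sV P)" if "x \<in> carrier X" for x
    using Hom_closed[OF assms(5) that] .
  have f_scale: "f (sX c x) = fscale (*) c (f x)" if "x \<in> carrier X" for c x
    by (rule Hom_scale[OF assms(3) D assms(5) that])
  show "hom_transpose P f v = 0" if "v \<notin> carrier P" for v using that by (simp add: hom_transpose_def)
  show "hom_transpose P f v \<in> carrier (dual star sX X)" if "v \<in> carrier P" for v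
    using that Hom_outside[OF assms(5)]
    by (simp add: hom_transpose_def dual_carrier_iff linear_form_def Hom_add[OF assms(5)] f_scale fscale_def)
  show "hom_transpose P f (v + w) = hom_transpose P f v + hom_transpose P f w"
    if vw: "v \<in> carrier P" "w \<in> carrier P" for v w
  proof
    fix x
    show "hom_transpose P f (v + w) x = (hom_transpose P f v + hom_transpose P f w) x"
      using vw P.subspace_add[OF P.subspace_carrier vw] Hom_outside[OF assms(5), of x] dual_add[OF f vw]
      by (cases "x \<in> carrier X") (simp_all add: hom_transpose_def)
  qed
  show "hom_transpose P f (act P a v) = act (dual star sX X) a (hom_transpose P f v)" if v: "v \<in> carrier P" for a v
  proof
    fix x
    have "f (act X (star a) x) v = f x (act P a v)" if "x \<in> carrier X"
      using that v by (simp add: Hom_act[OF assms(5)] dual_act anti_involution_star[OF assms(2)])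
    then show "hom_transpose P f (act P a v) x = act (dual star sX X) a (hom_transpose P f v) x"
      using v P.act_closed Hom_outside[OF assms(5), of x]
      by (simp add: hom_transpose_def dual_act)
  qed
qed

definition dual_map ::
  "('a \<Rightarrow> 'a) \<Rightarrow> ('k::field \<Rightarrow> 'v::ab_group_add \<Rightarrow> 'v) \<Rightarrow> ('a, 'v) amod \<Rightarrow> ('x \<Rightarrow> 'v)
    \<Rightarrow> ('v \<Rightarrow> 'k) \<Rightarrow> 'x \<Rightarrow> 'k" where
  "dual_map star sV N g = (\<lambda>\<phi>. if \<phi> \<in> carrier (dual star sV N) then \<phi> \<circ> g else 0)"

lemma dual_map_Hom:
  assumes "fd_algebra sA UNIV (*) 1" "anti_involution sA star"
    and "fd_mod sX sA X" "fd_mod sV sA N" "g \<in> Hom X N"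
  shows "dual_map star sV N g \<in> Hom (dual star sV N) (dual star sX X)"
proof (rule HomI)
  interpret N: fd_mod sV sA N by fact
  interpret X: fd_mod sX sA X by fact
  interpret D: fd_mod "fscale (*)" sA "dual star sV N" using N.dual_fd_mod[OF assms(1,2)] .
  show "dual_map star sV N g \<phi> = 0" if "\<phi> \<notin> carrier (dual star sV N)" for \<phi>
    using that by (simp add: dual_map_def)
  show "dual_map star sV N g \<phi> \<in> carrier (dual star sX X)" if \<phi>: "\<phi> \<in> carrier (dual star sV N)" for \<phi>
  proof -
    have "\<phi> 0 = 0" using dual_scale[OF \<phi> N.zero_closed, of 0] by simp
    then show ?thesis using \<phi>
      by (simp add: dual_map_def dual_carrier_iff[of _ _ sX] linear_form_def Hom_outside[OF assms(5)]
          Hom_add[OF assms(5)] Hom_scale[OF assms(3,4,5)] Hom_closed[OF assms(5)] dual_add[OF \<phi>]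
          dual_scale[OF \<phi>])
  qed
  show "dual_map star sV N g (\<phi> + \<psi>) = dual_map star sV N g \<phi> + dual_map star sV N g \<psi>"
    if "\<phi> \<in> carrier (dual star sV N)" "\<psi> \<in> carrier (dual star sV N)" for \<phi> \<psi>
    using that D.subspace_add[OF D.subspace_carrier that] by (simp add: dual_map_def fun_eq_iff)
  show "dual_map star sV N g (act (dual star sV N) a \<phi>) = act (dual star sX X) a (dual_map star sV N g \<phi>)"
    if \<phi>: "\<phi> \<in> carrier (dual star sV N)" for a \<phi>
  proof
    fix x
    show "dual_map star sV N g (act (dual star sV N) a \<phi>) x
        = act (dual star sX X) a (dual_map star sV N g \<phi>) x"
      using \<phi> D.act_closed[OF \<phi>, of a] N.zero_closed Hom_closed[OF assms(5), of x]
        Hom_outside[OF assms(5), of x] Hom_act[OF assms(5), of x] N.act_0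
        dual_scale[OF \<phi> N.zero_closed, of 0]
      by (simp add: dual_map_def dual_act)
  qed
qed

text \<open>Duality turns embeddings into surjections because vector spaces split: a form on
  \<open>X\<close> is transported to the image of \<open>g\<close>, extended to the ambient space,
  and cut off again outside \<open>N\<close>.\<close>

lemma dual_map_surj:
  assumes "fd_mod sX sA X" "fd_mod sV sA N" "g \<in> Hom X N" "inj_on g (carrier X)"
    and "\<psi> \<in> carrier (dual star sX X)"
  obtains \<phi> where "\<phi> \<in> carrier (dual star sV N)" "dual_map star sV N g \<phi> = \<psi>"
proof -
  interpret N: fd_mod sV sA N by fact
  interpret X: fd_mod sX sA X by fact
  let ?r = "inv_into (carrier X) g"
  have r: "?r (g x) = x" if "x \<in> carrier X" for x using that assms(4) by simp
  have "linear_form sV (g ` carrier X) (\<psi> \<circ> ?r)"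
  proof -
    have "\<psi> (?r (g x + g y)) = \<psi> x + \<psi> y" if "x \<in> carrier X" "y \<in> carrier X" for x y
      using r[of "x + y"] that X.subspace_add[OF X.subspace_carrier that]
      by (simp add: Hom_add[OF assms(3)] dual_add[OF assms(5)])
    moreover have "\<psi> (?r (sV c (g x))) = c * \<psi> x" if "x \<in> carrier X" for x c
      using r[of "sX c x"] that X.subspace_scale[OF X.subspace_carrier that]
      by (simp add: Hom_scale[OF assms(1,2,3)] dual_scale[OF assms(5)])
    ultimately show ?thesis by (auto simp: linear_form_def r)
  qed
  moreover have "N.subspace (g ` carrier X)"
    using N.submodule_subspace[OF Hom_image_submodule[OF assms(3) X.submodule_carrier]] .
  ultimately obtain \<chi> where \<chi>: "linear_form sV UNIV \<chi>" "\<And>w. w \<in> g ` carrier X \<Longrightarrow> \<chi> w = (\<psi> \<circ> ?r) w"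
    using linear_form_extend[OF N.vector_space_axioms] by blast
  define \<phi> where "\<phi> w = (if w \<in> carrier N then \<chi> w else 0)" for w
  have \<phi>: "\<phi> \<in> carrier (dual star sV N)"
    using \<chi>(1) N.subspace_add[OF N.subspace_carrier] N.subspace_scale[OF N.subspace_carrier]
    by (simp add: dual_carrier_iff linear_form_def \<phi>_def)
  have "dual_map star sV N g \<phi> x = \<psi> x" for x
  proof (cases "x \<in> carrier X")
    case True
    then show ?thesis using \<phi> \<chi>(2)[of "g x"] r Hom_closed[OF assms(3) True]
      by (simp add: dual_map_def \<phi>_def)
  next
    case False
    have "\<phi> 0 = 0" using dual_scale[OF \<phi> N.zero_closed, of 0] by simp
    then show ?thesis using \<phi> False Hom_outside[OF assms(3) False] dual_outside[OF assms(5) False]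
      by (simp add: dual_map_def)
  qed
  then show ?thesis using that[OF \<phi>] by blast
qed

text \<open>Transposing turns an extension problem along an embedding of \<open>X\<close> into
  \<open>Y\<close> into a lifting problem for \<open>P\<close> along the surjection between the
  duals. The lift, transposed back, is the extension.\<close>

lemma dual_projective_injective:
  fixes sV :: "'k::field \<Rightarrow> 'v::ab_group_add \<Rightarrow> 'v"
  assumes "fd_algebra sA UNIV (*) 1" "anti_involution sA star" "fd_mod sV sA P" "projective sA P"
  shows "injective sA (dual star sV P)"
  unfolding injective_def
proof (intro ballI impI)
  fix X Y g f
  assume XY: "X \<in> A_mod sA" "Y \<in> A_mod sA" and g: "g \<in> Hom X Y" "inj_on g (carrier X)"
    and f: "f \<in> Hom X (dual star sV P)"
  let ?s = "fscale (*) :: 'k \<Rightarrow> (nat \<Rightarrow> 'k) \<Rightarrow> _"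
  interpret P: fd_mod sV sA P by fact
  interpret X: fd_mod ?s sA X using A_mod_fd_mod[OF XY(1)] .
  interpret Y: fd_mod ?s sA Y using A_mod_fd_mod[OF XY(2)] .
  have ft: "hom_transpose P f \<in> Hom P (dual star ?s X)"
    by (rule hom_transpose_Hom[OF assms(1,2) X.fd_mod_axioms P.fd_mod_axioms f])
  have gd: "dual_map star ?s Y g \<in> Hom (dual star ?s Y) (dual star ?s X)"
    by (rule dual_map_Hom[OF assms(1,2) X.fd_mod_axioms Y.fd_mod_axioms g(1)])
  have "dual_map star ?s Y g ` carrier (dual star ?s Y) = carrier (dual star ?s X)"
  proof
    show "dual_map star ?s Y g ` carrier (dual star ?s Y) \<subseteq> carrier (dual star ?s X)"
      using Hom_closed[OF gd] by blast
    show "carrier (dual star ?s X) \<subseteq> dual_map star ?s Y g ` carrier (dual star ?s Y)"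
      using dual_map_surj[OF X.fd_mod_axioms Y.fd_mod_axioms g] by blast
  qed
  then obtain h where h: "h \<in> Hom P (dual star ?s Y)" "dual_map star ?s Y g \<circ> h = hom_transpose P f"
    using projective_lift[OF assms(4) Y.dual_fd_mod[OF assms(1,2)] X.dual_fd_mod[OF assms(1,2)] gd _ ft]
    by blast
  have ht: "hom_transpose Y h \<in> Hom Y (dual star sV P)"
    by (rule hom_transpose_Hom[OF assms(1,2) P.fd_mod_axioms Y.fd_mod_axioms h(1)])
  have "hom_transpose Y h \<circ> g = f"
  proof (rule Hom_eqI[OF Hom_comp[OF g(1) ht] f])
    fix x assume x: "x \<in> carrier X"
    show "(hom_transpose Y h \<circ> g) x = f x"
    proof
      fix v
      show "(hom_transpose Y h \<circ> g) x v = f x v"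
      proof (cases "v \<in> carrier P")
        case True
        have "dual_map star ?s Y g (h v) x = hom_transpose P f v x" using fun_cong[OF h(2), of v] by simp
        then show ?thesis
          using True Hom_closed[OF h(1) True] Hom_closed[OF g(1) x]
          by (simp add: hom_transpose_def dual_map_def)
      next
        case False
        then show ?thesis
          using Hom_outside[OF h(1) False] dual_outside[OF Hom_closed[OF f x] False] Hom_closed[OF g(1) x]
          by (simp add: hom_transpose_def)
      qed
    qed
  qed
  then show "\<exists>h\<in>Hom Y (dual star sV P). h \<circ> g = f" using ht by blast
qed

lemma dual_separates:
  assumes "fd_mod sV sA M" "v \<in> carrier M" "v \<noteq> 0"
  obtains \<phi> where "\<phi> \<in> carrier (dual star sV M)" "\<phi> v \<noteq> 0"
proof -
  interpret M: fd_mod sV sA M by fact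
  have "v \<notin> {0}" using assms(3) by simp
  then obtain \<psi> where \<psi>: "linear_form sV UNIV \<psi>" "\<psi> v = 1"
    using linear_form_separate[OF M.vector_space_axioms M.subspace_single_0] by blast
  have "(\<lambda>w. if w \<in> carrier M then \<psi> w else 0) \<in> carrier (dual star sV M)"
    using \<psi>(1) M.subspace_add[OF M.subspace_carrier] M.subspace_scale[OF M.subspace_carrier]
    by (simp add: dual_carrier_iff linear_form_def)
  then show ?thesis using that[of "\<lambda>w. if w \<in> carrier M then \<psi> w else 0"] \<psi>(2) assms(2) by simp
qed

text \<open>A submodule of the dual is the annihilator of its common zero set, and that zero set is a
  submodule.\<close>

lemma dual_cover_essential:
  assumes "fd_algebra sA UNIV (*) 1" "anti_involution sA star"
    and "fd_mod sV sA L" "simple L" "iso (dual star sV L) L" "projective_cover sA sV P L"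
  obtains i where "i \<in> Hom L (dual star sV P)" "inj_on i (carrier L)"
    "essential (i ` carrier L) (dual star sV P)"
proof -
  interpret L: fd_mod sV sA L by fact
  interpret P: fd_mod sV sA P
    using assms(6) L.vector_space_axioms
    unfolding projective_cover_def fd_mod_def fd_mod_axioms_def by blast
  interpret LD: fd_mod "fscale (*)" sA "dual star sV L" using L.dual_fd_mod[OF assms(1,2)] .
  interpret PD: fd_mod "fscale (*)" sA "dual star sV P" using P.dual_fd_mod[OF assms(1,2)] .
  let ?D = "dual star sV P"
  obtain q where q: "q \<in> Hom P L" "q ` carrier P = carrier L" "maximal_submodule (ker_on P q) P"
    using projective_cover_maximal_submodule[OF assms(3,4) L.vector_space_axioms assms(6)] by blast
  let ?q = "dual_map star sV L q"
  have qd: "?q \<in> Hom (dual star sV L) ?D"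
    by (rule dual_map_Hom[OF assms(1,2) P.fd_mod_axioms L.fd_mod_axioms q(1)])
  have qinj: "inj_on ?q (carrier (dual star sV L))"
  proof (rule inj_onI)
    fix \<phi> \<psi> assume *: "\<phi> \<in> carrier (dual star sV L)" "\<psi> \<in> carrier (dual star sV L)" "?q \<phi> = ?q \<psi>"
    show "\<phi> = \<psi>"
    proof
      fix w
      show "\<phi> w = \<psi> w"
      proof (cases "w \<in> carrier L")
        case True
        then obtain v where "w = q v" using q(2) by blast
        then show ?thesis using fun_cong[OF *(3), of v] *(1,2) by (simp add: dual_map_def)
      next
        case False
        then show ?thesis using *(1,2) by (simp add: dual_outside)
      qed
    qed
  qed
  obtain e where e: "e \<in> Hom L (dual star sV L)" "bij_betw e (carrier L) (carrier (dual star sV L))"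
    using iso_sym[OF LD.fd_mod_axioms assms(5)] unfolding iso_def by blast
  have eim: "(?q \<circ> e) ` carrier L = ?q ` carrier (dual star sV L)"
    using e(2) unfolding bij_betw_def by (simp only: image_comp[symmetric])
  have "inj_on (?q \<circ> e) (carrier L)"
    using e(2) qinj unfolding bij_betw_def by (auto intro: comp_inj_on)
  moreover have "essential ((?q \<circ> e) ` carrier L) ?D"
    unfolding essential_def eim
  proof (intro allI impI, rule ccontr)
    fix U assume U: "submodule U ?D" "U \<inter> ?q ` carrier (dual star sV L) = {0}" "U \<noteq> {0}"
    interpret UM: fd_mod "fscale (*)" sA "?D\<lparr>carrier := U\<rparr>" using PD.fd_mod_submodule[OF U(1)] .
    have UD: "U \<subseteq> carrier ?D" using U(1) by (simp add: submodule_def)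
    obtain \<Phi> where \<Phi>: "finite \<Phi>" "LD.span \<Phi> = U" "\<Phi> \<subseteq> U"
      using UM.basis by auto
    define Z where "Z = {v \<in> carrier P. \<forall>\<phi>\<in>\<Phi>. \<phi> v = 0}"
    have Z: "\<phi> v = 0" if "\<phi> \<in> U" "v \<in> Z" for \<phi> v
    proof -
      have "\<phi> \<in> LD.span \<Phi>" using that(1) \<Phi>(2) by simp
      then show ?thesis
        by (induction rule: LD.span_induct_alt) (use that(2) in \<open>auto simp: Z_def fscale_def\<close>)
    qed
    have "submodule Z P"
      unfolding submodule_def
    proof (intro conjI ballI allI)
      have D: "\<phi> \<in> carrier ?D" if "\<phi> \<in> \<Phi>" for \<phi> using that \<Phi>(3) UD by blast
      show "Z \<subseteq> carrier P" by (auto simp: Z_def)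
      show "0 \<in> Z"
        using P.zero_closed dual_scale[OF D P.zero_closed, of _ 0] by (simp add: Z_def)
      show "v + w \<in> Z" if "v \<in> Z" "w \<in> Z" for v w
      proof -
        have "\<phi> (v + w) = 0" if "\<phi> \<in> \<Phi>" for \<phi>
          using dual_add[OF D[OF that], of v w] \<open>v \<in> Z\<close> \<open>w \<in> Z\<close> that by (auto simp: Z_def)
        then show ?thesis using that L.subspace_add[OF P.subspace_carrier] by (simp add: Z_def)
      qed
      show "act P a v \<in> Z" if v: "v \<in> Z" for a v
      proof -
        have "\<phi> (act P a v) = 0" if \<phi>: "\<phi> \<in> \<Phi>" for \<phi>
        proof -
          \<comment> \<open>Evaluating this form at \<open>v\<close> gives the value of
            \<open>\<phi>\<close> at \<open>act P a v\<close>, so stability of \<open>U\<close>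
            becomes stability of its zero set.\<close>
          have "act ?D (star a) \<phi> \<in> U" using U(1) \<phi> \<Phi>(3) unfolding submodule_def by blast
          then have "act ?D (star a) \<phi> v = 0" using Z v by blast
          then show ?thesis using v by (simp add: dual_act anti_involution_star[OF assms(2)] Z_def)
        qed
        then show ?thesis using v P.act_closed by (simp add: Z_def)
      qed
    qed
    moreover have "Z \<noteq> carrier P"
    proof
      assume "Z = carrier P"
      then have "\<phi> v = 0" if "\<phi> \<in> U" for \<phi> v
        using Z that UD dual_outside by (cases "v \<in> carrier P") blast+
      then have "U \<subseteq> {0}" by (auto simp: fun_eq_iff)
      moreover have "0 \<in> U" using U(1) by (simp add: submodule_def)
      ultimately show False using U(3) by (simp add: subset_singleton_iff)
    qed
    ultimately have Zker: "Z \<subseteq> ker_on P q" using q(3) unfolding maximal_submodule_def by blast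
    have "carrier L \<noteq> {0}" using assms(4) unfolding simple_def by blast
    then obtain x where x: "x \<in> carrier L" "x \<noteq> 0" using L.zero_closed by blast
    obtain \<psi> where \<psi>: "\<psi> \<in> carrier (dual star sV L)" "\<psi> x \<noteq> 0"
      by (rule dual_separates[OF L.fd_mod_axioms x])
    have q\<psi>: "?q \<psi> \<in> carrier ?D" using Hom_closed[OF qd \<psi>(1)] .
    \<comment> \<open>A form pulled back along \<open>q\<close> vanishes on the kernel of
      \<open>q\<close>, hence on \<open>Z\<close>, and is therefore a combination of the generators
      of \<open>U\<close>. Taking \<open>\<psi>\<close> nonzero contradicts the trivial
      intersection.\<close>
    have "\<exists>c. \<forall>w\<in>carrier P. ?q \<psi> w = (\<Sum>\<phi>\<in>\<Phi>. c \<phi> * \<phi> w)"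
    proof (rule linear_form_combination[OF L.vector_space_axioms \<Phi>(1) P.subspace_carrier])
      show "linear_form sV (carrier P) \<phi>" if "\<phi> \<in> \<Phi>" for \<phi>
        using that \<Phi>(3) UD dual_carrier_iff by blast
      show "linear_form sV (carrier P) (?q \<psi>)" using q\<psi> dual_carrier_iff by blast
      show "?q \<psi> w = 0" if "w \<in> carrier P" "\<And>\<phi>. \<phi> \<in> \<Phi> \<Longrightarrow> \<phi> w = 0" for w
      proof -
        have "q w = 0" using that Zker by (auto simp: Z_def)
        then show ?thesis using \<psi>(1) dual_scale[OF \<psi>(1) L.zero_closed, of 0] by (simp add: dual_map_def)
      qed
    qed
    then obtain c where c: "\<forall>w\<in>carrier P. ?q \<psi> w = (\<Sum>\<phi>\<in>\<Phi>. c \<phi> * \<phi> w)" by blast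
    have "?q \<psi> = (\<Sum>\<phi>\<in>\<Phi>. fscale (*) (c \<phi>) \<phi>)"
    proof
      fix w
      show "?q \<psi> w = (\<Sum>\<phi>\<in>\<Phi>. fscale (*) (c \<phi>) \<phi>) w"
      proof (cases "w \<in> carrier P")
        case True then show ?thesis using c by (simp add: sum_fun_apply fscale_def)
      next
        case False
        have "\<phi> w = 0" if "\<phi> \<in> \<Phi>" for \<phi> using that \<Phi>(3) UD False dual_outside by blast
        then have "(\<Sum>\<phi>\<in>\<Phi>. c \<phi> * \<phi> w) = 0" by (intro sum.neutral) auto
        then show ?thesis using False dual_outside[OF q\<psi>] by (simp add: sum_fun_apply fscale_def)
      qed
    qed
    also have "\<dots> \<in> LD.span \<Phi>"
      by (intro LD.span_sum LD.span_scale LD.span_base)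
    finally have "?q \<psi> \<in> U \<inter> ?q ` carrier (dual star sV L)" using \<Phi>(2) \<psi>(1) by blast
    then have "?q \<psi> = 0" using U(2) by blast
    moreover obtain v where "x = q v" using x(1) q(2) by blast
    ultimately show False using \<psi> by (simp add: dual_map_def fun_eq_iff)
  qed
  ultimately show ?thesis using that[OF Hom_comp[OF e(1) qd]] by blast
qed

lemma card_basis_le_of_surj:
  assumes "vector_space s" "vector_space t" "finite S" "linear_on s (module.span s S) t f"
    and "\<not> module.dependent t B" "B \<subseteq> f ` module.span s S"
  shows "card B \<le> card S"
proof -
  interpret T: vector_space t by fact
  have "B \<subseteq> T.span (f ` S)" using assms(6) linear_on_image_span[OF assms(1,2,4)] by simp
  then have "card B \<le> card (f ` S)" using T.independent_span_bound assms(3,5) by blast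
  then show ?thesis using card_image_le[OF assms(3), of f] by simp
qed

text \<open>The transpose of an isomorphism \<open>M \<cong> N\<^sup>*\<close> is injective; it is surjective because
  \<open>dim M\<^sup>* \<le> dim M = dim N\<^sup>* \<le> dim N\<close>.\<close>

lemma iso_dual_transpose:
  assumes "fd_algebra sA UNIV (*) 1" "anti_involution sA star"
    and "fd_mod sV sA M" "fd_mod sW sA N" "iso M (dual star sW N)"
  shows "iso N (dual star sV M)"
proof -
  interpret M: fd_mod sV sA M by fact
  interpret N: fd_mod sW sA N by fact
  interpret MD: fd_mod "fscale (*)" sA "dual star sV M" using M.dual_fd_mod[OF assms(1,2)] .
  interpret ND: fd_mod "fscale (*)" sA "dual star sW N" using N.dual_fd_mod[OF assms(1,2)] .
  obtain F where F: "F \<in> Hom M (dual star sW N)" "bij_betw F (carrier M) (carrier (dual star sW N))"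
    using assms(5) unfolding iso_def by blast
  obtain G where G: "G \<in> Hom (dual star sW N) M" "bij_betw G (carrier (dual star sW N)) (carrier M)"
    "\<forall>v\<in>carrier M. G (F v) = v" "\<forall>w\<in>carrier (dual star sW N). F (G w) = w"
    by (rule Hom_inverse[OF assms(3) F])
  let ?F = "hom_transpose N F"
  have Ft: "?F \<in> Hom N (dual star sV M)"
    by (rule hom_transpose_Hom[OF assms(1,2,3,4) F(1)])
  have "ker_on N ?F = {0}"
  proof -
    have "w = 0" if w: "w \<in> carrier N" "?F w = 0" for w
    proof (rule ccontr)
      assume "w \<noteq> 0"
      then obtain \<phi> where \<phi>: "\<phi> \<in> carrier (dual star sW N)" "\<phi> w \<noteq> 0"
        using dual_separates[OF N.fd_mod_axioms w(1)] by blast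
      have "F (G \<phi>) w = 0" using fun_cong[OF w(2), of "G \<phi>"] w(1) by (simp add: hom_transpose_def)
      then show False using \<phi> G(4) by simp
    qed
    then show ?thesis using N.zero_closed Hom_0[OF Ft] by auto
  qed
  then have inj: "inj_on ?F (carrier N)" using Hom_inj_on_iff[OF N.fd_mod_axioms Ft] by simp
  have "?F ` carrier N = carrier (dual star sV M)"
  proof (rule ccontr)
    assume "?F ` carrier N \<noteq> carrier (dual star sV M)"
    then have psub: "?F ` carrier N \<subset> carrier (dual star sV M)" using Hom_closed[OF Ft] by blast
    obtain BM where BM: "finite BM" "M.independent BM" "M.span BM = carrier M" "BM \<subseteq> carrier M"
      by (rule M.basis)
    obtain BN where BN: "finite BN" "N.independent BN" "N.span BN = carrier N" "BN \<subseteq> carrier N"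
      by (rule N.basis)
    obtain CM where CM: "finite CM" "card CM \<le> card BM" "carrier (dual star sV M) \<subseteq> MD.span CM"
      by (rule M.dual_span[OF BM(1-3)])
    obtain DM where DM: "finite DM" "MD.independent DM" "MD.span DM = carrier (dual star sV M)"
      "DM \<subseteq> carrier (dual star sV M)" "card DM \<le> card CM"
      by (rule subspace_finite_basis[OF MD.vector_space_axioms MD.subspace_carrier CM(1,3)])
    obtain CN where CN: "finite CN" "card CN \<le> card BN" "carrier (dual star sW N) \<subseteq> ND.span CN"
      by (rule N.dual_span[OF BN(1-3)])
    obtain DN where DN: "finite DN" "ND.independent DN" "ND.span DN = carrier (dual star sW N)"
      "DN \<subseteq> carrier (dual star sW N)" "card DN \<le> card CN"
      by (rule subspace_finite_basis[OF ND.vector_space_axioms ND.subspace_carrier CN(1,3)])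
    let ?R = "dual star sV M\<lparr>carrier := ?F ` carrier N\<rparr>"
    interpret R: fd_mod "fscale (*)" sA ?R
      by (rule MD.fd_mod_submodule[OF Hom_image_submodule[OF Ft N.submodule_carrier]])
    obtain S where S: "finite S" "MD.independent S" "MD.span S = carrier ?R" "S \<subseteq> carrier ?R"
      by (rule R.basis)
    have "?F \<in> Hom N ?R" using Hom_restrict_codomain[OF Ft] by blast
    moreover have "bij_betw ?F (carrier N) (carrier ?R)" using inj by (simp add: bij_betw_def)
    ultimately obtain H where H: "H \<in> Hom ?R N" "bij_betw H (carrier ?R) (carrier N)"
      "\<forall>v\<in>carrier N. H (?F v) = v" "\<forall>w\<in>carrier ?R. ?F (H w) = w"
      by (rule Hom_inverse[OF N.fd_mod_axioms])
    \<comment> \<open>The equalities of dimension enter through surjections: \<open>H\<close> maps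
      the image of the transpose onto \<open>N\<close>, and \<open>G\<close> maps the dual of
      \<open>N\<close> onto \<open>M\<close>. A missing element in the dual of \<open>M\<close>
      makes one link of the cycle strict.\<close>
    have "card BN \<le> card S"
      using card_basis_le_of_surj[OF MD.vector_space_axioms N.vector_space_axioms S(1) _ BN(2), of H]
        Hom_linear_on[OF R.fd_mod_axioms N.fd_mod_axioms H(1)] S(3) H(2) BN(4)
      unfolding bij_betw_def by simp
    also have "card S < card DM"
      using card_basis_less[OF MD.vector_space_axioms DM(1) S(2)] S(3) DM(3) psub by simp
    also have "card DM \<le> card BM" using DM(5) CM(2) by simp
    also have "card BM \<le> card DN"
      using card_basis_le_of_surj[OF ND.vector_space_axioms M.vector_space_axioms DN(1) _ BM(2), of G]
        Hom_linear_on[OF ND.fd_mod_axioms M.fd_mod_axioms G(1)] DN(3) G(2) BM(4)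
      unfolding bij_betw_def by simp
    also have "card DN \<le> card BN" using DN(5) CN(2) by simp
    finally show False by simp
  qed
  then show ?thesis using Ft inj unfolding iso_def bij_betw_def by blast
qed

section \<open>Endomorphism algebras and blocks\<close>

lemma Hom_subspace:
  assumes "fd_algebra sA UNIV (*) 1" "fd_mod sV sA M" "fd_mod sW sA N"
  shows "module.subspace (fscale sW) (Hom M N)"
proof -
  interpret N: fd_mod sW sA N by fact
  interpret F: vector_space "fscale sW" using vector_space_fscale[OF N.vector_space_axioms] .
  show ?thesis
  proof (rule F.subspaceI)
    show "0 \<in> Hom M N"
      by (rule HomI) (simp_all add: N.zero_closed N.act_0)
    show "f + g \<in> Hom M N" if "f \<in> Hom M N" "g \<in> Hom M N" for f g
    proof (rule HomI)
      show "(f + g) v \<in> carrier N" if "v \<in> carrier M" for v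
        using N.subspace_add[OF N.subspace_carrier] Hom_closed \<open>f \<in> Hom M N\<close> \<open>g \<in> Hom M N\<close> that
        by (metis plus_fun_apply)
    qed (simp_all add: that Hom_outside[OF that(1)] Hom_outside[OF that(2)]
        Hom_add[OF that(1)] Hom_add[OF that(2)] Hom_act[OF that(1)] Hom_act[OF that(2)]
        Hom_closed[OF that(1)] Hom_closed[OF that(2)] N.act_add)
    show "fscale sW c f \<in> Hom M N" if "f \<in> Hom M N" for c f
      by (rule HomI)
        (simp_all add: fscale_def Hom_outside[OF that] Hom_add[OF that] Hom_act[OF that]
          Hom_closed[OF that] N.scale_right_distrib N.act_scale[OF assms(1)]
          N.subspace_scale[OF N.subspace_carrier])
  qed
qed

lemma fd_algebra_End:
  fixes sV :: "'k::field \<Rightarrow> 'v::ab_group_add \<Rightarrow> 'v"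
  assumes "fd_algebra sA UNIV (*) 1" "fd_mod sV sA M"
  shows "fd_algebra (fscale sV) (Hom M M) (\<circ>) (hom_incl (carrier M))"
proof -
  interpret M: fd_mod sV sA M by fact
  interpret F: vector_space "fscale sV :: 'k \<Rightarrow> ('v \<Rightarrow> 'v) \<Rightarrow> _" using vector_space_fscale[OF M.vector_space_axioms] .
  obtain B where B: "finite B" "M.independent B" "M.span B = carrier M" "B \<subseteq> carrier M"
    by (rule M.basis)
  let ?E = "(\<lambda>(b, c). elementary sV sV B b c) ` (B \<times> B)"
  have "f \<in> F.span ?E" if f: "f \<in> Hom M M" for f
    using B Hom_closed[OF f] Hom_outside[OF f] Hom_linear_on[OF assms(2,2) f]
    by (intro linear_maps_subset_span_elementary[OF M.vector_space_axioms M.vector_space_axioms]) auto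
  then have "fin_dim (fscale sV) (Hom M M)"
    using fin_dim_subspace[OF F.vector_space_axioms Hom_subspace[OF assms assms(2)], of ?E] B(1) by blast
  moreover have "hom_incl (carrier M) \<in> Hom M M" using hom_incl_Hom[OF M.submodule_carrier] by simp
  \<comment> \<open>Additivity of the left factor is available on the carrier only; elsewhere
    \<open>g\<close> and \<open>h\<close> vanish and \<open>f 0 = 0\<close> takes over. The other
    distributive law is pointwise.\<close>
  moreover have "f \<circ> (g + h) = (f \<circ> g) + (f \<circ> h)" if "f \<in> Hom M M" "g \<in> Hom M M" "h \<in> Hom M M" for f g h
  proof
    fix v
    show "(f \<circ> (g + h)) v = ((f \<circ> g) + (f \<circ> h)) v"
      using Hom_add[OF that(1)] Hom_closed[OF that(2)] Hom_closed[OF that(3)] Hom_0[OF that(1)]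
        Hom_outside[OF that(2)] Hom_outside[OF that(3)]
      by (cases "v \<in> carrier M") simp_all
  qed
  moreover have "f \<circ> fscale sV c g = fscale sV c (f \<circ> g)" if "f \<in> Hom M M" "g \<in> Hom M M" for c f g
  proof
    fix v
    show "(f \<circ> fscale sV c g) v = fscale sV c (f \<circ> g) v"
      using Hom_scale[OF assms(2,2) that(1)] Hom_closed[OF that(2)] Hom_0[OF that(1)] Hom_outside[OF that(2)]
      by (cases "v \<in> carrier M") (simp_all add: fscale_def)
  qed
  moreover have "(f + g) \<circ> h = (f \<circ> h) + (g \<circ> h)" "fscale sV c f \<circ> g = fscale sV c (f \<circ> g)" for c and f g h :: "'v \<Rightarrow> 'v"
    by (simp_all add: fun_eq_iff fscale_def)
  ultimately show ?thesis
    unfolding fd_algebra_def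
    using F.vector_space_axioms Hom_comp[of _ M M _ M] Hom_comp_incl[of _ M M] incl_comp_Hom[of _ M M]
    by (simp add: o_assoc)
qed

section \<open>Matrix calculus in the endomorphism algebra of a finite direct sum\<close>

locale fd_mod_family =
  fixes sA :: "'k::field \<Rightarrow> 'a::ring_1 \<Rightarrow> 'a" and sV :: "'k \<Rightarrow> 'v::ab_group_add \<Rightarrow> 'v"
    and S :: "'l set" and P :: "'l \<Rightarrow> ('a, 'v) amod"
  assumes algebra: "fd_algebra sA UNIV (*) 1"
    and vector_space: "vector_space sV"
    and finite_index: "finite S"
    and fd_mod_P: "i \<in> S \<Longrightarrow> fd_mod sV sA (P i)"
begin

sublocale V: vector_space sV by (rule vector_space)
sublocale F: vector_space "fscale sV :: 'k \<Rightarrow> ('l \<Rightarrow> 'v) \<Rightarrow> _"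
  by (rule vector_space_fscale[OF vector_space])
sublocale FF: vector_space "fscale (fscale sV) :: 'k \<Rightarrow> (('l \<Rightarrow> 'v) \<Rightarrow> 'l \<Rightarrow> 'v) \<Rightarrow> _"
  by (rule vector_space_fscale[OF F.vector_space_axioms])

definition inc :: "'l \<Rightarrow> 'v \<Rightarrow> 'l \<Rightarrow> 'v" where
  "inc i v = (\<lambda>k. if k = i then v else 0)"

definition component :: "'l \<Rightarrow> 'l \<Rightarrow> (('l \<Rightarrow> 'v) \<Rightarrow> 'l \<Rightarrow> 'v) \<Rightarrow> 'v \<Rightarrow> 'v" where
  "component i j f = (\<lambda>v. if v \<in> carrier (P i) then f (inc i v) j else 0)"

abbreviation "DS \<equiv> direct_sum S P"

lemma DS_carrier: "x \<in> carrier DS \<longleftrightarrow> (\<forall>i\<in>S. x i \<in> carrier (P i)) \<and> (\<forall>i. i \<notin> S \<longrightarrow> x i = 0)"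
  by (simp add: direct_sum_def)

lemma DS_act: "act DS a x = (\<lambda>i. if i \<in> S then act (P i) a (x i) else 0)"
  by (simp add: direct_sum_def)

lemma P_zero: "i \<in> S \<Longrightarrow> 0 \<in> carrier (P i)"
  using fd_mod.zero_closed[OF fd_mod_P] .

lemma P_add: "i \<in> S \<Longrightarrow> v \<in> carrier (P i) \<Longrightarrow> w \<in> carrier (P i) \<Longrightarrow> v + w \<in> carrier (P i)"
  using V.subspace_add[OF fd_mod.subspace_carrier[OF fd_mod_P]] .

lemma inc_closed: "i \<in> S \<Longrightarrow> v \<in> carrier (P i) \<Longrightarrow> inc i v \<in> carrier DS"
  using P_zero by (auto simp: DS_carrier inc_def)

lemma inc_add: "inc i (v + w) = inc i v + inc i w"
  by (simp add: inc_def fun_eq_iff)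

lemma inc_act: "i \<in> S \<Longrightarrow> inc i (act (P i) a v) = act DS a (inc i v)"
  using fd_mod.act_0[OF fd_mod_P] by (auto simp: inc_def DS_act fun_eq_iff)

lemma DS_decompose:
  assumes "x \<in> carrier DS"
  shows "x = (\<Sum>i\<in>S. inc i (x i))"
proof
  fix k
  have "(\<Sum>i\<in>S. inc i (x i) k) = (\<Sum>i\<in>S. if k = i then x i else 0)" by (simp add: inc_def)
  also have "\<dots> = x k" using assms finite_index by (auto simp: DS_carrier)
  finally show "x k = (\<Sum>i\<in>S. inc i (x i)) k" by (simp add: sum_fun_apply)
qed

lemma fd_mod_DS: "fd_mod (fscale sV) sA DS"
proof -
  have "\<exists>B. finite B \<and> V.span B = carrier (P i)" if "i \<in> S" for i
    using fd_mod.fin_dim[OF fd_mod_P[OF that]] unfolding fin_dim_def .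
  then obtain B where B: "\<And>i. i \<in> S \<Longrightarrow> finite (B i) \<and> V.span (B i) = carrier (P i)" by metis
  let ?B = "\<Union>i\<in>S. inc i ` B i"
  have sub: "F.subspace (carrier DS)"
  proof (rule F.subspaceI)
    show "fscale sV c x \<in> carrier DS" if "x \<in> carrier DS" for c x
      using that V.subspace_scale[OF fd_mod.subspace_carrier[OF fd_mod_P]]
      by (simp add: DS_carrier fscale_def)
  qed (auto simp: DS_carrier P_zero P_add)
  have "x \<in> F.span ?B" if x: "x \<in> carrier DS" for x
  proof -
    have "inc i (x i) \<in> F.span ?B" if i: "i \<in> S" for i
    proof -
      have "linear_on sV (V.span (B i)) (fscale sV) (inc i)"
        by (auto simp: linear_on_def inc_def fscale_def fun_eq_iff)
      then have "inc i ` V.span (B i) = F.span (inc i ` B i)"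
        by (rule linear_on_image_span[OF vector_space F.vector_space_axioms])
      moreover have "x i \<in> V.span (B i)" using B[OF i] i x by (simp add: DS_carrier)
      moreover have "F.span (inc i ` B i) \<subseteq> F.span ?B" by (rule F.span_mono) (use i in blast)
      ultimately show ?thesis by blast
    qed
    then show ?thesis using F.span_sum[of S "\<lambda>i. inc i (x i)" ?B] DS_decompose[OF x] by simp
  qed
  then have "fin_dim (fscale sV) (carrier DS)"
    using fin_dim_subspace[OF F.vector_space_axioms sub, of ?B] B finite_index by blast
  then have "fd_module sA (fscale sV) DS"
    unfolding fd_module_def
    by (auto simp: DS_carrier DS_act fscale_def fun_eq_iff P_add fd_mod.act_closed[OF fd_mod_P]
        fd_mod.act_add[OF fd_mod_P] fd_mod.add_act[OF fd_mod_P] fd_mod.mult_act[OF fd_mod_P]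
        fd_mod.one_act[OF fd_mod_P] fd_mod.scalar_act[OF fd_mod_P])
  then show ?thesis using F.vector_space_axioms by (simp add: fd_mod_def fd_mod_axioms_def)
qed

lemma End_subspace: "FF.subspace (End_sum S P)"
  unfolding End_sum_def by (rule Hom_subspace[OF algebra fd_mod_DS fd_mod_DS])

lemma fd_algebra_End_sum: "fd_algebra (fscale (fscale sV)) (End_sum S P) (\<circ>) (End_one S P)"
proof -
  have "End_one S P = hom_incl (carrier DS)" by (simp add: End_one_def hom_incl_def)
  then show ?thesis unfolding End_sum_def using fd_algebra_End[OF algebra fd_mod_DS] by simp
qed

lemma component_Hom:
  assumes "f \<in> End_sum S P" "i \<in> S" "j \<in> S"
  shows "component i j f \<in> Hom (P i) (P j)"
proof -
  have f: "f \<in> Hom DS DS" using assms(1) by (simp add: End_sum_def)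
  note inc = inc_closed[OF assms(2)]
  have fc: "f (inc i v) j \<in> carrier (P j)" if "v \<in> carrier (P i)" for v
    using Hom_closed[OF f inc[OF that]] assms(3) by (simp add: DS_carrier)
  show ?thesis
  proof (rule HomI)
    show "component i j f (v + w) = component i j f v + component i j f w"
      if "v \<in> carrier (P i)" "w \<in> carrier (P i)" for v w
      using that P_add[OF assms(2) that] Hom_add[OF f inc[OF that(1)] inc[OF that(2)]]
      by (simp add: component_def inc_add)
    show "component i j f (act (P i) a v) = act (P j) a (component i j f v)"
      if "v \<in> carrier (P i)" for a v
      using that fd_mod.act_closed[OF fd_mod_P[OF assms(2)] that] Hom_act[OF f inc[OF that]] assms
      by (simp add: component_def inc_act DS_act)
  qed (simp_all add: component_def fc)
qed

lemma block_End:
  assumes "g \<in> Hom (P i) (P j)" "i \<in> S" "j \<in> S"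
  shows "block S P i j g \<in> End_sum S P"
proof -
  have DS: "x + y \<in> carrier DS" if "x \<in> carrier DS" "y \<in> carrier DS" for x y
    using F.subspace_add[OF fd_mod.subspace_carrier[OF fd_mod_DS] that] .
  have xi: "x i \<in> carrier (P i)" if "x \<in> carrier DS" for x using that assms(2) by (simp add: DS_carrier)
  show ?thesis unfolding End_sum_def
  proof (rule HomI)
    show "block S P i j g x = 0" if "x \<notin> carrier DS" for x using that by (simp add: block_def)
    show "block S P i j g x \<in> carrier DS" if "x \<in> carrier DS" for x
      using that Hom_closed[OF assms(1) xi[OF that]] P_zero assms(3) by (auto simp: block_def DS_carrier)
    show "block S P i j g (x + y) = block S P i j g x + block S P i j g y"
      if "x \<in> carrier DS" "y \<in> carrier DS" for x y
      using that DS Hom_add[OF assms(1) xi[OF that(1)] xi[OF that(2)]]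
      by (simp add: block_def fun_eq_iff)
    show "block S P i j g (act DS a x) = act DS a (block S P i j g x)" if "x \<in> carrier DS" for a x
      using that fd_mod.act_closed[OF fd_mod_DS that] Hom_act[OF assms(1) xi[OF that]] assms(2,3)
        fd_mod.act_0[OF fd_mod_P]
      by (auto simp: block_def fun_eq_iff DS_act)
  qed
qed

lemma End_apply:
  assumes "f \<in> End_sum S P" "x \<in> carrier DS"
  shows "f x = (\<Sum>k\<in>S. f (inc k (x k)))"
proof -
  have f: "linear_on (fscale sV) (carrier DS) (fscale sV) f"
    using Hom_linear_on[OF fd_mod_DS fd_mod_DS] assms(1) by (simp add: End_sum_def)
  have "f (\<Sum>k\<in>S. fscale sV 1 (inc k (x k))) = (\<Sum>k\<in>S. fscale sV 1 (f (inc k (x k))))"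
    by (rule linear_on_sum[OF F.vector_space_axioms F.vector_space_axioms
          fd_mod.subspace_carrier[OF fd_mod_DS] f])
      (use assms(2) DS_carrier inc_closed in blast)
  then show ?thesis using DS_decompose[OF assms(2)] by (simp add: F.scale_one)
qed

text \<open>Composing with a block on the right reads a single column of \<open>f\<close>: all
  resulting entries share the source \<open>l\<close>.\<close>

lemma End_comp_block:
  assumes "f \<in> End_sum S P" "g \<in> Hom (P l) (P i)" "l \<in> S" "i \<in> S"
  shows "f \<circ> block S P l i g = (\<Sum>k\<in>S. block S P l k (component i k f \<circ> g))"
proof (rule ext, rule ext)
  fix x m
  have f: "f \<in> Hom DS DS" using assms(1) by (simp add: End_sum_def)
  show "(f \<circ> block S P l i g) x m = (\<Sum>k\<in>S. block S P l k (component i k f \<circ> g)) x m"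
  proof (cases "x \<in> carrier DS")
    case True
    then have gx: "g (x l) \<in> carrier (P i)" using Hom_closed[OF assms(2)] assms(3) by (simp add: DS_carrier)
    have "block S P l i g x = inc i (g (x l))" using True by (simp add: block_def inc_def)
    moreover have "f (inc i (g (x l))) m = (\<Sum>k\<in>S. if m = k then f (inc i (g (x l))) k else 0)"
      using Hom_closed[OF f inc_closed[OF assms(4) gx]] finite_index by (auto simp: DS_carrier)
    moreover have "\<dots> = (\<Sum>k\<in>S. block S P l k (component i k f \<circ> g)) x m"
      using True gx by (simp add: sum_fun_apply block_def component_def cong: if_cong)
    ultimately show ?thesis by simp
  next
    case False
    then show ?thesis using Hom_0[OF f] by (simp add: sum_fun_apply block_def)
  qed
qed

text \<open>The mirror image reads a single row, with common target \<open>l\<close>. Here linearity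
  of \<open>g\<close> is what separates the contributions of the source summands, which
  \<open>f\<close> has already added up.\<close>

lemma block_comp_End:
  assumes "f \<in> End_sum S P" "g \<in> Hom (P j) (P l)" "j \<in> S" "l \<in> S"
  shows "block S P j l g \<circ> f = (\<Sum>k\<in>S. block S P k l (g \<circ> component k j f))"
proof (rule ext, rule ext)
  fix x m
  have f: "f \<in> Hom DS DS" using assms(1) by (simp add: End_sum_def)
  have g: "linear_on sV (carrier (P j)) sV g"
    using Hom_linear_on[OF fd_mod_P[OF assms(3)] fd_mod_P[OF assms(4)] assms(2)] .
  show "(block S P j l g \<circ> f) x m = (\<Sum>k\<in>S. block S P k l (g \<circ> component k j f)) x m"
  proof (cases "x \<in> carrier DS")
    case True
    then have xk: "x k \<in> carrier (P k)" if "k \<in> S" for k using that by (simp add: DS_carrier)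
    have "g (f x j) = g (\<Sum>k\<in>S. sV 1 (component k j f (x k)))"
      using End_apply[OF assms(1) True] xk by (simp add: sum_fun_apply component_def)
    also have "\<dots> = (\<Sum>k\<in>S. sV 1 (g (component k j f (x k))))"
      by (rule linear_on_sum[OF vector_space vector_space fd_mod.subspace_carrier[OF fd_mod_P[OF assms(3)]] g])
        (use component_Hom[OF assms(1) _ assms(3)] xk in \<open>blast intro: Hom_closed\<close>)
    finally have "g (f x j) = (\<Sum>k\<in>S. g (component k j f (x k)))" by simp
    then show ?thesis
      using True Hom_closed[OF f True] by (simp add: sum_fun_apply block_def)
  next
    case False
    then show ?thesis
      using Hom_outside[OF f False] Hom_0[OF assms(2)] by (simp add: sum_fun_apply block_def)
  qed
qed

lemma component_ne_0:
  assumes "f \<in> End_sum S P" "f \<noteq> 0"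
  obtains i j where "i \<in> S" "j \<in> S" "component i j f \<noteq> 0"
proof -
  have f: "f \<in> Hom DS DS" using assms(1) by (simp add: End_sum_def)
  obtain x where x: "x \<in> carrier DS" "f x \<noteq> 0" using assms(2) Hom_ne_0[OF f] by blast
  then obtain j where j: "f x j \<noteq> 0" by (auto simp: fun_eq_iff)
  then have "j \<in> S" using Hom_closed[OF f x(1)] by (auto simp: DS_carrier)
  moreover have "(\<Sum>k\<in>S. f (inc k (x k)) j) \<noteq> 0" using j End_apply[OF assms(1) x(1)] by (simp add: sum_fun_apply)
  then obtain i where "i \<in> S" "f (inc i (x i)) j \<noteq> 0" 
    by (rule sum.not_neutral_contains_not_neutral)
  moreover from this have "component i j f (x i) \<noteq> 0" using x(1) by (simp add: component_def DS_carrier)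
  then have "component i j f \<noteq> 0" by auto
  ultimately show ?thesis using that by blast
qed

lemma linear_form_End_sum_sum:
  assumes "linear_form (fscale (fscale sV)) (End_sum S P) tr"
    and "\<And>k. k \<in> A \<Longrightarrow> F k \<in> End_sum S P"
  shows "tr (\<Sum>k\<in>A. F k) = (\<Sum>k\<in>A. tr (F k))"
proof -
  have "tr (\<Sum>k\<in>A. fscale (fscale sV) 1 (F k)) = (\<Sum>k\<in>A. 1 * tr (F k))"
    using assms unfolding linear_form_iff
    by (intro linear_on_sum[OF FF.vector_space_axioms vector_space_mult End_subspace])
  then show ?thesis by (simp add: FF.scale_one)
qed

text \<open>The module theory is isolated in \<open>right\<close> and \<open>left\<close>, which
  complete one nonzero component to a \<theta>; the rest is bookkeeping with matrix entries.\<close>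

lemma nondegenerate_trace:
  assumes inv: "involution_on S p"
    and tr: "linear_form (fscale (fscale sV)) (End_sum S P) tr"
    and tr_0: "\<And>i j h. i \<in> S \<Longrightarrow> j \<in> S \<Longrightarrow> h \<in> Hom (P i) (P j) \<Longrightarrow> j \<noteq> p i \<Longrightarrow> tr (block S P i j h) = 0"
    and tr_1: "\<And>i. i \<in> S \<Longrightarrow> tr (block S P i (p i) (\<theta> i)) = 1"
    and right: "\<And>i j f. i \<in> S \<Longrightarrow> j \<in> S \<Longrightarrow> f \<in> Hom (P i) (P j) \<Longrightarrow> f \<noteq> 0 \<Longrightarrow>
      \<exists>g\<in>Hom (P (p j)) (P i). f \<circ> g = \<theta> (p j)"
    and left: "\<And>i j f. i \<in> S \<Longrightarrow> j \<in> S \<Longrightarrow> f \<in> Hom (P i) (P j) \<Longrightarrow> f \<noteq> 0 \<Longrightarrow>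
      \<exists>g\<in>Hom (P j) (P (p i)). g \<circ> f = \<theta> i"
  shows "nondegenerate (End_sum S P) (induced_form (\<circ>) tr)"
proof -
  have p: "p i \<in> S" "p (p i) = i" if "i \<in> S" for i
    using inv that unfolding involution_on_def by auto
  have "\<exists>g\<in>End_sum S P. tr (f \<circ> g) \<noteq> 0" if f: "f \<in> End_sum S P" "f \<noteq> 0" for f
  proof -
    obtain i j where ij: "i \<in> S" "j \<in> S" "component i j f \<noteq> 0" by (rule component_ne_0[OF f])
    obtain g where g: "g \<in> Hom (P (p j)) (P i)" "component i j f \<circ> g = \<theta> (p j)"
      using right[OF ij(1,2) component_Hom[OF f(1) ij(1,2)] ij(3)] by blast
    have H: "component i k f \<circ> g \<in> Hom (P (p j)) (P k)" if "k \<in> S" for k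
      using Hom_comp[OF g(1) component_Hom[OF f(1) ij(1) that]] .
    have "tr (f \<circ> block S P (p j) i g) = (\<Sum>k\<in>S. tr (block S P (p j) k (component i k f \<circ> g)))"
      unfolding End_comp_block[OF f(1) g(1) p(1)[OF ij(2)] ij(1)]
      by (rule linear_form_End_sum_sum[OF tr]) (use H p(1) ij block_End in blast)
    \<comment> \<open>With source \<open>p j\<close>, the only target seen by the trace is
      \<open>p (p j) = j\<close>, and that entry was arranged to be
      \<open>\<theta> (p j)\<close>.\<close>
    also have "\<dots> = (\<Sum>k\<in>S. if k = j then 1 else 0)"
    proof (rule sum.cong)
      fix k assume k: "k \<in> S"
      show "tr (block S P (p j) k (component i k f \<circ> g)) = (if k = j then 1 else 0)"
        using tr_0[OF p(1)[OF ij(2)] k H[OF k]] tr_1[OF p(1)[OF ij(2)]] p(2)[OF ij(2)] g(2) by auto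
    qed simp
    also have "\<dots> = 1" using finite_index ij(2) by simp
    finally show ?thesis using block_End[OF g(1) p(1)[OF ij(2)] ij(1)] by (metis one_neq_zero)
  qed
  moreover have "\<exists>g\<in>End_sum S P. tr (g \<circ> f) \<noteq> 0" if f: "f \<in> End_sum S P" "f \<noteq> 0" for f
  proof -
    obtain i j where ij: "i \<in> S" "j \<in> S" "component i j f \<noteq> 0" by (rule component_ne_0[OF f])
    obtain g where g: "g \<in> Hom (P j) (P (p i))" "g \<circ> component i j f = \<theta> i"
      using left[OF ij(1,2) component_Hom[OF f(1) ij(1,2)] ij(3)] by blast
    have H: "g \<circ> component k j f \<in> Hom (P k) (P (p i))" if "k \<in> S" for k
      using Hom_comp[OF component_Hom[OF f(1) that ij(2)] g(1)] .
    have "tr (block S P j (p i) g \<circ> f) = (\<Sum>k\<in>S. tr (block S P k (p i) (g \<circ> component k j f)))"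
      unfolding block_comp_End[OF f(1) g(1) ij(2) p(1)[OF ij(1)]]
      by (rule linear_form_End_sum_sum[OF tr]) (use H p(1) ij block_End in blast)
    \<comment> \<open>With target \<open>p i\<close>, the trace sees only the source
      \<open>i\<close>, because an involution is injective.\<close>
    also have "\<dots> = (\<Sum>k\<in>S. if k = i then 1 else 0)"
    proof (rule sum.cong)
      fix k assume k: "k \<in> S"
      have "p i \<noteq> p k" if "k \<noteq> i" using that p(2)[OF k] p(2)[OF ij(1)] by metis
      then show "tr (block S P k (p i) (g \<circ> component k j f)) = (if k = i then 1 else 0)"
        using tr_0[OF k p(1)[OF ij(1)] H[OF k]] tr_1[OF ij(1)] g(2) by auto
    qed simp
    also have "\<dots> = 1" using finite_index ij(1) by simp
    finally show ?thesis using block_End[OF g(1) ij(2) p(1)[OF ij(1)]] by (metis one_neq_zero)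
  qed
  ultimately show ?thesis unfolding nondegenerate_def induced_form_def by blast
qed

lemma component_block:
  assumes "g \<in> Hom (P k) (P l)" "i \<in> S" "j \<in> S"
  shows "component i j (block S P k l g) = (if i = k \<and> j = l then g else 0)"
proof
  fix v
  show "component i j (block S P k l g) v = (if i = k \<and> j = l then g else 0) v"
    using inc_closed[OF assms(2), of v] Hom_outside[OF assms(1), of v] Hom_0[OF assms(1)]
    by (auto simp: component_def block_def) (simp_all add: inc_def)
qed

text \<open>The projection of a homogeneous basis onto one block is either the identity or zero on each
  basis element, so the form vanishes on a block containing no \<open>\<theta>\<^sub>i\<close>.\<close>

lemma canonical_form_block_0:
  assumes ab: "appropriate_basis sV S P p \<theta> \<Upsilon>" and cf: "canonical_form sV S P p \<theta> \<Upsilon> tr"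
    and \<theta>: "socle_maps sV S P p \<theta>" and p: "\<And>i. i \<in> S \<Longrightarrow> p i \<in> S"
    and ij: "i \<in> S" "j \<in> S" "h \<in> Hom (P i) (P j)" "j \<noteq> p i"
  shows "tr (block S P i j h) = 0"
proof -
  have tr: "linear_form (fscale (fscale sV)) (End_sum S P) tr"
    and tr_0: "\<And>f. f \<in> \<Upsilon> - theta_blocks S P p \<theta> \<Longrightarrow> tr f = 0"
    using cf unfolding canonical_form_def by auto
  have span: "FF.span \<Upsilon> = End_sum S P"
    and hom: "\<Upsilon> \<subseteq> (\<Union>i\<in>S. \<Union>j\<in>S. block S P i j ` Hom (P i) (P j))"
    using ab unfolding appropriate_basis_def by auto
  define \<pi> where "\<pi> x = block S P i j (component i j x)" for x
  have lin: "\<pi> (fscale (fscale sV) c x + y) = fscale (fscale sV) c (\<pi> x) + \<pi> y" for c x y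
    by (auto simp: \<pi>_def block_def component_def fscale_def fun_eq_iff)
  have \<pi>_End: "\<pi> x \<in> End_sum S P" if "x \<in> End_sum S P" for x
    unfolding \<pi>_def by (rule block_End[OF component_Hom[OF that ij(1,2)] ij(1,2)])
  have block_0: "block S P i j 0 = 0" by (simp add: block_def fun_eq_iff)
  have tr0: "tr 0 = 0"
    using tr linear_on_0 FF.subspace_0[OF End_subspace] unfolding linear_form_iff by metis
  have \<pi>_\<Upsilon>: "tr (\<pi> u) = 0" if u: "u \<in> \<Upsilon>" for u
  proof -
    obtain k l g where klg: "k \<in> S" "l \<in> S" "g \<in> Hom (P k) (P l)" "u = block S P k l g"
      using u hom by blast
    have eq: "\<pi> u = (if i = k \<and> j = l then u else 0)"
      using component_block[OF klg(3) ij(1,2)] klg(4) block_0 by (auto simp: \<pi>_def)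
    show ?thesis
    proof (cases "i = k \<and> j = l")
      case True
      \<comment> \<open>A nonzero block determines its two indices, so a \<theta> block in this
        position would force \<open>j = p i\<close>. This is where
        \<open>\<theta> m \<noteq> 0\<close> matters.\<close>
      have "u \<notin> theta_blocks S P p \<theta>"
      proof
        assume "u \<in> theta_blocks S P p \<theta>"
        then obtain m where m: "m \<in> S" "u = block S P m (p m) (\<theta> m)" unfolding theta_blocks_def by blast
        have \<theta>m: "\<theta> m \<in> Hom (P m) (P (p m))" "\<theta> m \<noteq> 0" using \<theta> m(1) unfolding socle_maps_def by auto
        have "component m (p m) u = \<theta> m" using component_block[OF \<theta>m(1) m(1) p[OF m(1)]] m(2) by simp
        moreover have "component m (p m) u = (if m = k \<and> p m = l then g else 0)"
          using component_block[OF klg(3) m(1) p[OF m(1)]] klg(4) by simp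
        ultimately have "m = k" "p m = l" using \<theta>m(2) by (auto split: if_splits)
        then show False using True ij(4) by simp
      qed
      then show ?thesis using tr_0 u eq True by simp
    next
      case False
      then show ?thesis using eq tr0 by auto
    qed
  qed
  \<comment> \<open>The induction must remember membership, as \<open>tr\<close> is linear only on
    the endomorphism algebra.\<close>
  have "x \<in> End_sum S P \<and> tr (\<pi> x) = 0" if "x \<in> FF.span \<Upsilon>" for x
  proof (rule FF.span_induct_alt[OF that])
    have "\<pi> 0 = 0" by (simp add: \<pi>_def block_def component_def fun_eq_iff)
    then show "0 \<in> End_sum S P \<and> tr (\<pi> 0) = 0" using tr0 FF.subspace_0[OF End_subspace] by simp
  next
    fix c x y assume step: "x \<in> \<Upsilon>" "y \<in> End_sum S P \<and> tr (\<pi> y) = 0"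
    then have "x \<in> End_sum S P" using span FF.span_base by blast
    then have "tr (fscale (fscale sV) c (\<pi> x) + \<pi> y) = c * tr (\<pi> x) + tr (\<pi> y)"
      using tr \<pi>_End step FF.subspace_scale[OF End_subspace] unfolding linear_form_def by simp
    then show "fscale (fscale sV) c x + y \<in> End_sum S P \<and> tr (\<pi> (fscale (fscale sV) c x + y)) = 0"
      using step \<pi>_\<Upsilon> lin \<open>x \<in> End_sum S P\<close> FF.subspace_add[OF End_subspace]
        FF.subspace_scale[OF End_subspace] by simp
  qed
  moreover have "block S P i j h \<in> FF.span \<Upsilon>" using block_End[OF ij(3,1,2)] span by simp
  moreover have "\<pi> (block S P i j h) = block S P i j h"
    using component_block[OF ij(3,1,2)] by (simp add: \<pi>_def)
  ultimately show ?thesis by metis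
qed

text \<open>The form reads the entries from \<open>i\<close> to \<open>p i\<close> only, each
  evaluated at a vector where \<open>\<theta> i\<close> does not vanish and followed by a functional
  equal to 1 on that value. It provides a Frobenius form without choosing a homogeneous
  basis.\<close>

lemma exists_trace:
  assumes \<theta>: "socle_maps sV S P p \<theta>" and p: "\<And>i. i \<in> S \<Longrightarrow> p i \<in> S"
  obtains tr where "linear_form (fscale (fscale sV)) (End_sum S P) tr"
    "\<And>i j h. i \<in> S \<Longrightarrow> j \<in> S \<Longrightarrow> h \<in> Hom (P i) (P j) \<Longrightarrow> j \<noteq> p i \<Longrightarrow> tr (block S P i j h) = 0"
    "\<And>i. i \<in> S \<Longrightarrow> tr (block S P i (p i) (\<theta> i)) = 1"
proof -
  have \<theta>H: "\<theta> i \<in> Hom (P i) (P (p i))" "\<theta> i \<noteq> 0" if "i \<in> S" for i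
    using \<theta> that unfolding socle_maps_def by auto
  have "\<exists>v. v \<in> carrier (P i) \<and> \<theta> i v \<noteq> 0" if "i \<in> S" for i
    using Hom_ne_0[OF \<theta>H(1)[OF that]] \<theta>H(2)[OF that] by blast
  then obtain v where v: "\<And>i. i \<in> S \<Longrightarrow> v i \<in> carrier (P i) \<and> \<theta> i (v i) \<noteq> 0" by metis
  have "\<exists>\<phi>. linear_form sV UNIV \<phi> \<and> \<phi> (\<theta> i (v i)) = 1" if "i \<in> S" for i
  proof -
    have "\<theta> i (v i) \<notin> {0}" using v[OF that] by simp
    then show ?thesis using linear_form_separate[OF vector_space V.subspace_single_0] by metis
  qed
  then obtain \<phi> where \<phi>: "\<And>i. i \<in> S \<Longrightarrow> linear_form sV UNIV (\<phi> i) \<and> \<phi> i (\<theta> i (v i)) = 1" by metis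
  have \<phi>0: "\<phi> i 0 = 0" if "i \<in> S" for i
    using \<phi>[OF that] linear_on_0[of sV UNIV "(*)" "\<phi> i"] by (simp add: linear_form_iff)
  define tr where "tr f = (\<Sum>i\<in>S. \<phi> i (f (inc i (v i)) (p i)))" for f
  have "linear_form (fscale (fscale sV)) (End_sum S P) tr"
    using \<phi> unfolding linear_form_def tr_def
    by (simp add: sum.distrib sum_distrib_left fscale_def)
  moreover have tr_block: "tr (block S P i j h) = (if j = p i then \<phi> i (h (v i)) else 0)"
    if "i \<in> S" "j \<in> S" "h \<in> Hom (P i) (P j)" for i j h
  proof -
    have "tr (block S P i j h) = (\<Sum>k\<in>S. if k = i then (if j = p i then \<phi> i (h (v i)) else 0) else 0)"
      unfolding tr_def
    proof (rule sum.cong)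
      fix k assume k: "k \<in> S"
      have "block S P i j h (inc k (v k)) (p k) = (if k = i \<and> j = p i then h (v i) else 0)"
        using inc_closed[OF k, of "v k"] v[OF k] Hom_0[OF that(3)]
        by (auto simp: block_def) (auto simp: inc_def)
      then show "\<phi> k (block S P i j h (inc k (v k)) (p k))
          = (if k = i then (if j = p i then \<phi> i (h (v i)) else 0) else 0)"
        using \<phi>0[OF k] by auto
    qed simp
    then show ?thesis using finite_index that(1) by simp
  qed
  ultimately show ?thesis
    using that[of tr] \<phi> \<theta>H(1) p by simp
qed

end

section \<open>Projective-injective modules\<close>

locale proj_inj_setup =
  fixes sA :: "'k::field \<Rightarrow> 'a::ring_1 \<Rightarrow> 'a" and sV :: "'k \<Rightarrow> 'v::ab_group_add \<Rightarrow> 'v"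
    and \<Lambda> :: "'l set" and L P I :: "'l \<Rightarrow> ('a, 'v) amod"
  assumes alg: "fd_algebra sA UNIV (*) 1" and vs: "vector_space sV" and fin: "finite \<Lambda>"
    and simples: "complete_simples sA sV \<Lambda> L"
    and covers: "\<forall>i\<in>\<Lambda>. projective_cover sA sV (P i) (L i)"
    and envelopes: "\<forall>i\<in>\<Lambda>. injective_envelope sA sV (I i) (L i)"
begin

abbreviation "S \<equiv> Lambda0 sA \<Lambda> P"
abbreviation "p \<equiv> prime_map \<Lambda> P I"

lemma S_iff: "i \<in> S \<longleftrightarrow> i \<in> \<Lambda> \<and> injective sA (P i)"
  by (simp add: Lambda0_def)

lemma fd_mod_L: "i \<in> \<Lambda> \<Longrightarrow> fd_mod sV sA (L i)" and simple_L: "i \<in> \<Lambda> \<Longrightarrow> simple (L i)"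
  using simples vs unfolding complete_simples_def fd_mod_def fd_mod_axioms_def by blast+

lemma fd_mod_cover: "i \<in> \<Lambda> \<Longrightarrow> fd_mod sV sA (P i)" and projective_P: "i \<in> \<Lambda> \<Longrightarrow> projective sA (P i)"
  using covers vs unfolding projective_cover_def fd_mod_def fd_mod_axioms_def by blast+

lemma fd_mod_I: "i \<in> \<Lambda> \<Longrightarrow> fd_mod sV sA (I i)" and injective_I: "i \<in> \<Lambda> \<Longrightarrow> injective sA (I i)"
  using envelopes vs unfolding injective_envelope_def fd_mod_def fd_mod_axioms_def by blast+

sublocale fd_mod_family sA sV S P
  by (rule fd_mod_family.intro) (use alg vs fin fd_mod_cover in \<open>simp_all add: Lambda0_def\<close>)

lemma top_P:
  assumes "i \<in> \<Lambda>"
  obtains q where "q \<in> Hom (P i) (L i)" "q ` carrier (P i) = carrier (L i)"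
    "maximal_submodule (ker_on (P i) q) (P i)"
proof -
  have "projective_cover sA sV (P i) (L i)" using covers assms by blast
  then show ?thesis
    by (rule projective_cover_maximal_submodule[OF fd_mod_L[OF assms] simple_L[OF assms] vs])
      (rule that)
qed

lemma prime_map_eq:
  assumes "i \<in> \<Lambda>" "k \<in> \<Lambda>" "iso (P i) (I k)"
  shows "p i = k"
  unfolding prime_map_def
proof (rule the_equality)
  show "k \<in> \<Lambda> \<and> iso (P i) (I k)" using assms(2,3) by blast
  show "j = k" if "j \<in> \<Lambda> \<and> iso (P i) (I j)" for j
    using that assms(2,3) iso_envelope_unique[OF fd_mod_cover[OF assms(1)] simples envelopes, of j k]
    by simp
qed

text \<open>As the cover of a simple module, \<open>P i\<close> has a greatest proper submodule;
  being injective as well, it is the envelope of one of the simple modules.\<close>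

lemma prime_map:
  assumes "i \<in> S"
  shows "p i \<in> \<Lambda>" "iso (P i) (I (p i))"
proof -
  have i: "i \<in> \<Lambda>" "injective sA (P i)" using assms by (auto simp: S_iff)
  obtain q where "q \<in> Hom (P i) (L i)" "q ` carrier (P i) = carrier (L i)"
    "maximal_submodule (ker_on (P i) q) (P i)" by (rule top_P[OF i(1)])
  then obtain k where "k \<in> \<Lambda>" "iso (P i) (I k)"
    using injective_local_iso_envelope[OF fd_mod_cover[OF i(1)] i(2) _ simples envelopes] by blast
  then show "p i \<in> \<Lambda>" "iso (P i) (I (p i))" using prime_map_eq[OF i(1)] by auto
qed

text \<open>The least nonzero submodule of the envelope \<open>I (p i)\<close> is carried over to
  \<open>P i\<close> and identified there with the socle.\<close>

lemma socle_P:
  assumes "i \<in> S"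
  obtains e where "e \<in> Hom (L (p i)) (P i)" "inj_on e (carrier (L (p i)))"
    "minimal_submodule (e ` carrier (L (p i))) (P i)" "e ` carrier (L (p i)) = socle sV (P i)"
proof -
  have i: "i \<in> \<Lambda>" using assms by (simp add: S_iff)
  note k = prime_map[OF assms]
  obtain j where j: "j \<in> Hom (L (p i)) (I (p i))" "inj_on j (carrier (L (p i)))"
    "minimal_submodule (j ` carrier (L (p i))) (I (p i))"
    using injective_envelope_minimal_submodule[OF fd_mod_L[OF k(1)] simple_L[OF k(1)] vs] envelopes k(1)
    by blast
  obtain f where f: "f \<in> Hom (I (p i)) (P i)" "bij_betw f (carrier (I (p i))) (carrier (P i))"
    using iso_sym[OF fd_mod_cover[OF i] k(2)] unfolding iso_def by blast
  have min: "minimal_submodule ((f \<circ> j) ` carrier (L (p i))) (P i)"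
    using minimal_submodule_iso[OF fd_mod_I[OF k(1)] f j(3)] by (simp only: image_comp)
  have "inj_on f (j ` carrier (L (p i)))"
    using f(2) Hom_closed[OF j(1)] unfolding bij_betw_def by (auto intro: inj_on_subset)
  then have "inj_on (f \<circ> j) (carrier (L (p i)))" using comp_inj_on j(2) by blast
  moreover have "(f \<circ> j) ` carrier (L (p i)) = socle sV (P i)"
    using fd_mod.socle_minimal_submodule[OF fd_mod_cover[OF i] min] by simp
  ultimately show ?thesis using that[OF Hom_comp[OF j(1) f(1)]] min by blast
qed

lemma minimal_socle: "i \<in> S \<Longrightarrow> minimal_submodule (socle sV (P i)) (P i)"
  using socle_P by metis

text \<open>Only two properties of the form are kept: it vanishes off the positions from
  \<open>i\<close> to \<open>p i\<close> and is 1 on each \<theta>. This covers both the canonical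
  forms and the trace constructed by hand.\<close>

lemma nondegenerate_socle_trace:
  assumes "involution_on S p" "socle_maps sV S P p \<theta>"
    and "linear_form (fscale (fscale sV)) (End_sum S P) tr"
    and "\<And>i j h. i \<in> S \<Longrightarrow> j \<in> S \<Longrightarrow> h \<in> Hom (P i) (P j) \<Longrightarrow> j \<noteq> p i \<Longrightarrow> tr (block S P i j h) = 0"
    and "\<And>i. i \<in> S \<Longrightarrow> tr (block S P i (p i) (\<theta> i)) = 1"
  shows "nondegenerate (End_sum S P) (induced_form (\<circ>) tr)"
proof (rule nondegenerate_trace[OF assms(1,3,4,5)])
  have p: "p i \<in> S" "p (p i) = i" if "i \<in> S" for i
    using assms(1) that unfolding involution_on_def by auto
  have \<theta>: "\<theta> i \<in> Hom (P i) (P (p i))" "\<theta> i ` carrier (P i) = socle sV (P (p i))" if "i \<in> S" for i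
    using assms(2) that unfolding socle_maps_def by auto
  have \<Lambda>: "i \<in> \<Lambda>" "injective sA (P i)" if "i \<in> S" for i using that by (auto simp: S_iff)
  show "\<exists>g\<in>Hom (P (p j)) (P i). f \<circ> g = \<theta> (p j)"
    if "i \<in> S" "j \<in> S" "f \<in> Hom (P i) (P j)" "f \<noteq> 0" for i j f
  proof -
    \<comment> \<open>The involution rewrites the target \<open>P (p (p j))\<close> as
      \<open>P j\<close>, where \<open>f\<close> ends.\<close>
    have "\<theta> (p j) \<in> Hom (P (p j)) (P j)" "\<theta> (p j) ` carrier (P (p j)) \<subseteq> socle sV (P j)"
      using \<theta>[OF p(1)[OF that(2)]] p(2)[OF that(2)] by auto
    then show ?thesis
      using factor_through_projective[OF fd_mod_cover[OF \<Lambda>(1)[OF that(1)]] fd_mod_cover[OF \<Lambda>(1)[OF that(2)]]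
          projective_P[OF \<Lambda>(1)[OF p(1)[OF that(2)]]] that(3,4) minimal_socle[OF that(2)]]
      by blast
  qed
  show "\<exists>g\<in>Hom (P j) (P (p i)). g \<circ> f = \<theta> i"
    if *: "i \<in> S" "j \<in> S" "f \<in> Hom (P i) (P j)" "f \<noteq> 0" for i j f
  proof -
    obtain q where "q \<in> Hom (P i) (L i)" "q ` carrier (P i) = carrier (L i)"
      "maximal_submodule (ker_on (P i) q) (P i)" by (rule top_P[OF \<Lambda>(1)[OF *(1)]])
    then show ?thesis
      \<comment> \<open>The extension has values in \<open>P (p i)\<close>, which is injective
        because \<open>p i\<close> lies in \<open>S\<close> again.\<close>
      using factor_through_injective[OF fd_mod_cover[OF \<Lambda>(1)[OF *(1)]] fd_mod_cover[OF \<Lambda>(1)[OF *(2)]]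
          fd_mod_cover[OF \<Lambda>(1)[OF p(1)[OF *(1)]]] \<Lambda>(2)[OF p(1)[OF *(1)]] *(3,4) _
          minimal_socle[OF p(1)[OF *(1)]] \<theta>[OF *(1)]]
      by blast
  qed
qed

text \<open>Since \<open>p (p i) = i\<close>, the socle of \<open>P (p i)\<close> is a copy of
  \<open>L i\<close>, which is also the top of \<open>P i\<close>; the map is the projection to the
  top followed by the embedding as socle.\<close>

lemma exists_socle_maps:
  assumes "involution_on S p"
  obtains \<theta> where "socle_maps sV S P p \<theta>"
proof -
  have "\<exists>t. t \<in> Hom (P i) (P (p i)) \<and> t \<noteq> 0 \<and> t ` carrier (P i) = socle sV (P (p i))" if i: "i \<in> S" for i
  proof -
    have p: "p i \<in> S" "p (p i) = i" using assms i unfolding involution_on_def by auto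
    have \<Lambda>: "i \<in> \<Lambda>" using i by (simp add: S_iff)
    obtain q where q: "q \<in> Hom (P i) (L i)" "q ` carrier (P i) = carrier (L i)"
      "maximal_submodule (ker_on (P i) q) (P i)" by (rule top_P[OF \<Lambda>])
    obtain e where e: "e \<in> Hom (L i) (P (p i))" "minimal_submodule (e ` carrier (L i)) (P (p i))"
      "e ` carrier (L i) = socle sV (P (p i))"
      using socle_P[OF p(1)] p(2) by metis
    have im: "(e \<circ> q) ` carrier (P i) = socle sV (P (p i))" using q(2) e(3) by (metis image_comp)
    have t: "e \<circ> q \<in> Hom (P i) (P (p i))" using Hom_comp[OF q(1) e(1)] .
    have "socle sV (P (p i)) \<noteq> {0}" "0 \<in> socle sV (P (p i))"
      using e(2,3) unfolding minimal_submodule_def submodule_def by auto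
    then obtain y where "y \<in> socle sV (P (p i))" "y \<noteq> 0" by blast
    then have "e \<circ> q \<noteq> 0" using im Hom_ne_0[OF t] by (metis (no_types, lifting) imageE)
    then show ?thesis using t im by blast
  qed
  then show ?thesis using that unfolding socle_maps_def by metis
qed

lemma canonical_form_nondegenerate:
  assumes "involution_on S p" "socle_maps sV S P p \<theta>" "appropriate_basis sV S P p \<theta> \<Upsilon>"
    and "canonical_form sV S P p \<theta> \<Upsilon> tr"
  shows "nondegenerate (End_sum S P) (induced_form (\<circ>) tr)"
proof (rule nondegenerate_socle_trace[OF assms(1,2)])
  show "linear_form (fscale (fscale sV)) (End_sum S P) tr"
    using assms(4) unfolding canonical_form_def by blast
  show "tr (block S P i (p i) (\<theta> i)) = 1" if "i \<in> S" for i
    using assms(4) that unfolding canonical_form_def theta_blocks_def by blast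
  show "tr (block S P i j h) = 0" if "i \<in> S" "j \<in> S" "h \<in> Hom (P i) (P j)" "j \<noteq> p i" for i j h
    by (rule canonical_form_block_0[OF assms(3,4,2) _ that])
      (use assms(1) in \<open>auto simp: involution_on_def\<close>)
qed

lemma frobenius_algebra_End_sum:
  assumes "involution_on S p"
  shows "frobenius_algebra (fscale (fscale sV)) (End_sum S P) (\<circ>) (End_one S P)"
proof -
  obtain \<theta> where \<theta>: "socle_maps sV S P p \<theta>" by (rule exists_socle_maps[OF assms])
  obtain tr where tr: "linear_form (fscale (fscale sV)) (End_sum S P) tr"
    "\<And>i j h. i \<in> S \<Longrightarrow> j \<in> S \<Longrightarrow> h \<in> Hom (P i) (P j) \<Longrightarrow> j \<noteq> p i \<Longrightarrow> tr (block S P i j h) = 0"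
    "\<And>i. i \<in> S \<Longrightarrow> tr (block S P i (p i) (\<theta> i)) = 1"
    using exists_trace[OF \<theta>] assms unfolding involution_on_def by metis
  have "nondegenerate (End_sum S P) (induced_form (\<circ>) tr)"
    by (rule nondegenerate_socle_trace[OF assms \<theta> tr])
  then show ?thesis unfolding frobenius_algebra_def using fd_algebra_End_sum tr(1) by blast
qed

text \<open>Both modules are injective essential extensions of \<open>L i\<close>: for the dual of
  \<open>P i\<close>, essentiality is the dual of having a greatest proper submodule, and the
  hypothesis on \<open>L i\<close> identifies the simple module inside.\<close>

lemma dual_P_iso_I:
  assumes "anti_involution sA star" "i \<in> \<Lambda>" "iso (dual star sV (L i)) (L i)"
  shows "iso (dual star sV (P i)) (I i)"
proof -
  note P = fd_mod_cover[OF assms(2)] and L = fd_mod_L[OF assms(2)]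
  obtain j where j: "j \<in> Hom (L i) (dual star sV (P i))" "inj_on j (carrier (L i))"
    "essential (j ` carrier (L i)) (dual star sV (P i))"
    using dual_cover_essential[OF alg assms(1) L simple_L[OF assms(2)] assms(3)] covers assms(2) by blast
  obtain k where k: "k \<in> Hom (L i) (I i)" "inj_on k (carrier (L i))"
    "essential (k ` carrier (L i)) (I i)"
    using envelopes assms(2) unfolding injective_envelope_def by blast
  show ?thesis
    by (rule injective_essential_extension_unique[OF L fd_mod.dual_fd_mod[OF P alg assms(1)]
          fd_mod_I[OF assms(2)] dual_projective_injective[OF alg assms(1) P projective_P[OF assms(2)]]
          injective_I[OF assms(2)] j k])
qed

text \<open>From \<open>P\<^sup>i \<cong> I\<^sup>k \<cong> (P\<^sup>k)\<^sup>*\<close> with \<open>k = i'\<close>, transposing gives \<open>P\<^sup>k \<cong> (P\<^sup>i)\<^sup>* \<cong> I\<^sup>i\<close>.\<close>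

lemma involution_of_simple_duality:
  assumes "anti_involution sA star" "\<forall>i\<in>\<Lambda>. iso (dual star sV (L i)) (L i)"
  shows "involution_on S p"
  unfolding involution_on_def
proof (intro ballI)
  fix i assume "i \<in> S"
  then have i: "i \<in> \<Lambda>" by (simp add: S_iff)
  let ?k = "p i"
  note k = prime_map[OF \<open>i \<in> S\<close>]
  have dual_iso: "iso (dual star sV (P j)) (I j)" if "j \<in> \<Lambda>" for j
    using dual_P_iso_I[OF assms(1) that] assms(2) that by blast
  have D: "fd_mod (fscale (*)) sA (dual star sV (P j))" if "j \<in> \<Lambda>" for j
    using fd_mod.dual_fd_mod[OF fd_mod_cover[OF that] alg assms(1)] .
  have "iso (P i) (dual star sV (P ?k))"
    using iso_trans[OF k(2) iso_sym[OF D[OF k(1)] dual_iso[OF k(1)]]] .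
  then have "iso (P ?k) (dual star sV (P i))"
    by (rule iso_dual_transpose[OF alg assms(1) fd_mod_cover[OF i] fd_mod_cover[OF k(1)]])
  then have PI: "iso (P ?k) (I i)" using dual_iso[OF i] by (rule iso_trans)
  \<comment> \<open>The isomorphism with \<open>I i\<close> does double duty: it puts
    \<open>?k\<close> into \<open>S\<close>, and by uniqueness of the index it gives
    \<open>p ?k = i\<close>.\<close>
  have "injective sA (P ?k)"
    using injective_iso[OF fd_mod_I[OF i] injective_I[OF i] iso_sym[OF fd_mod_cover[OF k(1)] PI]] .
  then show "?k \<in> S \<and> p ?k = i"
    using k(1) prime_map_eq[OF k(1) i PI] by (simp add: S_iff)
qed

end

theorem proposition2p11:
  fixes sA :: "'k::alg_closed_field \<Rightarrow> 'a::ring_1 \<Rightarrow> 'a"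
    and sV :: "'k \<Rightarrow> 'v::ab_group_add \<Rightarrow> 'v"
    and \<Lambda> \<Lambda>0 :: "'l set"
    and L P I :: "'l \<Rightarrow> ('a, 'v) amod"
    and p :: "'l \<Rightarrow> 'l"
    and B :: "(('l \<Rightarrow> 'v) \<Rightarrow> ('l \<Rightarrow> 'v)) set"
  assumes "fd_algebra sA UNIV (*) 1"
    and "vector_space sV"
    and "finite \<Lambda>"
    and "complete_simples sA sV \<Lambda> L"
    and "\<forall>i\<in>\<Lambda>. projective_cover sA sV (P i) (L i)"
    and "\<forall>i\<in>\<Lambda>. injective_envelope sA sV (I i) (L i)"
    and "\<Lambda>0 = Lambda0 sA \<Lambda> P"
    and "\<Lambda>0 \<noteq> {}"
    and "p = prime_map \<Lambda> P I"
    and "B = End_sum \<Lambda>0 P"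
  shows "(involution_on \<Lambda>0 p \<longrightarrow>
           (\<forall>\<theta> \<Upsilon> tr. socle_maps sV \<Lambda>0 P p \<theta> \<longrightarrow>
              appropriate_basis sV \<Lambda>0 P p \<theta> \<Upsilon> \<longrightarrow>
              canonical_form sV \<Lambda>0 P p \<theta> \<Upsilon> tr \<longrightarrow>
              nondegenerate B (induced_form (\<circ>) tr)) \<and>
           frobenius_algebra (fscale (fscale sV)) B (\<circ>) (End_one \<Lambda>0 P)) \<and>
         (\<forall>star. anti_involution sA star \<and> (\<forall>i\<in>\<Lambda>. iso (dual star sV (L i)) (L i)) \<longrightarrow>
           frobenius_algebra (fscale (fscale sV)) B (\<circ>) (End_one \<Lambda>0 P))"
proof -
  interpret proj_inj_setup sA sV \<Lambda> L P I
    using assms(1-6) by (rule proj_inj_setup.intro)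
  show ?thesis
    unfolding assms(7,9,10)
    using canonical_form_nondegenerate frobenius_algebra_End_sum involution_of_simple_duality by blast
qed

end
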